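(* Let $H$ be an infinite-dimensional separable complex Hilbert space and let $A:H\to H$ be a bounded antilinear skew-self-adjoint operator such that either $\dim N(A)=\infty$ or $\dim N(A)$ is (finite and) even. Let $1<p<\infty$. Then for every $\epsilon>0$ there exist an antilinear block skew-diagonal operator $D$ on $H$ and an antilinear skew-self-adjoint Schatten $p$-class operator $K$ on $H$ such that $A=K+D$ and $\|K\|_p<\epsilon$.
   Context: A map $A:H\to H$ is antilinear if $A(x+y)=Ax+Ay$ and $A(\alpha x)=\bar\alpha Ax$ for all $x,y\in H$, $\alpha\in\mathbb C$. For a bounded antilinear $A$, its antilinear adjoint $A^{\#}$ is the unique bounded antilinear operator with $\langle Ax,y\rangle=\overline{\langle x,A^{\#}y\rangle}$ for all $x,y\in H$. $A$ is (antilinear) skew-self-adjoint if $A^{\#}=-A$. $N(A)=\{x\in H: Ax=0\}$; the dimension $0$ counts as even. For antilinear $A$, $|A|$ is the positive square root of the positive linear operator $A^{\#}A$. A compact antilinear operator $K$ is in the Schatten $p$-class if $\|K\|_p=\left(\sum_n s_n(K)^p\right)^{1/p}<\infty$, where $s_n(K)$ are the singular values of $K$, i.e. the eigenvalues of $|K|=(K^{\#}K)^{1/2}$ counted with multiplicity. A bounded antilinear operator $D$ on $H$ is block skew-diagonal if there exist a sequence $(d_n)_{n\in\mathbb N}$ of complex numbers and an orthonormal basis $\{e_n,f_n:n\in\mathbb N\}$ of $H$ such that $De_n=d_nf_n$ and $Df_n=-d_ne_n$ for all $n\in\mathbb N$. *)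

theory Defs
  imports "HOL-Analysis.Analysis"
begin

text \<open>
  A complex Hilbert space is a type carrying a complex scalar multiplication and a complex inner
  product (linear in the first argument). Building on \<^class>\<open>real_inner\<close> is no restriction: the
  real inner product is required to be the real part of the complex one, so that
  \<open>norm x = sqrt (Re (cinner x x))\<close>, and the positive definiteness of \<open>cinner\<close> follows from that
  of \<open>inner\<close> because \<open>cinner x x\<close> is real by conjugate symmetry.
\<close>

class complex_vector = real_vector +
  fixes scaleC :: "complex \<Rightarrow> 'a \<Rightarrow> 'a"  (infixr \<open>*\<^sub>C\<close> 75)
  assumes scaleC_add_right: "a *\<^sub>C (x + y) = a *\<^sub>C x + a *\<^sub>C y"
    and scaleC_add_left: "(a + b) *\<^sub>C x = a *\<^sub>C x + b *\<^sub>C x"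
    and scaleC_scaleC: "a *\<^sub>C b *\<^sub>C x = (a * b) *\<^sub>C x"
    and scaleC_one: "1 *\<^sub>C x = x"
    and scaleR_scaleC: "r *\<^sub>R x = complex_of_real r *\<^sub>C x"

class complex_inner = complex_vector + real_inner +
  fixes cinner :: "'a \<Rightarrow> 'a \<Rightarrow> complex"
  assumes cinner_commute: "cinner x y = cnj (cinner y x)"
    and cinner_add_left: "cinner (x + y) z = cinner x z + cinner y z"
    and cinner_scaleC_left: "cinner (a *\<^sub>C x) y = a * cinner x y"
    and inner_Re_cinner: "inner x y = Re (cinner x y)"

class chilbert_space = complex_inner + complete_space

interpretation complex_vector: vector_space "scaleC :: complex \<Rightarrow> 'a \<Rightarrow> 'a::complex_vector"
  by unfold_locales (simp_all add: scaleC_add_right scaleC_add_left scaleC_scaleC scaleC_one)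

text \<open>
  Since \<^const>\<open>vector_space.dim\<close> is \<open>0\<close> on infinite-dimensional subspaces,
  finite-dimensionality has to be stated separately.
\<close>

definition finite_cdim :: "'a::complex_vector set \<Rightarrow> bool" where
  "finite_cdim V \<longleftrightarrow> (\<exists>B. finite B \<and> V \<subseteq> complex_vector.span B)"

definition antilinear :: "('a::complex_vector \<Rightarrow> 'a) \<Rightarrow> bool" where
  "antilinear A \<longleftrightarrow> (\<forall>x y. A (x + y) = A x + A y) \<and> (\<forall>c x. A (c *\<^sub>C x) = cnj c *\<^sub>C A x)"

definition bounded_antilinear :: "('a::complex_inner \<Rightarrow> 'a) \<Rightarrow> bool" where
  "bounded_antilinear A \<longleftrightarrow> antilinear A \<and> (\<exists>C. \<forall>x. norm (A x) \<le> C * norm x)"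

definition bounded_clinear :: "('a::complex_inner \<Rightarrow> 'a) \<Rightarrow> bool" where
  "bounded_clinear T \<longleftrightarrow> Vector_Spaces.linear scaleC scaleC T \<and> (\<exists>C. \<forall>x. norm (T x) \<le> C * norm x)"

definition antilinear_adjoint :: "('a::complex_inner \<Rightarrow> 'a) \<Rightarrow> 'a \<Rightarrow> 'a" where
  "antilinear_adjoint A =
    (THE B. bounded_antilinear B \<and> (\<forall>x y. cinner (A x) y = cnj (cinner x (B y))))"

definition skew_self_adjoint :: "('a::complex_inner \<Rightarrow> 'a) \<Rightarrow> bool" where
  "skew_self_adjoint A \<longleftrightarrow> bounded_antilinear A \<and> antilinear_adjoint A = (\<lambda>x. - A x)"

definition null_space :: "('a::complex_vector \<Rightarrow> 'a) \<Rightarrow> 'a set" where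
  "null_space A = {x. A x = 0}"

definition positive_operator :: "('a::complex_inner \<Rightarrow> 'a) \<Rightarrow> bool" where
  "positive_operator T \<longleftrightarrow> bounded_clinear T \<and> (\<forall>x. cinner (T x) x \<in> \<real>\<^sub>\<ge>\<^sub>0)"

definition antilinear_abs :: "('a::complex_inner \<Rightarrow> 'a) \<Rightarrow> 'a \<Rightarrow> 'a" where
  "antilinear_abs A = (THE T. positive_operator T \<and> T \<circ> T = antilinear_adjoint A \<circ> A)"

definition compact_antilinear :: "('a::complex_inner \<Rightarrow> 'a) \<Rightarrow> bool" where
  "compact_antilinear K \<longleftrightarrow> antilinear K \<and> compact (closure (K ` cball 0 1))"

text \<open>
  The singular values are counted with multiplicity by weighting each eigenvalue \<open>s\<close> of \<open>|K|\<close>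
  with the dimension of its eigenspace, i.e. \<open>\<Sum>\<^sub>n s\<^sub>n(K)\<^sup>p\<close> becomes the sum of
  \<open>singular_value_mult K s * s powr p\<close> over the distinct singular values \<open>s\<close>. All eigenvalues of the
  positive operator \<open>|K|\<close> are real, and for compact \<open>K\<close> the eigenspaces for \<open>s > 0\<close> are
  finite-dimensional; the eigenvalue \<open>s = 0\<close> contributes \<open>0\<close> whatever its multiplicity.
\<close>

definition singular_values :: "('a::complex_inner \<Rightarrow> 'a) \<Rightarrow> real set" where
  "singular_values K = {s. \<exists>x. x \<noteq> 0 \<and> antilinear_abs K x = s *\<^sub>R x}"

definition singular_value_mult :: "('a::complex_inner \<Rightarrow> 'a) \<Rightarrow> real \<Rightarrow> nat" where
  "singular_value_mult K s = complex_vector.dim {x. antilinear_abs K x = s *\<^sub>R x}"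

definition schatten_class :: "real \<Rightarrow> ('a::complex_inner \<Rightarrow> 'a) \<Rightarrow> bool" where
  "schatten_class p K \<longleftrightarrow> compact_antilinear K \<and>
    (\<lambda>s. real (singular_value_mult K s) * s powr p) summable_on singular_values K"

definition schatten_norm :: "real \<Rightarrow> ('a::complex_inner \<Rightarrow> 'a) \<Rightarrow> real" where
  "schatten_norm p K =
    (\<Sum>\<^sub>\<infinity>s\<in>singular_values K. real (singular_value_mult K s) * s powr p) powr (1 / p)"

definition orthonormal_basis :: "('i \<Rightarrow> 'a::complex_inner) \<Rightarrow> bool" where
  "orthonormal_basis b \<longleftrightarrow> (\<forall>i j. cinner (b i) (b j) = (if i = j then 1 else 0)) \<and>
    closure (complex_vector.span (range b)) = UNIV"

text \<open>The basis \<open>{e\<^sub>n, f\<^sub>n : n \<in> \<nat>}\<close> is indexed by the disjoint union of two copies of the naturals.\<close>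

definition block_skew_diagonal :: "('a::complex_inner \<Rightarrow> 'a) \<Rightarrow> bool" where
  "block_skew_diagonal D \<longleftrightarrow> bounded_antilinear D \<and>
    (\<exists>(d :: nat \<Rightarrow> complex) (e :: nat \<Rightarrow> 'a) (f :: nat \<Rightarrow> 'a).
      orthonormal_basis (case_sum e f) \<and>
      (\<forall>n. D (e n) = d n *\<^sub>C f n \<and> D (f n) = - (d n *\<^sub>C e n)))"

end

theory Submission
  imports Defs
begin

text \<open>
  On \<open>X = N(A)\<^sup>\<bottom>\<close> the polar decomposition \<open>A = U \<bar>A\<bar>\<close> has an antiunitary \<open>U\<close> commuting with \<open>\<bar>A\<bar>\<close> and
  satisfying \<open>U\<^sup>2 = -1\<close>, so \<open>X\<close> is a quaternionic Hilbert space and \<open>\<bar>A\<bar>\<close> a quaternionic-linear positive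
  operator. The Weyl--von Neumann--Kuroda argument then works over the quaternions: given a vector \<open>x\<close>
  orthogonal to the finitely many blocks found so far, compress \<open>\<bar>A\<bar>\<close> to the orthogonal complement of
  these blocks and split \<open>x\<close> into \<open>m\<close> spectral components \<open>x\<^sub>k\<close>; the pairs \<open>x\<^sub>k, U x\<^sub>k\<close> are approximate
  blocks with errors \<open>O(1/m)\<close>, and \<open>m (1/m)\<^sup>q\<close> tends to \<open>0\<close> for \<open>q > 1\<close>. Blocks inside \<open>N(A)\<close> are pairs of
  orthonormal kernel vectors, which never run out by the parity hypothesis.
  Exhausting a dense sequence gives a basis \<open>b\<^sub>m\<close> in which \<open>K = A - D\<close> has a small strictly upper
  triangular part \<open>R\<close>, whence \<open>\<parallel>K\<parallel>\<^sub>q\<^sup>q \<le> 2\<^sup>q \<Sum>\<^sub>m \<parallel>R b\<^sub>m\<parallel>\<^sup>q\<close> for \<open>1 < q \<le> 2\<close>; the case \<open>p > 2\<close> follows by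
  taking \<open>q = 2\<close>.
\<close>

section \<open>Positive operators on real Hilbert spaces\<close>

text \<open>Square roots and spectral projections are built over the real inner product. There
  \<open>U\<close> and multiplication by \<i> are just bounded skew-adjoint operators, and the
  quaternionic structure is expressed only by commutation with them. The form <A x, y> is
  antisymmetric. Hence x and U x are orthogonal, which produces two-dimensional blocks, and the
  matrix of K in an orthonormal basis is determined by its entries <K b_m, b_l> with m < l. A
  component of K b_m in the span of earlier basis vectors is therefore free: it only repeats, up to
  sign, what the errors of those earlier vectors already account for. This makes it harmless to
  compress to the complement of the blocks found so far. The obstacle is that m pieces with errors
  C/m add up to C under the triangle inequality, however large m is. So the q-norm of K has to be
  estimated from the q-th powers of the errors directly. The constant 2^q comes from cutting the
  form into its two triangles: convexity gives 2^(q-1), and there are two summands.\<close>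

definition selfadj :: "('a::real_inner \<Rightarrow> 'a) \<Rightarrow> bool" where
  "selfadj T \<longleftrightarrow> bounded_linear T \<and> (\<forall>x y. inner (T x) y = inner x (T y))"

definition pos_op :: "('a::real_inner \<Rightarrow> 'a) \<Rightarrow> bool" where
  "pos_op T \<longleftrightarrow> selfadj T \<and> (\<forall>x. 0 \<le> inner (T x) x)"

definition orth_proj :: "('a::real_inner \<Rightarrow> 'a) \<Rightarrow> bool" where
  "orth_proj P \<longleftrightarrow> selfadj P \<and> (\<forall>x. P (P x) = P x)"

lemma selfadjD:
  assumes "selfadj T"
  shows "bounded_linear T" "linear T" "inner (T x) y = inner x (T y)"
    "T (x + y) = T x + T y" "T (x - y) = T x - T y" "T (c *\<^sub>R x) = c *\<^sub>R T x" "T 0 = 0" "T (- x) = - T x"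
proof -
  show b: "bounded_linear T" and "inner (T x) y = inner x (T y)"
    using assms by (auto simp: selfadj_def)
  show l: "linear T" by (rule bounded_linear.linear[OF b])
  show "T (x + y) = T x + T y" "T (x - y) = T x - T y" "T (c *\<^sub>R x) = c *\<^sub>R T x" "T 0 = 0" "T (- x) = - T x"
    using l by (auto simp: linear_add linear_diff linear_scale linear_0 linear_neg)
qed

lemma pos_opD: "pos_op T \<Longrightarrow> selfadj T" "pos_op T \<Longrightarrow> 0 \<le> inner (T x) x"
  by (auto simp: pos_op_def)

lemma orth_projD: "orth_proj P \<Longrightarrow> selfadj P" "orth_proj P \<Longrightarrow> P (P x) = P x"
  by (auto simp: orth_proj_def)

lemma orth_proj_norm_le:
  assumes "orth_proj P"
  shows "norm (P x) \<le> norm x"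
proof -
  have "norm (P x) ^ 2 = inner (P x) x"
    using orth_projD[OF assms] selfadjD[OF orth_projD(1)[OF assms]]
    by (metis power2_norm_eq_inner)
  also have "\<dots> \<le> norm (P x) * norm x" by (rule norm_cauchy_schwarz)
  finally show ?thesis
    by (cases "P x = 0") (auto simp: power2_eq_square)
qed

lemma orth_proj_compl:
  assumes "orth_proj P"
  shows "orth_proj (\<lambda>x. x - P x)"
proof -
  note P = selfadjD[OF orth_projD(1)[OF assms]] and PP = orth_projD(2)[OF assms]
  show ?thesis unfolding orth_proj_def selfadj_def
    using P PP by (auto simp: inner_diff_left inner_diff_right intro!: bounded_linear_sub bounded_linear_ident)
qed

text \<open>If \<open>B\<close> is self-adjoint or skew-adjoint, invariance of the range already makes it reducing.\<close>

lemma orth_proj_commute: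
  fixes B :: "'a::real_inner \<Rightarrow> 'a"
  assumes P: "orth_proj P" and B: "\<And>x y. inner (B x) y = c * inner x (B y)"
    and inv: "\<And>x. P (B (P x)) = B (P x)"
  shows "P (B x) = B (P x)"
proof -
  note Pd = selfadjD[OF orth_projD(1)[OF P]]
  have "inner (P (B x)) y = inner (B (P x)) y" for y
  proof -
    have "inner (P (B x)) y = c * inner x (B (P y))" by (simp add: Pd B)
    also have "\<dots> = c * inner (P x) (B (P y))" by (subst inv[symmetric]) (simp add: Pd(3)[symmetric])
    also have "\<dots> = inner (B (P x)) (P y)" by (simp add: B)
    also have "\<dots> = inner (B (P x)) y" by (metis Pd(3) inv)
    finally show ?thesis .
  qed
  then show ?thesis by (metis inner_diff_left inner_eq_zero_iff eq_iff_diff_eq_0)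
qed

section \<open>Orthogonal projection onto a closed subspace\<close>

lemma nearest_point_exists:
  fixes V :: "'a::{real_inner,complete_space} set"
  assumes V: "subspace V" and cl: "closed V"
  shows "\<exists>y\<in>V. \<forall>v\<in>V. inner (x - y) v = 0"
proof -
  define S where "S = (\<lambda>v. (norm (x - v))\<^sup>2) ` V"
  define D where "D = Inf S"
  have ne: "S \<noteq> {}" using subspace_0[OF V] by (auto simp: S_def)
  have bb: "bdd_below S" by (rule bdd_belowI[of _ 0]) (auto simp: S_def)
  have lower: "D \<le> (norm (x - v))\<^sup>2" if "v \<in> V" for v
    unfolding D_def by (rule cInf_lower[OF _ bb]) (use that in \<open>auto simp: S_def\<close>)
  have "\<exists>v\<in>V. (norm (x - v))\<^sup>2 < D + 1 / real (Suc n)" for n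
  proof -
    have "Inf S < D + 1 / real (Suc n)" by (simp add: D_def)
    from cInf_lessD[OF ne this] show ?thesis by (auto simp: S_def)
  qed
  then obtain y where yV: "\<And>n. y n \<in> V" and yD: "\<And>n. (norm (x - y n))\<^sup>2 < D + 1 / real (Suc n)"
    by metis
  \<comment> \<open>Parallelogram law: the midpoint of two nearly minimal points lies in
    \<open>V\<close>, so it cannot be much closer to \<open>x\<close>, which forces the points
    together.\<close>
  have para: "(norm (y m - y n))\<^sup>2 \<le> 2 / real (Suc m) + 2 / real (Suc n)" for m n
  proof -
    have "(1/2) *\<^sub>R (y m + y n) \<in> V" using V yV by (simp add: subspace_add subspace_scale)
    then have "D \<le> (norm (x - (1/2) *\<^sub>R (y m + y n)))\<^sup>2" by (rule lower)
    moreover have "(norm (y m - y n))\<^sup>2 = 2 * (norm (x - y m))\<^sup>2 + 2 * (norm (x - y n))\<^sup>2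
        - 4 * (norm (x - (1/2) *\<^sub>R (y m + y n)))\<^sup>2"
      by (simp add: power2_norm_eq_inner inner_diff_left inner_diff_right inner_add_left inner_add_right
          inner_commute field_simps)
    ultimately show ?thesis using yD[of m] yD[of n] by simp
  qed
  have "Cauchy y"
  proof (rule metric_CauchyI)
    fix e :: real assume e: "e > 0"
    obtain N where N: "4 / e\<^sup>2 < real N" using reals_Archimedean2 by blast
    have "dist (y m) (y n) < e" if "m \<ge> N" "n \<ge> N" for m n
    proof -
      have "2 / real (Suc k) < e\<^sup>2 / 2" if "k \<ge> N" for k
      proof -
        have "4 / e\<^sup>2 < real (Suc k)" using N that by linarith
        then show ?thesis using e by (simp add: field_simps)
      qed
      from this[OF that(1)] this[OF that(2)] para[of m n] have "(norm (y m - y n))\<^sup>2 < e\<^sup>2" by linarith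
      then show ?thesis using e by (simp add: dist_norm power2_less_imp_less)
    qed
    then show "\<exists>M. \<forall>m\<ge>M. \<forall>n\<ge>M. dist (y m) (y n) < e" by blast
  qed
  then obtain z where z: "y \<longlonglongrightarrow> z" using Cauchy_convergent convergent_def by blast
  have zV: "z \<in> V" using closed_sequentially[OF cl] yV z by blast
  have "(\<lambda>n. (norm (x - y n))\<^sup>2) \<longlonglongrightarrow> (norm (x - z))\<^sup>2" by (intro tendsto_intros z)
  moreover have "(\<lambda>n. D + 1 / real (Suc n)) \<longlonglongrightarrow> D + 0"
    by (intro tendsto_intros LIMSEQ_Suc[OF lim_1_over_n])
  ultimately have "(norm (x - z))\<^sup>2 \<le> D + 0"
    by (rule LIMSEQ_le) (use yD in \<open>auto intro: less_imp_le\<close>)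
  then have zD: "(norm (x - z))\<^sup>2 \<le> D" by simp
  have "inner (x - z) v = 0" if v: "v \<in> V" for v
  proof (rule ccontr)
    assume nz: "inner (x - z) v \<noteq> 0"
    then have vn: "inner v v > 0" by auto
    \<comment> \<open>The distance from \<open>x\<close> to the line through \<open>z\<close> in
      direction \<open>v\<close> is least at this \<open>t\<close>.\<close>
    define t where "t = inner (x - z) v / inner v v"
    have "z + t *\<^sub>R v \<in> V" using V zV v by (simp add: subspace_add subspace_scale)
    then have "(norm (x - z))\<^sup>2 \<le> (norm (x - (z + t *\<^sub>R v)))\<^sup>2" using lower[of "z + t *\<^sub>R v"] zD by linarith
    also have "\<dots> = (norm (x - z))\<^sup>2 - 2 * t * inner (x - z) v + t\<^sup>2 * inner v v"
      by (simp add: power2_norm_eq_inner inner_diff_left inner_diff_right inner_add_left inner_add_right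
          inner_commute power2_eq_square[of t] algebra_simps)
    also have "t\<^sup>2 * inner v v = t * inner (x - z) v" using vn by (simp add: t_def power2_eq_square)
    finally have "t * inner (x - z) v \<le> 0" by simp
    moreover have "t * inner (x - z) v = (inner (x - z) v)\<^sup>2 / inner v v"
      by (simp add: t_def power2_eq_square)
    moreover have "(inner (x - z) v)\<^sup>2 / inner v v > 0" using nz vn by simp
    ultimately show False by simp
  qed
  with zV show ?thesis by blast
qed

text \<open>Only one point of \<open>V\<close> has residual orthogonal to \<open>V\<close>, so
  linearity and idempotence of \<open>P\<close> reduce to testing the expected candidate.\<close>

lemma ex_orth_proj:
  fixes V :: "'a::{real_inner,complete_space} set"
  assumes V: "subspace V" and cl: "closed V"
  obtains P where "orth_proj P" "\<And>x. P x \<in> V" "\<And>x. x \<in> V \<Longrightarrow> P x = x"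
    "\<And>x v. v \<in> V \<Longrightarrow> inner (x - P x) v = 0"
    "\<And>x. (\<And>v. v \<in> V \<Longrightarrow> inner x v = 0) \<Longrightarrow> P x = 0"
proof -
  obtain P where PV: "\<And>x. P x \<in> V" and Po: "\<And>x v. v \<in> V \<Longrightarrow> inner (x - P x) v = 0"
    using nearest_point_exists[OF assms] by metis
  have uniq: "P x = y" if "y \<in> V" "\<And>v. v \<in> V \<Longrightarrow> inner (x - y) v = 0" for x y
  proof -
    have "P x - y \<in> V" using V PV that by (simp add: subspace_diff)
    then have "inner (P x - y) (P x - y) = 0"
      using Po[of "P x - y" x] that(2)[of "P x - y"] by (simp add: inner_diff_left)
    then show ?thesis by simp
  qed
  have PP: "P (P x) = P x" for x by (rule uniq[OF PV]) simp
  have add: "P (x + y) = P x + P y" for x y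
    by (rule uniq) (use V PV Po[of _ x] Po[of _ y] in \<open>auto simp: subspace_add inner_diff_left inner_add_left\<close>)
  have sc: "P (c *\<^sub>R x) = c *\<^sub>R P x" for c x
    by (rule uniq) (use V PV Po[of _ x] in \<open>auto simp: subspace_scale inner_diff_left\<close>)
  have sa: "inner (P x) y = inner x (P y)" for x y
    using Po[OF PV[of y], of x] Po[OF PV[of x], of y] by (simp add: inner_diff_left inner_diff_right inner_commute)
  have nle: "norm (P x) \<le> norm x * 1" for x
  proof -
    have "norm (P x) ^ 2 = inner (P x) x" by (metis sa PP power2_norm_eq_inner)
    also have "\<dots> \<le> norm (P x) * norm x" by (rule norm_cauchy_schwarz)
    finally show ?thesis by (cases "P x = 0") (auto simp: power2_eq_square)
  qed
  have "orth_proj P" unfolding orth_proj_def selfadj_def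
    using bounded_linear_intro[of P, OF add sc nle] sa PP by blast
  moreover have "P x = 0" if "\<And>v. v \<in> V \<Longrightarrow> inner x v = 0" for x
    by (rule uniq) (use that subspace_0[OF V] in auto)
  ultimately show thesis using that[of P] PV Po uniq by auto
qed

section \<open>Cauchy-Schwarz and norm bounds for positive operators\<close>

lemma pos_op_cauchy_schwarz:
  assumes "pos_op T"
  shows "(inner (T x) y)\<^sup>2 \<le> inner (T x) x * inner (T y) y"
proof -
  note T = selfadjD[OF pos_opD(1)[OF assms]]
  define a b c where "a = inner (T x) x" and "b = inner (T x) y" and "c = inner (T y) y"
  have quad: "0 \<le> a + 2 * t * b + t\<^sup>2 * c" for t
  proof -
    have "0 \<le> inner (T (x + t *\<^sub>R y)) (x + t *\<^sub>R y)" by (rule pos_opD(2)[OF assms])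
    also have "\<dots> = a + 2 * t * b + t\<^sup>2 * c"
      using T(3)[of y x]
      by (simp add: T a_def b_def c_def inner_add_left inner_add_right power2_eq_square inner_commute algebra_simps)
    finally show ?thesis .
  qed
  have a0: "0 \<le> a" and c0: "0 \<le> c" using pos_opD(2)[OF assms] by (auto simp: a_def c_def)
  have "b\<^sup>2 \<le> a * c"
  proof (cases "c = 0")
    case True
    have "b = 0"
    proof (rule ccontr)
      assume "b \<noteq> 0"
      \<comment> \<open>For \<open>c = 0\<close> the quadratic is affine in \<open>t\<close>, and
        this \<open>t\<close> gives it the value -1.\<close>
      with quad[of "- (a + 1) / (2 * b)"] True show False by (simp add: field_simps)
    qed
    with True show ?thesis by simp
  next
    case False
    with quad[of "- b / c"] c0 show ?thesis by (simp add: power2_eq_square field_simps)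
  qed
  then show ?thesis by (simp add: a_def b_def c_def)
qed

lemma pos_op_zero: "pos_op T \<Longrightarrow> inner (T x) x = 0 \<Longrightarrow> T x = 0"
  using pos_op_cauchy_schwarz[of T x "T x"] by simp

text \<open>Cauchy-Schwarz for the form of \<open>T\<close>, applied to \<open>x\<close> and
  \<open>T x\<close>, turns a bound on the form into a bound on the norm.\<close>

lemma pos_op_norm_le:
  assumes "pos_op T" and le: "\<And>x. inner (T x) x \<le> c * (norm x)\<^sup>2" and c: "0 \<le> c"
  shows "norm (T x) \<le> c * norm x"
proof (cases "T x = 0")
  case False
  have "(norm (T x))\<^sup>2 * (norm (T x))\<^sup>2 = (inner (T x) (T x))\<^sup>2"
    by (simp add: power2_norm_eq_inner power2_eq_square[of "inner (T x) (T x)"])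
  also have "\<dots> \<le> inner (T x) x * inner (T (T x)) (T x)" by (rule pos_op_cauchy_schwarz[OF assms(1)])
  also have "\<dots> \<le> (c * (norm x)\<^sup>2) * (c * (norm (T x))\<^sup>2)"
    by (intro mult_mono le pos_opD(2)[OF assms(1)]) (use c in auto)
  finally have "(norm (T x))\<^sup>2 * (norm (T x))\<^sup>2 \<le> (c * norm x)\<^sup>2 * (norm (T x))\<^sup>2"
    by (simp only: power_mult_distrib power2_eq_square ac_simps)
  then have "(norm (T x))\<^sup>2 \<le> (c * norm x)\<^sup>2" using False by (simp only: mult_le_cancel_right) auto
  then show ?thesis by (rule power2_le_imp_le) (use c in simp)
qed (use c in simp)

lemma selfadj_pos_bound:
  assumes "selfadj T"
  obtains c where "c > 0" "\<And>x. norm (T x) \<le> c * norm x" "\<And>x. \<bar>inner (T x) x\<bar> \<le> c * (norm x)\<^sup>2"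
proof -
  obtain c where c: "c > 0" "\<And>x. norm (T x) \<le> norm x * c"
    using bounded_linear.pos_bounded[OF selfadjD(1)[OF assms]] by blast
  have "\<bar>inner (T x) x\<bar> \<le> c * (norm x)\<^sup>2" for x
  proof -
    have "\<bar>inner (T x) x\<bar> \<le> norm (T x) * norm x" by (rule Cauchy_Schwarz_ineq2)
    also have "\<dots> \<le> (norm x * c) * norm x" using c(2) by (simp add: mult_right_mono)
    finally show ?thesis by (simp add: power2_eq_square algebra_simps)
  qed
  with c that show thesis by (simp add: mult.commute)
qed

section \<open>Square roots of positive operators\<close>

primrec sqrt_majorant :: "nat \<Rightarrow> real" where
  "sqrt_majorant 0 = 0"
| "sqrt_majorant (Suc n) = (1 + (sqrt_majorant n)\<^sup>2) / 2"

text \<open>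
  The iteration \<open>Y\<^bsub>n+1\<^esub> = (Z + Y\<^sub>n\<^sup>2) / 2\<close> for \<open>1 - sqrt (1 - Z)\<close>, whose increments are dominated
  in norm by those of the scalar iteration for \<open>Z = 1\<close>.
\<close>

primrec sqrt_iter :: "('a::real_vector \<Rightarrow> 'a) \<Rightarrow> nat \<Rightarrow> 'a \<Rightarrow> 'a" where
  "sqrt_iter Z 0 = (\<lambda>x. 0)"
| "sqrt_iter Z (Suc n) = (\<lambda>x. (1/2) *\<^sub>R (Z x + sqrt_iter Z n (sqrt_iter Z n x)))"

lemma sqrt_majorant_bounds: "0 \<le> sqrt_majorant n \<and> sqrt_majorant n \<le> 1"
  by (induction n) (auto simp: power_le_one)

lemma sqrt_majorant_mono: "sqrt_majorant n \<le> sqrt_majorant (Suc n)"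
proof -
  have "0 \<le> (1 - sqrt_majorant n)\<^sup>2" by simp
  then show ?thesis by (simp add: power2_eq_square algebra_simps)
qed

text \<open>The fixed-point equation says (1 - Y)^2 = 1 - Z. Every iterate is a polynomial in
  \<open>Z\<close>, so self-adjointness and commutation with \<open>B\<close> pass to the strong
  limit.\<close>

lemma sqrt_iter_limit:
  fixes Z :: "'a::{real_inner,complete_space} \<Rightarrow> 'a"
  assumes Z: "selfadj Z" and le: "\<And>x. norm (Z x) \<le> norm x"
  obtains Y where "selfadj Y" "\<And>x. norm (Y x) \<le> norm x" "\<And>x. 2 *\<^sub>R Y x = Z x + Y (Y x)"
    "\<And>B x. bounded_linear B \<Longrightarrow> (\<And>x. B (Z x) = Z (B x)) \<Longrightarrow> B (Y x) = Y (B x)"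
proof -
  let ?Y = "sqrt_iter Z" and ?y = sqrt_majorant
  note Zd = selfadjD[OF Z]
  have bl: "bounded_linear (?Y n)" for n
  proof (induction n)
    case (Suc n)
    then show ?case
      by (auto intro!: bounded_linear_const_scaleR bounded_linear_add Zd(1) bounded_linear_compose[of "?Y n" "?Y n"])
  qed simp
  have sa: "inner (?Y n x) y = inner x (?Y n y)" for n x y
    by (induction n arbitrary: x y) (auto simp: inner_add_left inner_add_right Zd(3))
  have com: "B (?Y n x) = ?Y n (B x)" if "bounded_linear B" "\<And>x. B (Z x) = Z (B x)" for B n x
    using bounded_linear.linear[OF that(1)] that(2)
    by (induction n arbitrary: x) (auto simp: linear_0 linear_add linear_scale)
  have nle: "norm (?Y n x) \<le> ?y n * norm x" for n x
  proof (induction n arbitrary: x)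
    case (Suc n)
    have "norm (Z x + ?Y n (?Y n x)) \<le> norm x + ?y n * (?y n * norm x)"
      using norm_triangle_ineq[of "Z x" "?Y n (?Y n x)"] le[of x] Suc[of "?Y n x"]
        mult_left_mono[OF Suc[of x], of "?y n"] sqrt_majorant_bounds[of n] by linarith
    then show ?case by (simp add: power2_eq_square algebra_simps scaleR_add_right[symmetric] del: scaleR_add_right)
  qed simp
  have step: "norm (?Y (Suc n) x - ?Y n x) \<le> (?y (Suc n) - ?y n) * norm x" for n x
  proof (induction n arbitrary: x)
    case 0 then show ?case using le[of x] by simp
  next
    case (Suc n)
    let ?d = "\<lambda>x. ?Y (Suc n) x - ?Y n x" and ?D = "?y (Suc n) - ?y n"
    have D0: "0 \<le> ?D" using sqrt_majorant_mono[of n] by linarith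
    have "?Y (Suc (Suc n)) x - ?Y (Suc n) x
        = (1/2) *\<^sub>R (?Y (Suc n) (?Y (Suc n) x) - ?Y n (?Y n x))"
      by (simp only: sqrt_iter.simps(2)[of Z "Suc n"] sqrt_iter.simps(2)[of Z n])
         (simp add: scaleR_diff_right[symmetric] scaleR_add_right[symmetric] del: sqrt_iter.simps)
    \<comment> \<open>A difference of squares split without commuting the factors; it matches term
      by term the scalar identity s^2 - t^2 = s (s - t) + (s - t) t for the majorant.\<close>
    also have "?Y (Suc n) (?Y (Suc n) x) - ?Y n (?Y n x) = ?Y (Suc n) (?d x) + ?d (?Y n x)"
      using bounded_linear.linear[OF bl[of "Suc n"]] by (simp add: linear_diff del: sqrt_iter.simps)
    finally have e: "?Y (Suc (Suc n)) x - ?Y (Suc n) x = (1/2) *\<^sub>R (?Y (Suc n) (?d x) + ?d (?Y n x))" .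
    have "norm (?Y (Suc n) (?d x)) \<le> ?y (Suc n) * (?D * norm x)"
      using order_trans[OF nle mult_left_mono[OF Suc]] sqrt_majorant_bounds by blast
    moreover have "norm (?d (?Y n x)) \<le> ?D * (?y n * norm x)"
      using order_trans[OF Suc mult_left_mono[OF nle]] D0 by blast
    ultimately have "norm (?Y (Suc n) (?d x) + ?d (?Y n x)) \<le> ?y (Suc n) * (?D * norm x) + ?D * (?y n * norm x)"
      using norm_triangle_ineq[of "?Y (Suc n) (?d x)" "?d (?Y n x)"] by linarith
    also have "\<dots> = ((?y (Suc n))\<^sup>2 - (?y n)\<^sup>2) * norm x"
      by (simp add: power2_eq_square algebra_simps del: sqrt_majorant.simps)
    finally have "norm (?Y (Suc (Suc n)) x - ?Y (Suc n) x) \<le> ((?y (Suc n))\<^sup>2 - (?y n)\<^sup>2) * norm x / 2"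
      unfolding e by (simp del: sqrt_majorant.simps sqrt_iter.simps scaleR_add_right)
    also have "\<dots> = (?y (Suc (Suc n)) - ?y (Suc n)) * norm x"
      by (simp add: field_simps power2_eq_square)
    finally show ?case .
  qed
  have mono: "incseq ?y" by (rule incseq_SucI[of sqrt_majorant, OF sqrt_majorant_mono])
  have steps: "norm (?Y (n + k) x - ?Y n x) \<le> (?y (n + k) - ?y n) * norm x" for n k x
  proof (induction k)
    case (Suc k)
    then show ?case using step[of "n + k" x] norm_triangle_ineq[of "?Y (Suc (n+k)) x - ?Y (n+k) x" "?Y (n+k) x - ?Y n x"]
      by (simp add: left_diff_distrib del: sqrt_majorant.simps sqrt_iter.simps)
  qed simp
  have "Cauchy ?y"
    using incseq_convergent[OF mono, of 1] sqrt_majorant_bounds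
    by (metis LIMSEQ_imp_Cauchy)
  have "Cauchy (\<lambda>n. ?Y n x)" for x
  proof (rule CauchyI')
    fix e :: real assume e: "e > 0"
    then have "e / (norm x + 1) > 0" by (smt (verit) divide_pos_pos norm_ge_zero)
    with \<open>Cauchy ?y\<close> obtain M where M: "\<And>m n. m \<ge> M \<Longrightarrow> n \<ge> M \<Longrightarrow> norm (?y m - ?y n) < e / (norm x + 1)"
      unfolding Cauchy_iff by metis
    have "norm (?Y m x - ?Y n x) < e" if mn: "m \<ge> M" "n > m" for m n
    proof -
      obtain k where k: "n = m + k" using mn less_imp_add_positive by blast
      have "norm (?Y m x - ?Y n x) \<le> (?y n - ?y m) * norm x" using steps[of m k x] k by (simp add: norm_minus_commute)
      also have "\<dots> \<le> e / (norm x + 1) * norm x"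
        using M[of n m] mn by (intro mult_right_mono) auto
      also have "\<dots> < e / (norm x + 1) * (norm x + 1)" using e
        by (intro mult_strict_left_mono) (auto intro!: divide_pos_pos simp: add_nonneg_pos)
      finally show ?thesis by (smt (verit) norm_ge_zero nonzero_mult_div_cancel_right times_divide_eq_left)
    qed
    then show "\<exists>M. \<forall>m\<ge>M. \<forall>n>m. dist (?Y m x) (?Y n x) < e" unfolding dist_norm by blast
  qed
  then have conv: "convergent (\<lambda>n. ?Y n x)" for x by (rule Cauchy_convergent)
  define Y where "Y x = lim (\<lambda>n. ?Y n x)" for x
  have Y: "(\<lambda>n. ?Y n x) \<longlonglongrightarrow> Y x" for x
    using conv[of x] unfolding Y_def convergent_LIMSEQ_iff .
  have nY: "norm (Y x) \<le> norm x" for x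
  proof (rule LIMSEQ_le_const2[OF tendsto_norm[OF Y]])
    have "norm (?Y n x) \<le> norm x" for n
      using nle[of n x] mult_right_mono[of "?y n" 1 "norm x"] sqrt_majorant_bounds[of n] by simp
    then show "\<exists>N. \<forall>n\<ge>N. norm (?Y n x) \<le> norm x" by blast
  qed
  have "Y (x + y) = Y x + Y y" for x y
  proof (rule LIMSEQ_unique[OF Y])
    show "(\<lambda>n. ?Y n (x + y)) \<longlonglongrightarrow> Y x + Y y"
      using tendsto_add[OF Y[of x] Y[of y]] bounded_linear.linear[OF bl] by (simp add: linear_add)
  qed
  moreover have "Y (c *\<^sub>R x) = c *\<^sub>R Y x" for c x
  proof (rule LIMSEQ_unique[OF Y])
    show "(\<lambda>n. ?Y n (c *\<^sub>R x)) \<longlonglongrightarrow> c *\<^sub>R Y x"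
      using tendsto_scaleR[OF tendsto_const[of c] Y[of x]] bounded_linear.linear[OF bl] by (simp add: linear_scale)
  qed
  ultimately have blY: "bounded_linear Y" by (rule bounded_linear_intro[where K=1]) (simp add: nY)
  have saY: "inner (Y x) y = inner x (Y y)" for x y
  proof (rule LIMSEQ_unique)
    show "(\<lambda>n. inner (?Y n x) y) \<longlonglongrightarrow> inner (Y x) y" by (intro tendsto_intros Y)
    show "(\<lambda>n. inner (?Y n x) y) \<longlonglongrightarrow> inner x (Y y)" unfolding sa by (intro tendsto_intros Y)
  qed
  have YY: "(\<lambda>n. ?Y n (?Y n x)) \<longlonglongrightarrow> Y (Y x)" for x
  proof -
    have "(\<lambda>n. ?Y n (?Y n x) - ?Y n (Y x)) \<longlonglongrightarrow> 0"
    proof (rule Lim_null_comparison)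
      show "\<forall>\<^sub>F n in sequentially. norm (?Y n (?Y n x) - ?Y n (Y x)) \<le> norm (?Y n x - Y x)"
      proof (rule always_eventually, rule allI)
        fix n
        have "norm (?Y n (?Y n x - Y x)) \<le> ?y n * norm (?Y n x - Y x)" by (rule nle)
        also have "\<dots> \<le> 1 * norm (?Y n x - Y x)"
          using sqrt_majorant_bounds[of n] by (intro mult_right_mono) auto
        finally show "norm (?Y n (?Y n x) - ?Y n (Y x)) \<le> norm (?Y n x - Y x)"
          using bounded_linear.linear[OF bl[of n]] by (simp add: linear_diff)
      qed
      show "(\<lambda>n. norm (?Y n x - Y x)) \<longlonglongrightarrow> 0" using Y[of x] LIM_zero tendsto_norm_zero by blast
    qed
    from tendsto_add[OF this Y[of "Y x"]] show ?thesis by simp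
  qed
  have eq: "2 *\<^sub>R Y x = Z x + Y (Y x)" for x
  proof (rule LIMSEQ_unique)
    show "(\<lambda>n. 2 *\<^sub>R ?Y (Suc n) x) \<longlonglongrightarrow> 2 *\<^sub>R Y x"
      by (intro tendsto_intros LIMSEQ_Suc[OF Y])
    show "(\<lambda>n. 2 *\<^sub>R ?Y (Suc n) x) \<longlonglongrightarrow> Z x + Y (Y x)"
      using tendsto_add[OF tendsto_const YY] by simp
  qed
  have "B (Y x) = Y (B x)" if B: "bounded_linear B" "\<And>x. B (Z x) = Z (B x)" for B x
  proof (rule LIMSEQ_unique)
    show "(\<lambda>n. ?Y n (B x)) \<longlonglongrightarrow> Y (B x)" by (rule Y)
    show "(\<lambda>n. ?Y n (B x)) \<longlonglongrightarrow> B (Y x)"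
      using bounded_linear.tendsto[OF B(1) Y[of x]] com[OF B] by simp
  qed
  with that[of Y] blY saY nY eq show thesis by (simp add: selfadj_def)
qed

text \<open>For Z = 1 - S / c the solution Y of the iteration satisfies (1 - Y)^2 = S / c, so sqrt c
  (1 - Y) is a root of S; it is positive because Y is a contraction.\<close>

lemma ex_pos_sqrt:
  fixes S :: "'a::{real_inner,complete_space} \<Rightarrow> 'a"
  assumes S: "pos_op S"
  obtains Q where "pos_op Q" "\<And>x. Q (Q x) = S x"
    "\<And>B x. bounded_linear B \<Longrightarrow> (\<And>x. B (S x) = S (B x)) \<Longrightarrow> B (Q x) = Q (B x)"
proof -
  note Sd = selfadjD[OF pos_opD(1)[OF S]]
  obtain c where c: "c > 0" "\<And>x. \<bar>inner (S x) x\<bar> \<le> c * (norm x)\<^sup>2"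
    using selfadj_pos_bound[OF pos_opD(1)[OF S]] by metis
  define Z where "Z x = x - (1/c) *\<^sub>R S x" for x
  have Zsa: "selfadj Z" unfolding selfadj_def Z_def
    using Sd by (auto simp: inner_diff_left inner_diff_right
        intro!: bounded_linear_sub bounded_linear_ident bounded_linear_const_scaleR)
  have Zp: "pos_op Z" unfolding pos_op_def
  proof (intro conjI allI Zsa)
    fix x
    have "inner (S x) x \<le> c * inner x x" using c(2)[of x] by (simp add: power2_norm_eq_inner)
    then show "0 \<le> inner (Z x) x" using c(1) by (simp add: Z_def inner_diff_left field_simps)
  qed
  have Z1: "inner (Z x) x \<le> 1 * (norm x)\<^sup>2" for x
    using pos_opD(2)[OF S, of x] c(1) by (simp add: Z_def inner_diff_left power2_norm_eq_inner)
  obtain Y where Y: "selfadj Y" "\<And>x. norm (Y x) \<le> norm x" "\<And>x. 2 *\<^sub>R Y x = Z x + Y (Y x)"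
    "\<And>B x. bounded_linear B \<Longrightarrow> (\<And>x. B (Z x) = Z (B x)) \<Longrightarrow> B (Y x) = Y (B x)"
    using sqrt_iter_limit[OF Zsa] pos_op_norm_le[OF Zp Z1] by (metis mult_1 zero_le_one)
  note Yd = selfadjD[OF Y(1)]
  define Q where "Q x = sqrt c *\<^sub>R (x - Y x)" for x
  have Qsa: "selfadj Q" unfolding selfadj_def Q_def
    using Yd by (auto simp: inner_diff_left inner_diff_right
        intro!: bounded_linear_sub bounded_linear_ident bounded_linear_const_scaleR)
  have "pos_op Q" unfolding pos_op_def
  proof (intro conjI allI Qsa)
    fix x
    have "inner (Y x) x \<le> norm (Y x) * norm x" by (rule norm_cauchy_schwarz)
    also have "\<dots> \<le> norm x * norm x" using Y(2)[of x] by (simp add: mult_right_mono)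
    finally have "inner (Y x) x \<le> inner x x" by (simp add: power2_norm_eq_inner[symmetric] power2_eq_square)
    then show "0 \<le> inner (Q x) x" using c(1) by (simp add: Q_def inner_diff_left)
  qed
  moreover have "Q (Q x) = S x" for x
  proof -
    have "Q (Q x) = c *\<^sub>R (x - 2 *\<^sub>R Y x + Y (Y x))"
      using c(1) by (simp add: Q_def Yd scaleR_diff_right scaleR_add_right scaleR_2 algebra_simps)
    also have "\<dots> = c *\<^sub>R (x - Z x)" by (simp add: Y(3))
    also have "\<dots> = S x" using c(1) by (simp add: Z_def)
    finally show ?thesis .
  qed
  moreover have "B (Q x) = Q (B x)" if B: "bounded_linear B" "\<And>x. B (S x) = S (B x)" for B x
  proof -
    note Bl = bounded_linear.linear[OF B(1)]
    have "B (Z x) = Z (B x)" for x by (simp add: Z_def B(2) linear_diff[OF Bl] linear_scale[OF Bl])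
    from Y(4)[OF B(1) this] show ?thesis by (simp add: Q_def linear_diff[OF Bl] linear_scale[OF Bl])
  qed
  ultimately show thesis using that by blast
qed

text \<open>Commuting roots satisfy (Q + B)(Q - B) = 0. For y = (Q - B) x positivity splits this
  into Q y = B y = 0, and then |y|^2 = <x, (Q - B) y> = 0.\<close>

lemma pos_sqrt_unique:
  assumes Q: "pos_op Q" "\<And>x. Q (Q x) = S x" and B: "pos_op B" "\<And>x. B (B x) = S x"
    and com: "\<And>x. B (Q x) = Q (B x)"
  shows "B = Q"
proof
  fix x
  note Qd = selfadjD[OF pos_opD(1)[OF Q(1)]] and Bd = selfadjD[OF pos_opD(1)[OF B(1)]]
  define y where "y = Q x - B x"
  have "Q y + B y = 0" by (simp add: y_def Qd Bd Q(2) B(2) com)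
  then have "inner (Q y) y + inner (B y) y = 0" by (metis inner_add_left inner_zero_left)
  then have "inner (Q y) y = 0" "inner (B y) y = 0"
    using pos_opD(2)[OF Q(1), of y] pos_opD(2)[OF B(1), of y] by linarith+
  then have "Q y = 0" "B y = 0" using pos_op_zero Q(1) B(1) by blast+
  then have "inner (Q x - B x) y = 0" by (simp add: inner_diff_left Qd Bd)
  then have "y = 0" by (simp add: y_def)
  then show "B x = Q x" by (simp add: y_def)
qed

section \<open>Spectral projections\<close>

text \<open>The factor \<open>c\<close> admits skew-adjoint \<open>B\<close> (c = -1) besides
  self-adjoint ones (c = 1). For the real inner product \<open>U\<close> and multiplication by \<i>
  are skew-adjoint, and the spectral projections have to commute with both.\<close>

definition in_bicommutant :: "('a::real_inner \<Rightarrow> 'a) \<Rightarrow> ('a \<Rightarrow> 'a) \<Rightarrow> bool" where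
  "in_bicommutant T E \<longleftrightarrow> (\<forall>B c. bounded_linear B \<longrightarrow> (\<forall>x y. inner (B x) y = c * inner x (B y)) \<longrightarrow>
     (\<forall>x. B (T x) = T (B x)) \<longrightarrow> (\<forall>x. B (E x) = E (B x)))"

lemma in_bicommutantD:
  assumes "in_bicommutant T E" "bounded_linear B" "\<And>x y. inner (B x) y = c * inner x (B y)"
    "\<And>x. B (T x) = T (B x)"
  shows "B (E x) = E (B x)"
  using assms unfolding in_bicommutant_def by blast

lemma in_bicommutantD_selfadj:
  assumes "in_bicommutant T E" "selfadj B" "\<And>x. B (T x) = T (B x)"
  shows "B (E x) = E (B x)"
  by (rule in_bicommutantD[OF assms(1), of B 1]) (use assms selfadjD[OF assms(2)] in auto)

text \<open>No interval is attached; membership in the bicommutant stands in for being a function of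
  \<open>T\<close>.\<close>

definition spectral_proj :: "('a::real_inner \<Rightarrow> 'a) \<Rightarrow> ('a \<Rightarrow> 'a) \<Rightarrow> bool" where
  "spectral_proj T E \<longleftrightarrow> orth_proj E \<and> in_bicommutant T E"

lemma spectral_projD:
  assumes "spectral_proj T E"
  shows "orth_proj E" "in_bicommutant T E" "selfadj E" "E (E x) = E x"
  using assms by (auto simp: spectral_proj_def orth_proj_def)

lemma spectral_proj_commutes:
  assumes T: "selfadj T" and E: "spectral_proj T E"
  shows "T (E x) = E (T x)"
  by (rule in_bicommutantD_selfadj[OF spectral_projD(2)[OF E] T]) simp

lemma spectral_proj_commute2:
  assumes T: "selfadj T" and E: "spectral_proj T E" and F: "spectral_proj T F"
  shows "F (E x) = E (F x)"
  by (rule in_bicommutantD_selfadj[OF spectral_projD(2)[OF E] spectral_projD(3)[OF F]])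
    (simp add: spectral_proj_commutes[OF T F])

lemma spectral_proj_comp:
  assumes T: "selfadj T" and E: "spectral_proj T E" and F: "spectral_proj T F"
  shows "spectral_proj T (\<lambda>x. E (F x))"
proof -
  note Ed = spectral_projD[OF E] selfadjD[OF spectral_projD(3)[OF E]]
  note Fd = spectral_projD[OF F] selfadjD[OF spectral_projD(3)[OF F]]
  have c: "F (E x) = E (F x)" for x by (rule spectral_proj_commute2[OF assms])
  have "in_bicommutant T (\<lambda>x. E (F x))"
    using Ed(2) Fd(2) unfolding in_bicommutant_def by metis
  moreover have "orth_proj (\<lambda>x. E (F x))" unfolding orth_proj_def selfadj_def
    using Ed Fd c by (auto intro: bounded_linear_compose)
  ultimately show ?thesis by (simp add: spectral_proj_def)
qed

lemma spectral_proj_compl: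
  assumes E: "spectral_proj T E"
  shows "spectral_proj T (\<lambda>x. x - E x)"
proof -
  have "in_bicommutant T (\<lambda>x. x - E x)"
    using spectral_projD(2)[OF E] bounded_linear.linear unfolding in_bicommutant_def
    by (metis linear_diff)
  with orth_proj_compl[OF spectral_projD(1)[OF E]] show ?thesis by (simp add: spectral_proj_def)
qed

text \<open>The spectral projection of \<open>(-\<infinity>, t]\<close>: the projection onto the kernel of \<open>\<bar>T - t\<bar> + (T - t)\<close>.\<close>

lemma ex_spectral_proj:
  fixes T :: "'a::{real_inner,complete_space} \<Rightarrow> 'a"
  assumes T: "selfadj T"
  obtains E where "spectral_proj T E"
    "\<And>x. E x = x \<Longrightarrow> inner (T x) x \<le> t * (norm x)\<^sup>2"
    "\<And>x. E x = 0 \<Longrightarrow> t * (norm x)\<^sup>2 \<le> inner (T x) x"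
proof -
  note Td = selfadjD[OF T]
  define S where "S x = T x - t *\<^sub>R x" for x
  have S: "selfadj S" unfolding selfadj_def S_def
    using Td by (auto simp: inner_diff_left inner_diff_right
        intro!: bounded_linear_sub bounded_linear_ident bounded_linear_const_scaleR)
  note Sd = selfadjD[OF S]
  have SS: "pos_op (\<lambda>x. S (S x))" unfolding pos_op_def selfadj_def
  proof (intro conjI allI)
    show "0 \<le> inner (S (S x)) x" for x using inner_ge_zero[of "S x"] by (simp add: Sd(3))
  qed (use Sd in \<open>auto intro: bounded_linear_compose\<close>)
  obtain Q where Q: "pos_op Q" "\<And>x. Q (Q x) = S (S x)"
    "\<And>B x. bounded_linear B \<Longrightarrow> (\<And>x. B (S (S x)) = S (S (B x))) \<Longrightarrow> B (Q x) = Q (B x)"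
    using ex_pos_sqrt[OF SS] by metis
  note Qd = selfadjD[OF pos_opD(1)[OF Q(1)]]
  have SQ: "S (Q x) = Q (S x)" for x by (rule Q(3)) (use Sd in auto)
  define V where "V = {x. Q x + S x = 0}"
  have V: "subspace V"
  proof (rule subspaceI)
    show "0 \<in> V" by (simp add: V_def Qd Sd)
    show "x + y \<in> V" if "x \<in> V" "y \<in> V" for x y
    proof -
      have "Q (x + y) + S (x + y) = (Q x + S x) + (Q y + S y)" by (simp add: Qd Sd)
      with that show ?thesis by (simp add: V_def)
    qed
    show "c *\<^sub>R x \<in> V" if "x \<in> V" for c x
    proof -
      have "Q (c *\<^sub>R x) + S (c *\<^sub>R x) = c *\<^sub>R (Q x + S x)" by (simp add: Qd Sd scaleR_add_right)
      with that show ?thesis by (simp add: V_def)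
    qed
  qed
  have "closed V"
  proof -
    have "continuous_on UNIV (\<lambda>x. Q x + S x)"
      using Qd(1) Sd(1) by (intro continuous_on_add linear_continuous_on)
    from continuous_closed_preimage_constant[OF this] show ?thesis by (simp add: V_def)
  qed
  with V obtain E where E: "orth_proj E" "\<And>x. E x \<in> V" "\<And>x. x \<in> V \<Longrightarrow> E x = x"
    "\<And>x v. v \<in> V \<Longrightarrow> inner (x - E x) v = 0"
    using ex_orth_proj by metis
  have "in_bicommutant T E" unfolding in_bicommutant_def
  proof (intro allI impI)
    fix B :: "'a \<Rightarrow> 'a" and c x
    assume B: "bounded_linear B" "\<forall>x y. inner (B x) y = c * inner x (B y)" "\<forall>x. B (T x) = T (B x)"
    note Bl = bounded_linear.linear[OF B(1)]
    have BS: "B (S x) = S (B x)" for x using B(3) by (simp add: S_def linear_diff[OF Bl] linear_scale[OF Bl])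
    have BQ: "B (Q x) = Q (B x)" for x by (rule Q(3)[OF B(1)]) (simp add: BS)
    have "B x \<in> V" if "x \<in> V" for x
      using that by (simp add: V_def BS[symmetric] BQ[symmetric] linear_add[OF Bl, symmetric] linear_0[OF Bl])
    then show "B (E x) = E (B x)"
      using orth_proj_commute[OF E(1), of B c x] B(2) E(2,3) by metis
  qed
  then have sp: "spectral_proj T E" using E(1) by (simp add: spectral_proj_def)
  show thesis
  proof (rule that[OF sp])
    fix x assume "E x = x"
    then have "S x = - Q x" using E(2)[of x] by (simp add: V_def add_eq_0_iff)
    then have "inner (S x) x \<le> 0" using pos_opD(2)[OF Q(1), of x] by simp
    then show "inner (T x) x \<le> t * (norm x)\<^sup>2"
      by (simp add: S_def inner_diff_left power2_norm_eq_inner)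
  next
    fix x assume Ex: "E x = 0"
    \<comment> \<open>With Q = |S| one has (|S| + S)(|S| - S) = 0. So a vector orthogonal to
      \<open>V\<close> is orthogonal to the range of |S| - S, hence satisfies |S| x = S x, and the
      form of S is nonnegative there.\<close>
    have rng: "Q y - S y \<in> V" for y by (simp add: V_def Qd Sd SQ Q(2))
    have "inner (Q x - S x) y = 0" for y
    proof -
      have "inner (Q x - S x) y = inner x (Q y - S y)"
        by (simp add: inner_diff_left inner_diff_right Qd Sd)
      also have "\<dots> = 0" using E(4)[OF rng, of x y] Ex by simp
      finally show ?thesis .
    qed
    then have "Q x - S x = 0" by (metis inner_eq_zero_iff)
    then have "inner (S x) x \<ge> 0" using pos_opD(2)[OF Q(1), of x] by simp
    then show "t * (norm x)\<^sup>2 \<le> inner (T x) x"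
      by (simp add: S_def inner_diff_left power2_norm_eq_inner)
  qed
qed

section \<open>Slabs of the spectrum\<close>

lemma spectral_proj_approx:
  assumes T: "selfadj T" and E: "spectral_proj T E" and d: "0 \<le> \<delta>"
    and le: "\<And>x. E x = x \<Longrightarrow> inner (T x) x \<le> (t + \<delta>) * (norm x)\<^sup>2"
    and ge: "\<And>x. E x = x \<Longrightarrow> t * (norm x)\<^sup>2 \<le> inner (T x) x"
    and x: "E x = x"
  shows "norm (T x - t *\<^sub>R x) \<le> \<delta> * norm x"
proof -
  note Td = selfadjD[OF T] and Ed = spectral_projD[OF E] selfadjD[OF spectral_projD(3)[OF E]]
  have c: "T (E x) = E (T x)" for x by (rule spectral_proj_commutes[OF T E])
  \<comment> \<open>Compression by \<open>E\<close> turns the two bounds on the range of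
    \<open>E\<close> into 0 \<le> S \<le> \<delta> on the whole space, where
    \<open>pos_op_norm_le\<close> applies.\<close>
  define S where "S x = T (E x) - t *\<^sub>R E x" for x
  have Ssa: "selfadj S" unfolding selfadj_def S_def
    using c by (auto simp: inner_diff_left inner_diff_right Td(3) Ed(7)
        intro!: bounded_linear_sub bounded_linear_const_scaleR bounded_linear_compose[OF Ed(5) Td(1)] Ed(5))
  have Si: "inner (S x) x = inner (T (E x)) (E x) - t * (norm (E x))\<^sup>2" for x
  proof -
    have "inner (T (E x)) x = inner (T (E x)) (E x)"
      by (simp only: Ed(7)[of _ x, symmetric] c[symmetric] Ed(4))
    moreover have "inner (E x) x = inner (E x) (E x)" using Ed(4)[of x] Ed(7)[of "E x" x] by simp
    ultimately show ?thesis by (simp add: S_def inner_diff_left power2_norm_eq_inner)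
  qed
  have "pos_op S" unfolding pos_op_def using Ssa Si ge[OF Ed(4)] by simp
  moreover have "inner (S x) x \<le> \<delta> * (norm x)\<^sup>2" for x
  proof -
    have "inner (S x) x \<le> \<delta> * (norm (E x))\<^sup>2" using Si[of x] le[OF Ed(4), of x] by (simp add: algebra_simps)
    also have "\<dots> \<le> \<delta> * (norm x)\<^sup>2"
      using orth_proj_norm_le[OF Ed(1), of x] d by (intro mult_left_mono power_mono) auto
    finally show ?thesis .
  qed
  ultimately have "norm (S x) \<le> \<delta> * norm x" by (rule pos_op_norm_le) (rule d)
  then show ?thesis using x by (simp add: S_def)
qed

text \<open>Induction that cuts off the topmost slab: the part of \<open>G\<close> above
  \<open>t\<close> has form values in an interval of length \<delta>, and the part below is again a
  spectral projection with one slab fewer. This is why \<open>G\<close> has to be arbitrary.\<close>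

lemma spectral_partition_aux:
  fixes T :: "'a::{real_inner,complete_space} \<Rightarrow> 'a"
  assumes T: "selfadj T" and d: "0 \<le> \<delta>"
  shows "spectral_proj T G \<Longrightarrow> (\<And>x. G x = x \<Longrightarrow> a * (norm x)\<^sup>2 \<le> inner (T x) x) \<Longrightarrow>
    (\<And>x. G x = x \<Longrightarrow> inner (T x) x \<le> (a + real (Suc m) * \<delta>) * (norm x)\<^sup>2) \<Longrightarrow>
    \<exists>E. (\<forall>k\<le>m. spectral_proj T (E k) \<and> (\<forall>x. G (E k x) = E k x) \<and>
        (\<forall>x. norm (T (E k x) - (a + real k * \<delta>) *\<^sub>R E k x) \<le> \<delta> * norm (E k x)))
      \<and> (\<forall>k\<le>m. \<forall>l\<le>m. k \<noteq> l \<longrightarrow> (\<forall>x. E k (E l x) = 0)) \<and> (\<forall>x. (\<Sum>k\<le>m. E k x) = G x)"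
proof (induction m arbitrary: G)
  case 0
  note Gd = spectral_projD[OF 0(1)]
  have "norm (T (G x) - a *\<^sub>R G x) \<le> \<delta> * norm (G x)" for x
    by (rule spectral_proj_approx[OF T 0(1) d]) (use 0(2,3) Gd(4) in simp_all)
  then show ?case using 0(1) Gd(4) by (intro exI[of _ "\<lambda>_. G"]) simp
next
  case (Suc m)
  define t where "t = a + real (Suc m) * \<delta>"
  obtain F where F: "spectral_proj T F"
    "\<And>x. F x = x \<Longrightarrow> inner (T x) x \<le> t * (norm x)\<^sup>2"
    "\<And>x. F x = 0 \<Longrightarrow> t * (norm x)\<^sup>2 \<le> inner (T x) x"
    using ex_spectral_proj[OF T] by metis
  note Gd = spectral_projD[OF Suc.prems(1)] selfadjD[OF spectral_projD(3)[OF Suc.prems(1)]]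
  note Fd = spectral_projD[OF F(1)] selfadjD[OF spectral_projD(3)[OF F(1)]]
  have GF: "G (F x) = F (G x)" for x by (rule spectral_proj_commute2[OF T F(1) Suc.prems(1)])
  define G1 where "G1 x = F (G x)" for x
  define G2 where "G2 x = (\<lambda>x. x - F x) (G x)" for x
  have G1: "spectral_proj T G1" unfolding G1_def by (rule spectral_proj_comp[OF T F(1) Suc.prems(1)])
  have G2: "spectral_proj T G2" unfolding G2_def
    by (rule spectral_proj_comp[OF T spectral_proj_compl[OF F(1)] Suc.prems(1)])
  note G1d = spectral_projD[OF G1] selfadjD[OF spectral_projD(3)[OF G1]]
  note G2d = spectral_projD[OF G2] selfadjD[OF spectral_projD(3)[OF G2]]
  have G1G: "G x = x" "F x = x" if "G1 x = x" for x
  proof -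
    have x: "F (G x) = x" using that by (simp add: G1_def)
    have "G (F (G x)) = F (G x)" by (simp only: GF Gd(4))
    then show "G x = x" by (simp only: x)
    have "F (F (G x)) = F (G x)" by (simp only: Fd(4))
    then show "F x = x" by (simp only: x)
  qed
  have G2G: "G x = x" "F x = 0" if "G2 x = x" for x
  proof -
    have x: "x = G x - F (G x)" using that by (simp add: G2_def)
    have "G (G x - F (G x)) = G x - F (G x)" by (simp only: Gd(4,9) GF)
    then show "G x = x" by (simp only: x[symmetric])
    have "F (G x - F (G x)) = 0" by (simp only: Fd(4,9) diff_self)
    then show "F x = 0" by (simp only: x[symmetric])
  qed
  have "\<exists>E. (\<forall>k\<le>m. spectral_proj T (E k) \<and> (\<forall>x. G1 (E k x) = E k x) \<and>
        (\<forall>x. norm (T (E k x) - (a + real k * \<delta>) *\<^sub>R E k x) \<le> \<delta> * norm (E k x)))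
      \<and> (\<forall>k\<le>m. \<forall>l\<le>m. k \<noteq> l \<longrightarrow> (\<forall>x. E k (E l x) = 0)) \<and> (\<forall>x. (\<Sum>k\<le>m. E k x) = G1 x)"
  proof (rule Suc.IH[OF G1])
    fix x assume x: "G1 x = x"
    show "a * (norm x)\<^sup>2 \<le> inner (T x) x" by (rule Suc.prems(2)[OF G1G(1)[OF x]])
    show "inner (T x) x \<le> (a + real (Suc m) * \<delta>) * (norm x)\<^sup>2" by (rule F(2)[OF G1G(2)[OF x], unfolded t_def])
  qed
  then obtain E where Eall: "(\<forall>k\<le>m. spectral_proj T (E k) \<and> (\<forall>x. G1 (E k x) = E k x) \<and>
        (\<forall>x. norm (T (E k x) - (a + real k * \<delta>) *\<^sub>R E k x) \<le> \<delta> * norm (E k x)))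
      \<and> (\<forall>k\<le>m. \<forall>l\<le>m. k \<noteq> l \<longrightarrow> (\<forall>x. E k (E l x) = 0)) \<and> (\<forall>x. (\<Sum>k\<le>m. E k x) = G1 x)" ..
  have E: "\<And>k. k \<le> m \<Longrightarrow> spectral_proj T (E k)"
      "\<And>k x. k \<le> m \<Longrightarrow> G1 (E k x) = E k x"
      "\<And>k x. k \<le> m \<Longrightarrow> norm (T (E k x) - (a + real k * \<delta>) *\<^sub>R E k x) \<le> \<delta> * norm (E k x)"
      "\<And>k l x. k \<le> m \<Longrightarrow> l \<le> m \<Longrightarrow> k \<noteq> l \<Longrightarrow> E k (E l x) = 0"
      "\<And>x. (\<Sum>k\<le>m. E k x) = G1 x" using Eall by simp_all
  define E' where "E' k = (if k \<le> m then E k else G2)" for k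
  have n2: "norm (T (G2 x) - (a + real (Suc m) * \<delta>) *\<^sub>R G2 x) \<le> \<delta> * norm (G2 x)" for x
  proof (rule spectral_proj_approx[OF T G2 d])
    fix x assume x: "G2 x = x"
    show "inner (T x) x \<le> (a + real (Suc m) * \<delta> + \<delta>) * (norm x)\<^sup>2"
      using Suc.prems(3)[OF G2G(1)[OF x]] by (simp add: algebra_simps)
    show "(a + real (Suc m) * \<delta>) * (norm x)\<^sup>2 \<le> inner (T x) x" by (rule F(3)[OF G2G(2)[OF x], unfolded t_def])
  qed (rule G2d(4))
  have z21: "G2 (E k x) = 0" if "k \<le> m" for k x
    using E(2)[OF that, of x] G1G[of "E k x"] by (simp add: G2_def)
  have z12: "E k (G2 x) = 0" if "k \<le> m" for k x
    using spectral_proj_commute2[OF T G2 E(1)[OF that]] z21[OF that] by simp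
  have "\<forall>k\<le>Suc m. spectral_proj T (E' k) \<and> (\<forall>x. G (E' k x) = E' k x) \<and>
        (\<forall>x. norm (T (E' k x) - (a + real k * \<delta>) *\<^sub>R E' k x) \<le> \<delta> * norm (E' k x))"
  proof (intro allI impI)
    fix k assume "k \<le> Suc m"
    then consider "k \<le> m" | "k = Suc m" by linarith
    then show "spectral_proj T (E' k) \<and> (\<forall>x. G (E' k x) = E' k x) \<and>
        (\<forall>x. norm (T (E' k x) - (a + real k * \<delta>) *\<^sub>R E' k x) \<le> \<delta> * norm (E' k x))"
    proof cases
      case 1
      then show ?thesis using E(1,3) G1G(1)[OF E(2)] by (simp add: E'_def)
    next
      case 2
      then have "E' k = G2" by (simp add: E'_def)
      with 2 show ?thesis using G2 n2 G2G(1)[OF G2d(4)] by simp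
    qed
  qed
  moreover have "\<forall>k\<le>Suc m. \<forall>l\<le>Suc m. k \<noteq> l \<longrightarrow> (\<forall>x. E' k (E' l x) = 0)"
    unfolding E'_def using E(4) z12 z21 by simp
  moreover have "\<forall>x. (\<Sum>k\<le>Suc m. E' k x) = G x"
  proof
    fix x
    have "(\<Sum>k\<le>Suc m. E' k x) = (\<Sum>k\<le>m. E k x) + G2 x" by (simp add: E'_def)
    also have "\<dots> = G x" by (simp add: E(5) G1_def G2_def)
    finally show "(\<Sum>k\<le>Suc m. E' k x) = G x" .
  qed
  ultimately show ?case by (intro exI[of _ E'] conjI)
qed

lemma spectral_partition:
  fixes T :: "'a::{real_inner,complete_space} \<Rightarrow> 'a"
  assumes T: "selfadj T" and d: "0 \<le> \<delta>" and ge: "\<And>x. 0 \<le> inner (T x) x"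
    and le: "\<And>x. inner (T x) x \<le> real (Suc m) * \<delta> * (norm x)\<^sup>2"
  obtains E where "\<And>k. k \<le> m \<Longrightarrow> spectral_proj T (E k)"
      "\<And>k x. k \<le> m \<Longrightarrow> norm (T (E k x) - (real k * \<delta>) *\<^sub>R E k x) \<le> \<delta> * norm (E k x)"
      "\<And>k l x. k \<le> m \<Longrightarrow> l \<le> m \<Longrightarrow> k \<noteq> l \<Longrightarrow> E k (E l x) = 0"
      "\<And>x. (\<Sum>k\<le>m. E k x) = x"
proof -
  have "spectral_proj T (\<lambda>x. x)"
    by (auto simp: spectral_proj_def orth_proj_def selfadj_def in_bicommutant_def)
  from spectral_partition_aux[OF T d this, of 0 m] ge le
  obtain E where "\<forall>k\<le>m. spectral_proj T (E k) \<and> (\<forall>x. norm (T (E k x) - (real k * \<delta>) *\<^sub>R E k x) \<le> \<delta> * norm (E k x))"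
    "\<forall>k\<le>m. \<forall>l\<le>m. k \<noteq> l \<longrightarrow> (\<forall>x. E k (E l x) = 0)" "\<forall>x. (\<Sum>k\<le>m. E k x) = x" by auto
  then show thesis by (intro that[of E]) auto
qed

section \<open>Antilinear operators and polar decomposition\<close>

lemma scaleC_zero_left [simp]: "0 *\<^sub>C (x::'a::complex_vector) = 0"
  using scaleR_scaleC[of 0 x] by simp

lemma scaleC_zero_right [simp]: "a *\<^sub>C (0::'a::complex_vector) = 0"
  using scaleC_add_right[of a 0 0] by simp

lemma scaleC_minus_right: "a *\<^sub>C (- x) = - (a *\<^sub>C (x::'a::complex_vector))"
  using scaleC_add_right[of a x "- x"] by (simp add: eq_neg_iff_add_eq_0 add.commute)

lemma scaleC_minus_left: "(- a) *\<^sub>C x = - (a *\<^sub>C (x::'a::complex_vector))"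
  using scaleC_add_left[of a "- a" x] by (simp add: eq_neg_iff_add_eq_0 add.commute)

lemma scaleC_diff_right: "a *\<^sub>C (x - y) = a *\<^sub>C x - a *\<^sub>C (y::'a::complex_vector)"
  using scaleC_add_right[of a x "- y"] by (simp add: scaleC_minus_right)

lemma scaleC_sum_right: "a *\<^sub>C (\<Sum>i\<in>I. f i) = (\<Sum>i\<in>I. a *\<^sub>C (f i::'a::complex_vector))"
  by (induction I rule: infinite_finite_induct) (auto simp: scaleC_add_right)

lemma scaleC_i_i: "\<i> *\<^sub>C \<i> *\<^sub>C x = - (x::'a::complex_vector)"
  by (simp add: scaleC_scaleC scaleC_minus_left scaleC_one)

lemma scaleC_Re_Im: "c *\<^sub>C x = Re c *\<^sub>R x + Im c *\<^sub>R (\<i> *\<^sub>C (x::'a::complex_vector))"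
proof -
  have "c *\<^sub>C x = (complex_of_real (Re c) + complex_of_real (Im c) * \<i>) *\<^sub>C x"
    using complex_eq[of c] by (simp add: mult.commute)
  then show ?thesis by (simp add: scaleC_add_left scaleR_scaleC scaleC_scaleC)
qed

context
  fixes x y z :: "'a::complex_inner"
begin

lemma cinner_add_right: "cinner x (y + z) = cinner x y + cinner x z"
  by (metis cinner_add_left cinner_commute complex_cnj_add)

lemma cinner_scaleC_right: "cinner x (a *\<^sub>C y) = cnj a * cinner x y"
  by (metis cinner_commute cinner_scaleC_left complex_cnj_mult)

lemma cinner_zero_left [simp]: "cinner 0 y = 0"
  using cinner_scaleC_left[of 0 0 y] by simp

lemma cinner_zero_right [simp]: "cinner x 0 = 0"
  using cinner_scaleC_right[of 0] by simp

lemma cinner_minus_left: "cinner (- x) y = - cinner x y"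
  using cinner_scaleC_left[of "-1" x y] by (simp add: scaleC_minus_left scaleC_one)

lemma cinner_minus_right: "cinner x (- y) = - cinner x y"
  using cinner_scaleC_right[of "-1"] by (simp add: scaleC_minus_left scaleC_one)

lemma cinner_diff_left: "cinner (x - y) z = cinner x z - cinner y z"
  using cinner_add_left[of x "-y" z] cinner_scaleC_left[of "-1" y z] by (simp add: scaleC_minus_left scaleC_one)

lemma cinner_scaleR_left: "cinner (r *\<^sub>R x) y = r * cinner x y"
  by (simp add: scaleR_scaleC cinner_scaleC_left)

lemma cinner_scaleR_right: "cinner x (r *\<^sub>R y) = r * cinner x y"
  by (simp add: scaleR_scaleC cinner_scaleC_right)

lemma Im_cinner: "Im (cinner x y) = inner x (\<i> *\<^sub>C y)"
  by (simp add: inner_Re_cinner cinner_scaleC_right)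

lemma cinner_self: "cinner x x = complex_of_real ((norm x)\<^sup>2)"
proof -
  have "Im (cinner x x) = 0" using cinner_commute[of x x] by (metis complex_cnj complex.sel(2) complex_surj equal_neg_zero)
  moreover have "Re (cinner x x) = (norm x)\<^sup>2" by (simp add: inner_Re_cinner[symmetric] power2_norm_eq_inner)
  ultimately show ?thesis by (simp add: complex_eq_iff)
qed

end

lemma norm_scaleC: "norm (a *\<^sub>C (x::'a::complex_inner)) = cmod a * norm x"
proof -
  have "complex_of_real ((norm (a *\<^sub>C x))\<^sup>2) = a * cnj a * cinner x x"
    by (simp add: cinner_self[symmetric] cinner_scaleC_left cinner_scaleC_right mult.assoc del: of_real_power)
  also have "\<dots> = complex_of_real ((cmod a * norm x)\<^sup>2)"
    by (simp add: cinner_self complex_norm_square[symmetric] power_mult_distrib)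
  finally have "(norm (a *\<^sub>C x))\<^sup>2 = (cmod a * norm x)\<^sup>2" by (simp only: of_real_eq_iff)
  then show ?thesis by simp
qed

lemma cinner_diff_right: "cinner x (y - z) = cinner x y - cinner x (z::'a::complex_inner)"
  using cinner_add_right[of x y "-z"] by (simp add: cinner_minus_right)

lemma cinner_sum_left: "cinner (\<Sum>i\<in>I. f i) y = (\<Sum>i\<in>I. cinner (f i) (y::'a::complex_inner))"
  by (induction I rule: infinite_finite_induct) (auto simp: cinner_add_left)

lemma cinner_sum_right: "cinner y (\<Sum>i\<in>I. f i) = (\<Sum>i\<in>I. cinner (y::'a::complex_inner) (f i))"
  by (induction I rule: infinite_finite_induct) (auto simp: cinner_add_right)

lemma cinner_eq_zero_iff [simp]: "cinner x x = 0 \<longleftrightarrow> x = (0::'a::complex_inner)"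
  by (simp add: cinner_self)

lemma cmod_cinner_le: "cmod (cinner x y) \<le> norm x * norm (y::'a::complex_inner)"
proof (cases "cinner x y = 0")
  case False
  \<comment> \<open>This phase rotates the inner product onto the positive reals, so the real
    Cauchy-Schwarz inequality suffices.\<close>
  define u where "u = cnj (cinner x y) / cmod (cinner x y)"
  have u: "cmod u = 1" using False by (simp add: u_def norm_divide)
  have "cmod (cinner x y) = Re (u * cinner x y)" using False
    by (simp add: u_def mult.commute[of "cnj _"] complex_norm_square[symmetric] power2_eq_square
        flip: of_real_mult of_real_divide)
  also have "\<dots> = inner (u *\<^sub>C x) y" by (simp add: inner_Re_cinner cinner_scaleC_left)
  also have "\<dots> \<le> norm (u *\<^sub>C x) * norm y" by (rule norm_cauchy_schwarz)
  finally show ?thesis by (simp add: norm_scaleC u)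
qed simp

lemma cinner_eq_0_iff_inner: "cinner x y = 0 \<longleftrightarrow> inner x y = 0 \<and> inner x (\<i> *\<^sub>C y) = 0"
  by (simp add: complex_eq_iff inner_Re_cinner[symmetric] Im_cinner)

lemma inner_i_left: "inner (\<i> *\<^sub>C x) y = - inner x (\<i> *\<^sub>C (y::'a::complex_inner))"
  by (simp add: inner_Re_cinner cinner_scaleC_left cinner_scaleC_right)

lemma bounded_linear_scaleC: "bounded_linear (\<lambda>x::'a::complex_inner. a *\<^sub>C x)"
  by (rule bounded_linear_intro[where K="cmod a"])
    (auto simp: scaleC_add_right scaleR_scaleC scaleC_scaleC norm_scaleC mult.commute)

lemma bounded_linear_cinner_left: "bounded_linear (\<lambda>x::'a::complex_inner. cinner x y)"
  by (rule bounded_linear_intro[where K="norm y"])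
    (auto simp: cinner_add_left cinner_scaleR_left scaleR_conv_of_real cmod_cinner_le)

lemma bounded_linear_cinner_right: "bounded_linear (\<lambda>x::'a::complex_inner. cinner y x)"
  by (rule bounded_linear_intro[where K="norm y"])
    (use cmod_cinner_le[of y] in \<open>auto simp: cinner_add_right cinner_scaleR_right scaleR_conv_of_real mult.commute\<close>)

section \<open>Antilinear maps and their adjoints\<close>

lemma antilinearD:
  assumes "antilinear A"
  shows "A (x + y) = A x + A y" "A (c *\<^sub>C x) = cnj c *\<^sub>C A x" "A (r *\<^sub>R x) = r *\<^sub>R A x"
    "A 0 = 0" "A (- x) = - A x" "A (x - y) = A x - A y" "A (\<Sum>i\<in>I. f i) = (\<Sum>i\<in>I. A (f i))"
proof -
  show a: "A (x + y) = A x + A y" and s: "A (c *\<^sub>C x) = cnj c *\<^sub>C A x" for x y c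
    using assms by (auto simp: antilinear_def)
  show "A (r *\<^sub>R x) = r *\<^sub>R A x" by (simp add: scaleR_scaleC s)
  show z: "A 0 = 0" using s[of 0 0] by simp
  show m: "A (- x) = - A x" for x using s[of "-1" x] by (simp add: scaleC_minus_left scaleC_one)
  show "A (x - y) = A x - A y" using a[of x "-y"] m[of y] by simp
  show "A (\<Sum>i\<in>I. f i) = (\<Sum>i\<in>I. A (f i))"
    by (induction I rule: infinite_finite_induct) (auto simp: a z)
qed

lemma bounded_antilinear_imp_bounded_linear:
  assumes "bounded_antilinear A"
  shows "bounded_linear A"
proof -
  obtain C where C: "\<And>x. norm (A x) \<le> C * norm x" and A: "antilinear A"
    using assms by (auto simp: bounded_antilinear_def)
  show ?thesis by (rule bounded_linear_intro[where K=C]) (auto simp: antilinearD[OF A] C mult.commute)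
qed

lemma bounded_antilinearI:
  assumes "bounded_linear A" "\<And>x. A (\<i> *\<^sub>C x) = - (\<i> *\<^sub>C A x)"
  shows "bounded_antilinear A"
proof -
  have l: "linear A" by (rule bounded_linear.linear[OF assms(1)])
  obtain C where "\<And>x. norm (A x) \<le> norm x * C" using bounded_linear.bounded[OF assms(1)] by blast
  moreover have "A (c *\<^sub>C x) = cnj c *\<^sub>C A x" for c x
    unfolding scaleC_Re_Im[of c x] scaleC_Re_Im[of "cnj c" "A x"]
    by (simp add: linear_add[OF l] linear_scale[OF l] assms(2))
  ultimately show ?thesis unfolding bounded_antilinear_def antilinear_def
    using linear_add[OF l] by (metis mult.commute)
qed

lemma riesz_representation:
  fixes f :: "'a::{real_inner,complete_space} \<Rightarrow> real"
  assumes f: "bounded_linear f"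
  obtains z where "\<And>x. f x = inner x z"
proof -
  note l = bounded_linear.linear[OF f]
  define V where "V = {x. f x = 0}"
  have "subspace V" by (auto simp: V_def subspace_def linear_0[OF l] linear_add[OF l] linear_scale[OF l])
  moreover have "closed V"
    using continuous_closed_preimage_constant[OF linear_continuous_on[OF f], of UNIV 0] by (simp add: V_def)
  ultimately obtain P where P: "\<And>x. P x \<in> V" "\<And>x v. v \<in> V \<Longrightarrow> inner (x - P x) v = 0"
    using ex_orth_proj by metis
  show thesis
  proof (cases "\<forall>x. f x = 0")
    case True
    then show thesis using that[of 0] by simp
  next
    case False
    then obtain w0 where w0: "f w0 \<noteq> 0" by blast
    define w where "w = w0 - P w0"
    have fw: "f w = f w0" using P(1)[of w0] by (simp add: w_def V_def linear_diff[OF l])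
    have "f x = inner x ((f w / inner w w) *\<^sub>R w)" for x
    proof -
      have "w \<noteq> 0" using fw w0 linear_0[OF l] by auto
      have "x - (f x / f w) *\<^sub>R w \<in> V" using fw w0 by (simp add: V_def linear_diff[OF l] linear_scale[OF l])
      from P(2)[OF this, of w0] have "inner w x = f x / f w * inner w w"
        by (simp add: w_def[symmetric] inner_diff_right)
      then show ?thesis using fw w0 \<open>w \<noteq> 0\<close> by (simp add: inner_commute)
    qed
    then show thesis by (rule that)
  qed
qed

text \<open>A form of \<open>skew_self_adjoint\<close> free of the definite description: <A x, y> is
  conjugate-linear in both arguments and antisymmetric. On Hilbert spaces the two notions
  agree.\<close>

definition skew_antilinear :: "('a::complex_inner \<Rightarrow> 'a) \<Rightarrow> bool" where
  "skew_antilinear A \<longleftrightarrow> bounded_antilinear A \<and> (\<forall>x y. cinner (A x) y = - cinner (A y) x)"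

text \<open>Existence is what lets one extract information from the definite description in
  \<open>antilinear_adjoint\<close>. The adjoint for the real inner product anticommutes with \<i>
  because \<open>A\<close> does, and this upgrades the real identity to the complex one.\<close>

lemma ex_antilinear_adjoint:
  fixes A :: "'a::chilbert_space \<Rightarrow> 'a"
  assumes A: "bounded_antilinear A"
  obtains B where "bounded_antilinear B" "\<And>x y. cinner (A x) y = cnj (cinner x (B y))"
proof -
  note bl = bounded_antilinear_imp_bounded_linear[OF A]
  have al: "antilinear A" using A by (simp add: bounded_antilinear_def)
  note Ad = antilinearD[OF al]
  obtain C where C: "C > 0" "\<And>x. norm (A x) \<le> norm x * C" using bounded_linear.pos_bounded[OF bl] by blast
  have "\<exists>z. \<forall>x. inner (A x) y = inner x z" for y
    using riesz_representation[OF bounded_linear_compose[OF bounded_linear_inner_left bl]] by metis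
  then obtain B where B: "\<And>x y. inner (A x) y = inner x (B y)" by metis
  have eqI: "u = v" if "\<And>x. inner x u = inner x v" for u v :: 'a
    using that by (metis inner_diff_right inner_eq_zero_iff eq_iff_diff_eq_0)
  have add: "B (x + y) = B x + B y" for x y by (rule eqI) (simp add: B[symmetric] inner_add_right)
  have sc: "B (r *\<^sub>R x) = r *\<^sub>R B x" for r x by (rule eqI) (simp add: B[symmetric])
  have i: "B (\<i> *\<^sub>C y) = - (\<i> *\<^sub>C B y)" for y
  proof (rule eqI)
    fix x
    have "inner x (B (\<i> *\<^sub>C y)) = inner (A (\<i> *\<^sub>C x)) y"
      by (simp add: B[symmetric] Ad scaleC_minus_left inner_i_left)
    also have "\<dots> = inner x (- (\<i> *\<^sub>C B y))" by (simp add: B inner_i_left)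
    finally show "inner x (B (\<i> *\<^sub>C y)) = inner x (- (\<i> *\<^sub>C B y))" .
  qed
  have nB: "norm (B y) \<le> norm y * C" for y
  proof (cases "B y = 0")
    case False
    have "norm (B y) * norm (B y) = inner (A (B y)) y"
      by (simp add: B power2_eq_square[symmetric] power2_norm_eq_inner)
    also have "\<dots> \<le> norm (A (B y)) * norm y" by (rule norm_cauchy_schwarz)
    also have "\<dots> \<le> (norm (B y) * C) * norm y" by (intro mult_right_mono C) auto
    finally show ?thesis using False by (simp add: mult.commute mult.left_commute)
  qed (use C in simp)
  have "bounded_antilinear B"
    by (rule bounded_antilinearI[OF bounded_linear_intro[OF add sc nB] i])
  moreover have "cinner (A x) y = cnj (cinner x (B y))" for x y
    by (simp add: complex_eq_iff inner_Re_cinner[symmetric] Im_cinner B i)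
  ultimately show thesis by (rule that)
qed

lemma antilinear_adjoint_unique:
  fixes A :: "'a::complex_inner \<Rightarrow> 'a"
  assumes "bounded_antilinear B" "\<And>x y. cinner (A x) y = cnj (cinner x (B y))"
  shows "antilinear_adjoint A = B"
  unfolding antilinear_adjoint_def
proof (rule the_equality)
  show "bounded_antilinear B \<and> (\<forall>x y. cinner (A x) y = cnj (cinner x (B y)))" using assms by blast
  fix B' assume B': "bounded_antilinear B' \<and> (\<forall>x y. cinner (A x) y = cnj (cinner x (B' y)))"
  show "B' = B"
  proof
    fix y
    have "cinner x (B' y) = cinner x (B y)" for x using B' assms(2) by (metis complex_cnj_cancel_iff)
    then have "cinner (B' y - B y) (B' y - B y) = 0" by (simp add: cinner_diff_right)
    then show "B' y = B y" by simp
  qed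
qed

lemma skew_antilinear_imp_skew_self_adjoint:
  assumes "skew_antilinear A"
  shows "skew_self_adjoint A"
proof -
  have A: "bounded_antilinear A" and s: "\<And>x y. cinner (A x) y = - cinner (A y) x"
    using assms unfolding skew_antilinear_def by blast+
  have "bounded_antilinear (\<lambda>x. - A x)"
    using A by (simp add: bounded_antilinear_def antilinear_def scaleC_minus_right)
  moreover have "cinner (A x) y = cnj (cinner x (- A y))" for x y
    using s[of x y] cinner_commute[of x "A y"] by (simp add: cinner_minus_right)
  ultimately have "antilinear_adjoint A = (\<lambda>x. - A x)" by (rule antilinear_adjoint_unique)
  with A show ?thesis by (simp add: skew_self_adjoint_def)
qed

lemma skew_self_adjoint_imp_skew_antilinear:
  fixes A :: "'a::chilbert_space \<Rightarrow> 'a"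
  assumes "skew_self_adjoint A"
  shows "skew_antilinear A"
proof -
  have A: "bounded_antilinear A" and e: "antilinear_adjoint A = (\<lambda>x. - A x)"
    using assms by (auto simp: skew_self_adjoint_def)
  obtain B where B: "bounded_antilinear B" "\<And>x y. cinner (A x) y = cnj (cinner x (B y))"
    using ex_antilinear_adjoint[OF A] by metis
  have "B = (\<lambda>x. - A x)" using antilinear_adjoint_unique[OF B] e by simp
  then have "cinner (A x) y = - cinner (A y) x" for x y
    using B(2)[of x y] cinner_commute[of x "A y"] by (simp add: cinner_minus_right)
  with A show ?thesis unfolding skew_antilinear_def by blast
qed

lemma skew_antilinearD:
  assumes "skew_antilinear A"
  shows "bounded_antilinear A" "antilinear A" "bounded_linear A" "cinner (A x) y = - cinner (A y) x"
    "inner (A x) y = - inner x (A y)"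
proof -
  show a: "bounded_antilinear A" and s: "cinner (A x) y = - cinner (A y) x"
    using assms unfolding skew_antilinear_def by blast+
  then show "antilinear A" by (simp add: bounded_antilinear_def)
  show "bounded_linear A" by (rule bounded_antilinear_imp_bounded_linear[OF a])
  show "inner (A x) y = - inner x (A y)"
    unfolding inner_commute[of x "A y"] by (simp only: inner_Re_cinner s uminus_complex.sel)
qed

text \<open>
  Polar decomposition. The range of \<open>\<lambda>z. (Q z, A z)\<close> and that of \<open>\<lambda>z. (Q z, - A z)\<close> are orthogonal in
  \<open>H \<times> H\<close> for \<open>Q = \<bar>A\<bar>\<close>, so the projection onto a closed subspace separating them maps \<open>(2 Q z, 0)\<close>
  to \<open>(Q z, A z)\<close>; its off-diagonal block is half the partial isometry \<open>U\<close>.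
\<close>

lemma skew_antilinear_polar:
  fixes A :: "'a::chilbert_space \<Rightarrow> 'a"
  assumes A: "skew_antilinear A"
  obtains Q U where "pos_op Q" "\<And>x. Q (\<i> *\<^sub>C x) = \<i> *\<^sub>C Q x" "skew_antilinear U"
    "\<And>x. U (Q x) = A x" "\<And>x. Q (U x) = A x" "\<And>x. A (U x) = U (A x)" "\<And>x. A x = 0 \<Longrightarrow> U x = 0"
    "\<And>x. \<forall>n. A n = 0 \<longrightarrow> inner x n = 0 \<Longrightarrow> U (U x) = - x"
proof -
  note Aa = skew_antilinearD[OF A]
  note Al = antilinearD[OF Aa(2)]
  have S: "pos_op (\<lambda>x. - A (A x))" unfolding pos_op_def selfadj_def
  proof (intro conjI allI)
    show "bounded_linear (\<lambda>x. - A (A x))" by (intro bounded_linear_minus bounded_linear_compose[OF Aa(3) Aa(3)])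
    show "inner (- A (A x)) y = inner x (- A (A y))" for x y by (simp add: Aa(5)[of "A x"] Aa(5)[of x])
    show "0 \<le> inner (- A (A x)) x" for x by (simp add: Aa(5)[of "A x"])
  qed
  obtain Q where Q: "pos_op Q" "\<And>x. Q (Q x) = - A (A x)"
    "\<And>B x. bounded_linear B \<Longrightarrow> (\<And>x. B (- A (A x)) = - A (A (B x))) \<Longrightarrow> B (Q x) = Q (B x)"
    using ex_pos_sqrt[OF S] by metis
  note Qd = selfadjD[OF pos_opD(1)[OF Q(1)]]
  have QA: "A (Q x) = Q (A x)" for x by (rule Q(3)[OF Aa(3)]) (simp add: Al)
  have Qi: "\<i> *\<^sub>C Q x = Q (\<i> *\<^sub>C x)" for x
    by (rule Q(3)[OF bounded_linear_scaleC]) (simp add: Al scaleC_minus_right scaleC_minus_left)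
  have QA0: "Q x = 0 \<longleftrightarrow> A x = 0" for x
  proof -
    have "inner (Q x) (Q x) = inner (A x) (A x)"
      by (simp add: Qd(3) Q(2) Aa(5))
    then show ?thesis by (metis inner_eq_zero_iff)
  qed
  \<comment> \<open>The first equation is orthogonality to all (Q z, - A z), the second to all (A z,
    Q z). Together they make \<open>L\<close> invariant under the rotation (x, y) -> (- y, x), which
    gives the projection equal diagonal blocks \<open>a\<close> and opposite off-diagonal blocks
    \<open>b\<close>, \<open>- b\<close>.\<close>
  define L :: "('a \<times> 'a) set" where "L = {w. Q (fst w) + A (snd w) = 0 \<and> Q (snd w) - A (fst w) = 0}"
  have "subspace L"
  proof (rule subspaceI)
    show "0 \<in> L" by (simp add: L_def Qd Al)
    show "v + w \<in> L" if "v \<in> L" "w \<in> L" for v w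
    proof -
      have "Q (fst v) = - A (snd v)" "Q (fst w) = - A (snd w)" "Q (snd v) = A (fst v)" "Q (snd w) = A (fst w)"
        using that by (auto simp: L_def eq_neg_iff_add_eq_0)
      then show ?thesis by (simp add: L_def Qd Al)
    qed
    show "c *\<^sub>R v \<in> L" if "v \<in> L" for c v
      using that by (simp add: L_def Qd Al flip: scaleR_add_right scaleR_diff_right)
  qed
  moreover have "closed L"
  proof -
    have "continuous_on UNIV (\<lambda>w. Q (fst w) + A (snd w))" "continuous_on UNIV (\<lambda>w. Q (snd w) - A (fst w))"
      by (intro continuous_on_add continuous_on_diff linear_continuous_on
          bounded_linear_compose[OF Qd(1) bounded_linear_fst] bounded_linear_compose[OF Qd(1) bounded_linear_snd]
          bounded_linear_compose[OF Aa(3) bounded_linear_fst] bounded_linear_compose[OF Aa(3) bounded_linear_snd])+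
    from closed_Int[OF continuous_closed_preimage_constant[OF this(1), of 0] continuous_closed_preimage_constant[OF this(2), of 0]]
    show ?thesis by (simp add: L_def Collect_conj_eq)
  qed
  ultimately obtain E where E: "orth_proj E" "\<And>w. E w \<in> L" "\<And>w. w \<in> L \<Longrightarrow> E w = w"
    "\<And>w. (\<And>v. v \<in> L \<Longrightarrow> inner w v = 0) \<Longrightarrow> E w = 0" using ex_orth_proj by metis
  note Ed = selfadjD[OF orth_projD(1)[OF E(1)]] and EE = orth_projD(2)[OF E(1)]
  have comm: "E (B w) = B (E w)" if "\<And>v w. inner (B v) w = c * inner v (B w)" "\<And>w. w \<in> L \<Longrightarrow> B w \<in> L" for B c w
    by (rule orth_proj_commute[OF E(1) that(1)]) (rule E(3)[OF that(2)[OF E(2)]])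
  define a where "a x = fst (E (x, 0))" for x
  define b where "b x = snd (E (x, 0))" for x
  have E1: "E (x, 0) = (a x, b x)" for x by (simp add: a_def b_def)
  have E2: "E (0, y) = (- b y, a y)" for y
  proof -
    have "E ((\<lambda>w. (- snd w, fst w)) (y, 0)) = (\<lambda>w. (- snd w, fst w)) (E (y, 0))"
    proof (rule comm[of _ "-1"])
      show "(- snd w, fst w) \<in> L" if "w \<in> L" for w
        using that by (simp add: L_def Qd Al add.commute) (metis add.inverse_inverse add_eq_0_iff eq_iff_diff_eq_0)
    qed (simp add: inner_prod_def)
    then show ?thesis by (simp add: E1)
  qed
  have EQA: "E (Q z, A z) = (Q z, A z)" for z
    by (rule E(3)) (simp add: L_def Q(2) QA)
  have EQA': "E (Q z, - A z) = 0" for z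
  proof (rule E(4))
    fix v assume v: "v \<in> L"
    have "inner (Q z, - A z) v = inner z (Q (fst v) + A (snd v))"
      by (simp add: inner_prod_def Qd(3) Aa(5) inner_add_right)
    then show "inner (Q z, - A z) v = 0" using v by (simp add: L_def)
  qed
  have "E (2 *\<^sub>R Q z, 0) = (Q z, A z)" for z
  proof -
    have "(2 *\<^sub>R Q z, 0) = (Q z, A z) + (Q z, - A z)" by (simp add: scaleR_2)
    then show ?thesis by (simp only: Ed(4) EQA EQA' add_0_right)
  qed
  then have abQ: "a (2 *\<^sub>R Q z) = Q z" "b (2 *\<^sub>R Q z) = A z" for z by (simp_all add: a_def b_def)
  have asc: "a (r *\<^sub>R x) = r *\<^sub>R a x" and bsc: "b (r *\<^sub>R x) = r *\<^sub>R b x"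
    and aadd: "a (x + y) = a x + a y" and badd: "b (x + y) = b x + b y" for r x y
    using Ed(6)[of r "(x, 0)"] Ed(4)[of "(x,0)" "(y,0)"] by (simp_all add: a_def b_def)
  have nb: "norm (b x) \<le> norm x * 1" for x
  proof -
    have "norm (b x) \<le> norm (E (x, 0))" by (simp add: E1 norm_Pair real_le_rsqrt)
    also have "\<dots> \<le> norm (x, 0::'a)" by (rule orth_proj_norm_le[OF E(1)])
    finally show ?thesis by simp
  qed
  have bskew: "inner (b x) y = - inner x (b y)" for x y
    using Ed(3)[of "(x, 0)" "(0, y)"] by (simp add: E1 E2 inner_prod_def)
  have asym: "inner (a x) y = inner x (a y)" for x y
    using Ed(3)[of "(x, 0)" "(y, 0)"] by (simp add: E1 inner_prod_def)
  have bQ: "b (Q x) = Q (b x)" for x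
  proof -
    have "E ((\<lambda>w. (Q (fst w), Q (snd w))) (x, 0)) = (\<lambda>w. (Q (fst w), Q (snd w))) (E (x, 0))"
    proof (rule comm[of _ 1])
      show "(Q (fst w), Q (snd w)) \<in> L" if "w \<in> L" for w
      proof -
        have "Q (Q (fst w)) + A (Q (snd w)) = Q (Q (fst w) + A (snd w))"
          "Q (Q (snd w)) - A (Q (fst w)) = Q (Q (snd w) - A (fst w))" by (simp_all only: Qd(4,5) QA)
        then show ?thesis using that by (simp add: L_def Qd(7))
      qed
    qed (simp add: inner_prod_def Qd(3))
    then show ?thesis by (simp add: E1 Qd)
  qed
  \<comment> \<open>Since \<open>Q\<close> is complex-linear and \<open>A\<close> antilinear,
    \<open>L\<close> is invariant under (x, y) -> (\<i> x, - \<i> y); the opposite signs in the two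
    components make \<open>b\<close> anticommute with \<i>.\<close>
  have bi: "b (\<i> *\<^sub>C x) = - (\<i> *\<^sub>C b x)" for x
  proof -
    have "E ((\<lambda>w. (\<i> *\<^sub>C fst w, - (\<i> *\<^sub>C snd w))) (x, 0)) = (\<lambda>w. (\<i> *\<^sub>C fst w, - (\<i> *\<^sub>C snd w))) (E (x, 0))"
    proof (rule comm[of _ "-1"])
      show "(\<i> *\<^sub>C fst w, - (\<i> *\<^sub>C snd w)) \<in> L" if "w \<in> L" for w
      proof -
        have "Q (fst w) = - A (snd w)" "Q (snd w) = A (fst w)"
          using that by (auto simp: L_def eq_neg_iff_add_eq_0)
        then show ?thesis
          by (simp add: L_def Qi[symmetric] Qd Al scaleC_minus_left scaleC_minus_right)
      qed
    qed (simp add: inner_prod_def inner_i_left)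
    then show ?thesis by (simp add: E1)
  qed
  define U where "U x = 2 *\<^sub>R b x" for x
  have blU: "bounded_linear U"
    unfolding U_def by (intro bounded_linear_const_scaleR bounded_linear_intro[OF badd bsc nb])
  have Ui: "U (\<i> *\<^sub>C x) = - (\<i> *\<^sub>C U x)" for x
    by (simp add: U_def bi scaleR_scaleC scaleC_scaleC scaleC_minus_right mult.commute)
  have Uskew: "inner (U x) y = - inner x (U y)" for x y by (simp add: U_def bskew)
  have skU: "skew_antilinear U" unfolding skew_antilinear_def
  proof (intro conjI allI)
    show "bounded_antilinear U" by (rule bounded_antilinearI[OF blU Ui])
    show "cinner (U x) y = - cinner (U y) x" for x y
    proof -
      have "inner (U x) y = - inner (U y) x" using Uskew[of x y] by (simp add: inner_commute)
      moreover have "inner (U x) (\<i> *\<^sub>C y) = - inner (U y) (\<i> *\<^sub>C x)"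
        by (simp add: Uskew[of x] Ui inner_i_left[of "U y", symmetric] inner_commute[of x])
      ultimately show ?thesis by (simp add: complex_eq_iff inner_Re_cinner[symmetric] Im_cinner)
    qed
  qed
  have UQ: "U (Q x) = A x" for x using abQ(2)[of x] by (simp add: U_def bsc)
  have QU: "Q (U x) = A x" for x using UQ[of x] by (simp add: U_def bQ Qd)
  have AU: "A (U x) = U (A x)" for x by (simp add: UQ[symmetric] QU)
  have ker: "a n = n" "b n = 0" if "A n = 0" for n
    using E(3)[of "(n, 0)"] that QA0[of n] by (simp_all add: L_def a_def b_def Qd Al)
  have U0: "U x = 0" if "A x = 0" for x using ker(2)[OF that] by (simp add: U_def)
  \<comment> \<open>The symmetric map r = 2 a - 1 kills the range of \<open>Q\<close>, so its values
    lie in the kernel, where \<open>r\<close> is the identity. Hence |r x|^2 = <x, r x> = 0 for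
    \<open>x\<close> orthogonal to the kernel, so a x = x / 2. The first component of E^2 = E then
    gives b^2 = 1/4 - 1/2 = -1/4 on such \<open>x\<close>.\<close>
  have UU: "U (U x) = - x" if x: "\<forall>n. A n = 0 \<longrightarrow> inner x n = 0" for x
  proof -
    define r where "r x = 2 *\<^sub>R a x - x" for x
    have rQ: "r (Q z) = 0" for z using abQ(1)[of z] by (simp add: r_def asc)
    have rsym: "inner (r x) y = inner x (r y)" for x y
      by (simp add: r_def inner_diff_left inner_diff_right asym)
    have "inner (Q (r x)) (Q (r x)) = 0" by (simp add: Qd(3) rsym rQ)
    then have k: "A (r x) = 0" by (simp add: QA0)
    then have "r (r x) = r x" by (simp add: r_def[of "r x"] ker scaleR_2)
    then have "inner (r x) (r x) = inner x (r x)" by (simp add: rsym)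
    then have "r x = 0" using x k by simp
    then have "(1/2) *\<^sub>R (2 *\<^sub>R a x) = (1/2) *\<^sub>R x" by (simp add: r_def)
    then have ax: "a x = (1/2) *\<^sub>R x" by simp
    have "E (E (x, 0)) = E (a x, 0) + E (0, b x)" by (simp add: E1[of x] flip: Ed(4))
    then have "a x = a (a x) - b (b x)" using EE[of "(x, 0)"] by (simp add: E1 E2)
    then have "b (b x) = (1/4) *\<^sub>R x - (1/2) *\<^sub>R x" by (simp add: ax asc algebra_simps)
    then have "b (b x) = (1/4 - 1/2) *\<^sub>R x" by (simp only: scaleR_diff_left)
    then have "b (b x) = - ((1/4) *\<^sub>R x)" by simp
    then show ?thesis by (simp add: U_def bsc)
  qed
  show thesis
    by (rule that[of Q U]) (use Q(1) Qi skU UQ QU AU U0 UU in auto)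
qed

section \<open>Orthonormal sets\<close>

abbreviation cspan :: "'a::complex_vector set \<Rightarrow> 'a set" where
  "cspan \<equiv> complex_vector.span"

abbreviation csubspace :: "'a::complex_vector set \<Rightarrow> bool" where
  "csubspace \<equiv> complex_vector.subspace"

definition orthonormal_set :: "'a::complex_inner set \<Rightarrow> bool" where
  "orthonormal_set B \<longleftrightarrow> (\<forall>x\<in>B. \<forall>y\<in>B. cinner x y = (if x = y then 1 else 0))"

definition fourier_sum :: "'a::complex_inner set \<Rightarrow> 'a \<Rightarrow> 'a" where
  "fourier_sum B x = (\<Sum>b\<in>B. cinner x b *\<^sub>C b)"

lemma cnj_cinner: "cnj (cinner x y) = cinner y (x::'a::complex_inner)"
  by (metis cinner_commute)

lemma cinner_eq_0_commute: "cinner x y = 0 \<longleftrightarrow> cinner y (x::'a::complex_inner) = 0"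
  by (metis cinner_commute complex_cnj_zero)

lemma csubspace_real_subspace: "csubspace V \<Longrightarrow> subspace (V::'a::complex_vector set)"
  unfolding complex_vector.subspace_def subspace_def by (auto simp: scaleR_scaleC)

lemma cinner_span_eq_0:
  assumes "\<And>b. b \<in> B \<Longrightarrow> cinner x b = 0" "v \<in> cspan B"
  shows "cinner x v = 0"
  using assms(2)
  by (induction rule: complex_vector.span_induct_alt)
    (auto simp: cinner_add_right cinner_scaleC_right assms(1))

context
  fixes B :: "'a::complex_inner set"
  assumes fin: "finite B" and on: "orthonormal_set B"
begin

lemma fourier_sum_in_span: "fourier_sum B x \<in> cspan B"
  unfolding fourier_sum_def
  by (intro complex_vector.span_sum complex_vector.span_scale complex_vector.span_base)

lemma cinner_fourier_sum: "b \<in> B \<Longrightarrow> cinner (fourier_sum B x) b = cinner x b"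
proof -
  assume b: "b \<in> B"
  have "cinner (fourier_sum B x) b = (\<Sum>b'\<in>B. cinner x b' * (if b' = b then 1 else 0))"
    unfolding fourier_sum_def cinner_sum_left using on b
    by (intro sum.cong) (auto simp: cinner_scaleC_left orthonormal_set_def)
  also have "\<dots> = (\<Sum>b'\<in>B. if b' = b then cinner x b else 0)" by (intro sum.cong) auto
  finally show ?thesis using fin b by simp
qed

lemma fourier_sum_residual: "v \<in> cspan B \<Longrightarrow> cinner (x - fourier_sum B x) v = 0"
  by (rule cinner_span_eq_0[of B]) (auto simp: cinner_diff_left cinner_fourier_sum)

lemma fourier_sum_id: "x \<in> cspan B \<Longrightarrow> fourier_sum B x = x"
proof -
  assume "x \<in> cspan B"
  then have "x - fourier_sum B x \<in> cspan B"
    by (intro complex_vector.span_diff fourier_sum_in_span)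
  from fourier_sum_residual[OF this, of x] show ?thesis by simp
qed

lemma orth_proj_fourier_sum: "orth_proj (fourier_sum B)"
proof -
  have "bounded_linear (fourier_sum B)"
  proof -
    have "bounded_linear (\<lambda>x. cinner x b *\<^sub>C b)" for b :: 'a
      by (rule bounded_linear_intro[where K="norm b * norm b"])
        (use cmod_cinner_le[of _ b] in \<open>auto simp: cinner_add_left scaleC_add_left cinner_scaleC_left
          scaleC_scaleC scaleR_scaleC norm_scaleC mult_right_mono mult.assoc[symmetric]\<close>)
    then show ?thesis unfolding fourier_sum_def by (intro bounded_linear_sum)
  qed
  moreover have "inner (fourier_sum B x) y = inner x (fourier_sum B y)" for x y
  proof -
    have "cinner (fourier_sum B x) y = cinner x (fourier_sum B y)"
      unfolding fourier_sum_def cinner_sum_left cinner_sum_right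
      by (intro sum.cong) (auto simp: cinner_scaleC_left cinner_scaleC_right cnj_cinner)
    then show ?thesis by (simp add: inner_Re_cinner)
  qed
  ultimately show ?thesis unfolding orth_proj_def selfadj_def
    using fourier_sum_id[OF fourier_sum_in_span] by blast
qed

lemma fourier_sum_scaleC: "fourier_sum B (c *\<^sub>C x) = c *\<^sub>C fourier_sum B x"
  by (simp add: fourier_sum_def scaleC_sum_right cinner_scaleC_left scaleC_scaleC)

lemma closed_cspan_finite_orthonormal: "closed (cspan B)"
proof -
  note P = selfadjD[OF orth_projD(1)[OF orth_proj_fourier_sum]]
  have "x \<in> cspan B \<longleftrightarrow> fourier_sum B x - x = 0" for x
    using fourier_sum_id[of x] fourier_sum_in_span[of x] by auto
  then have "cspan B = {x. fourier_sum B x - x = 0}" by blast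
  moreover have "continuous_on UNIV (\<lambda>x. fourier_sum B x - x)"
    by (intro continuous_on_diff linear_continuous_on P continuous_on_id)
  ultimately show ?thesis using continuous_closed_preimage_constant[of UNIV _ 0] by force
qed

lemma orthonormal_set_independent: "complex_vector.independent B"
proof (rule complex_vector.independent_if_scalars_zero[OF fin])
  fix f x assume 0: "(\<Sum>x\<in>B. f x *\<^sub>C x) = 0" and x: "x \<in> B"
  have "0 = cinner (\<Sum>x\<in>B. f x *\<^sub>C x) x" using 0 by simp
  also have "\<dots> = (\<Sum>y\<in>B. f y * (if y = x then 1 else 0))"
    unfolding cinner_sum_left using on x
    by (intro sum.cong) (auto simp: cinner_scaleC_left orthonormal_set_def)
  also have "\<dots> = (\<Sum>y\<in>B. if y = x then f x else 0)" by (intro sum.cong) auto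
  finally show "f x = 0" using fin x by simp
qed

lemma bessel_finite: "(\<Sum>b\<in>B. (cmod (cinner x b))\<^sup>2) \<le> (norm x)\<^sup>2"
proof -
  have "complex_of_real (\<Sum>b\<in>B. (cmod (cinner x b))\<^sup>2) = (\<Sum>b\<in>B. cinner x b * cinner b x)"
    by (simp add: complex_norm_square cnj_cinner del: of_real_power)
  also have "\<dots> = cinner (fourier_sum B x) x"
    unfolding fourier_sum_def cinner_sum_left by (simp add: cinner_scaleC_left)
  finally have "(\<Sum>b\<in>B. (cmod (cinner x b))\<^sup>2) = inner (fourier_sum B x) x"
    by (metis Re_complex_of_real inner_Re_cinner)
  also have "\<dots> \<le> norm (fourier_sum B x) * norm x" by (rule norm_cauchy_schwarz)
  also have "\<dots> \<le> norm x * norm x"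
    by (intro mult_right_mono orth_proj_norm_le orth_proj_fourier_sum) auto
  finally show ?thesis by (simp add: power2_eq_square)
qed

text \<open>One Gram-Schmidt step; \<open>B \<subseteq> V\<close> keeps the new vector inside
  \<open>V\<close>.\<close>

lemma orthonormal_extend:
  assumes V: "csubspace V" "B \<subseteq> V" and x: "x \<in> V"
  obtains e where "e \<in> V" "x \<in> cspan (insert e B)" "norm e = 1" "\<And>b. b \<in> B \<Longrightarrow> cinner e b = 0"
  | "x \<in> cspan B"
proof (cases "x \<in> cspan B")
  case False
  define z where "z = x - fourier_sum B x"
  have z0: "z \<noteq> 0" using False fourier_sum_in_span[of x] by (auto simp: z_def)
  define e where "e = (1 / norm z) *\<^sub>R z"
  have xe: "x = norm z *\<^sub>R e + fourier_sum B x" using z0 by (simp add: e_def z_def)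
  have "fourier_sum B x \<in> V"
    using fourier_sum_in_span[of x] complex_vector.span_minimal[OF V(2,1)] by blast
  then have "e \<in> V" unfolding e_def z_def scaleR_scaleC
    using V x by (intro complex_vector.subspace_scale complex_vector.subspace_diff)
  moreover have "x \<in> cspan (insert e B)"
    by (subst xe, unfold scaleR_scaleC, intro complex_vector.span_add complex_vector.span_scale)
      (auto intro: complex_vector.span_base complex_vector.span_mono[THEN subsetD, OF _ fourier_sum_in_span])
  moreover have "norm e = 1" using z0 by (simp add: e_def)
  moreover have "cinner e b = 0" if "b \<in> B" for b
    using fourier_sum_residual[of b x] complex_vector.span_base[OF that]
    by (simp add: e_def z_def cinner_scaleR_left)
  ultimately show thesis using that by blast
qed (use that in blast)

end

lemma orthonormal_insert:
  assumes "orthonormal_set B" "norm e = 1" "\<And>b. b \<in> B \<Longrightarrow> cinner e b = 0"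
  shows "orthonormal_set (insert e B)" "e \<notin> B"
proof -
  have "cinner e e = 1" using assms(2) by (simp add: cinner_self)
  then show "orthonormal_set (insert e B)" "e \<notin> B"
    using assms unfolding orthonormal_set_def
    by (auto simp: cinner_eq_0_commute[of _ e])
qed

text \<open>An orthonormal set with fewer than dim V elements cannot span \<open>V\<close>, so
  Gram-Schmidt can continue. For infinite-dimensional \<open>V\<close> the value of
  \<open>dim\<close> is 0 and the empty set serves.\<close>

lemma ex_orthonormal_dim:
  fixes V :: "'a::complex_inner set"
  assumes V: "csubspace V"
  obtains B where "finite B" "orthonormal_set B" "B \<subseteq> V" "card B = complex_vector.dim V"
proof -
  have "\<exists>B. finite B \<and> orthonormal_set B \<and> B \<subseteq> V \<and> card B = k" if "k \<le> complex_vector.dim V" for k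
    using that
  proof (induction k)
    case 0
    show ?case by (rule exI[of _ "{}"]) (simp add: orthonormal_set_def)
  next
    case (Suc k)
    then obtain B where B: "finite B" "orthonormal_set B" "B \<subseteq> V" "card B = k" by auto
    have "\<not> V \<subseteq> cspan B" using complex_vector.dim_le_card[of V B] B Suc by auto
    then obtain x where x: "x \<in> V" "x \<notin> cspan B" by blast
    obtain e where e: "e \<in> V" "norm e = 1" "\<And>b. b \<in> B \<Longrightarrow> cinner e b = 0"
      using orthonormal_extend[OF B(1,2) V B(3) x(1)] x(2) by metis
    from orthonormal_insert[OF B(2) e(2,3)] B e(1) show ?case
      by (intro exI[of _ "insert e B"]) auto
  qed
  from this[OF order_refl] that show thesis by blast
qed

section \<open>Splitting off blocks\<close>

definition block_vecs :: "('a \<times> 'a \<times> real \<times> real) list \<Rightarrow> 'a set" where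
  "block_vecs L = (\<Union>(e, f, d, r)\<in>set L. {e, f})"

text \<open>Each pair is charged once although both of its vectors may err by \<open>r\<close>; the
  factor 2 appears when the pairs are flattened into one basis.\<close>

definition block_cost :: "real \<Rightarrow> ('a \<times> 'a \<times> real \<times> real) list \<Rightarrow> real" where
  "block_cost q L = (\<Sum>(e, f, d, r)\<leftarrow>L. r powr q)"

lemma block_vecs_simps [simp]:
  "block_vecs [] = {}" "block_vecs (L @ L') = block_vecs L \<union> block_vecs L'" "block_vecs [(e, f, d, r)] = {e, f}"
  by (auto simp: block_vecs_def)

lemma block_cost_simps [simp]:
  "block_cost q [] = 0" "block_cost q (L @ L') = block_cost q L + block_cost q L'"
  "block_cost q [(e, f, d, r)] = r powr q"
  by (auto simp: block_cost_def)

lemma cspan_mono_in: "x \<in> cspan B \<Longrightarrow> B \<subseteq> B' \<Longrightarrow> x \<in> cspan B'"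
  using complex_vector.span_mono by blast

lemma csubspace_null_space: "antilinear A \<Longrightarrow> csubspace (null_space A)"
  unfolding complex_vector.subspace_def null_space_def by (auto simp: antilinearD)

text \<open>
  An entry \<open>(e, f, d, r)\<close> of a list of blocks stands for the pair of basis vectors \<open>e, f\<close> with
  \<open>D e = d f\<close>, \<open>D f = - d e\<close>, where \<open>A - D\<close> maps \<open>e\<close> and \<open>f\<close> into the span of the earlier blocks up
  to an error of norm at most \<open>r\<close>.
\<close>

locale polar_decomposition =
  fixes A Q U :: "'a::chilbert_space \<Rightarrow> 'a" and C :: real
  assumes A: "skew_antilinear A" and Q: "pos_op Q" and Qi: "Q (\<i> *\<^sub>C x) = \<i> *\<^sub>C Q x"
    and U: "skew_antilinear U" and UQ: "U (Q x) = A x" and QU: "Q (U x) = A x"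
    and AU: "A (U x) = U (A x)" and U0: "A x = 0 \<Longrightarrow> U x = 0"
    and UU: "\<forall>n. A n = 0 \<longrightarrow> inner x n = 0 \<Longrightarrow> U (U x) = - x"
    and QC: "norm (Q x) \<le> C * norm x" and C: "C > 0"
    and odd_extend: "finite B \<Longrightarrow> orthonormal_set B \<Longrightarrow> B \<subseteq> null_space A \<Longrightarrow> odd (card B) \<Longrightarrow>
      \<exists>y\<in>null_space A. norm y = 1 \<and> (\<forall>b\<in>B. cinner y b = 0)"
begin

text \<open>Real orthogonality to the kernel amounts to complex orthogonality because the kernel is
  a complex subspace.\<close>

definition X :: "'a set" where "X = {x. \<forall>n. A n = 0 \<longrightarrow> inner x n = 0}"

lemmas Aa = skew_antilinearD[OF A] and Al = antilinearD[OF skew_antilinearD(2)[OF A]]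
lemmas Ua = skew_antilinearD[OF U] and Ul = antilinearD[OF skew_antilinearD(2)[OF U]]
lemmas Qd = selfadjD[OF pos_opD(1)[OF Q]]

lemma X_cinner: "x \<in> X \<Longrightarrow> A n = 0 \<Longrightarrow> cinner x n = 0"
  by (auto simp: X_def cinner_eq_0_iff_inner Al)

lemma csubspace_X: "csubspace X"
  unfolding complex_vector.subspace_def
proof (intro conjI ballI allI)
  show "0 \<in> X" by (simp add: X_def)
  show "x + y \<in> X" if "x \<in> X" "y \<in> X" for x y using that by (simp add: X_def inner_add_left)
  show "c *\<^sub>C x \<in> X" if "x \<in> X" for c x
    using that X_cinner[OF that] unfolding X_def by (simp add: inner_Re_cinner cinner_scaleC_left)
qed

lemma U_in_X: "U x \<in> X"
  by (simp add: X_def Ua(5) U0)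

lemma UU_X: "x \<in> X \<Longrightarrow> U (U x) = - x"
  by (rule UU) (simp add: X_def)

lemma norm_U: "x \<in> X \<Longrightarrow> norm (U x) = norm x"
  by (simp add: norm_eq_sqrt_inner Ua(5)[of x] UU_X)

lemma not_kernel_X: "x \<in> X \<Longrightarrow> norm x = 1 \<Longrightarrow> A x \<noteq> 0"
  using X_cinner[of x x] by (auto simp: cinner_self)

text \<open>This is why the blocks are two-dimensional: antisymmetry makes \<open>x\<close> and
  \<open>U x\<close> orthogonal with no further choice.\<close>

lemma cinner_U_self: "cinner (U x) x = 0"
  using Ua(4)[of x x] by simp

text \<open>The bound on \<open>d\<close> is what makes the block operator bounded. The errors
  \<open>v\<close>, \<open>w\<close> are measured only modulo the span of the earlier blocks, since
  components in that span cost nothing.\<close>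

definition new_block :: "('a \<times> 'a \<times> real \<times> real) list \<Rightarrow> 'a \<Rightarrow> 'a \<Rightarrow> real \<Rightarrow> real \<Rightarrow> bool" where
  "new_block L e f d r \<longleftrightarrow> norm e = 1 \<and> norm f = 1 \<and> cinner e f = 0 \<and>
     (\<forall>b\<in>block_vecs L. cinner e b = 0 \<and> cinner f b = 0) \<and>
     (A e = 0 \<and> A f = 0 \<or> e \<in> X \<and> f = U e) \<and> \<bar>d\<bar> \<le> C \<and>
     (\<exists>v w. norm v \<le> r \<and> norm w \<le> r \<and> A e - d *\<^sub>R f - v \<in> cspan (block_vecs L) \<and>
        A f + d *\<^sub>R e - w \<in> cspan (block_vecs L))"

definition good :: "('a \<times> 'a \<times> real \<times> real) list \<Rightarrow> bool" where
  "good L \<longleftrightarrow> (\<forall>n<length L. case L ! n of (e, f, d, r) \<Rightarrow> new_block (take n L) e f d r)"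

lemma good_Nil: "good []"
  by (simp add: good_def)

lemma good_snoc: "good (L @ [(e, f, d, r)]) \<longleftrightarrow> good L \<and> new_block L e f d r"
  by (simp add: good_def All_less_Suc nth_append conj_commute)

text \<open>The invariants behind the two extension steps: a \<open>U\<close>-invariant span makes
  the projection onto it commute with \<open>U\<close>; an even number of kernel vectors leaves room
  for another pair; and block vectors outside the kernel lie in \<open>X\<close>, hence are
  orthogonal to every new kernel vector.\<close>

lemma good_vecs:
  assumes "good L"
  shows "finite (block_vecs L)" "orthonormal_set (block_vecs L)"
    "even (card (block_vecs L \<inter> null_space A))" "block_vecs L \<subseteq> null_space A \<union> X"
    "b \<in> block_vecs L \<Longrightarrow> U b \<in> cspan (block_vecs L)"
proof -
  have "finite (block_vecs L) \<and> orthonormal_set (block_vecs L) \<and>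
    even (card (block_vecs L \<inter> null_space A)) \<and> block_vecs L \<subseteq> null_space A \<union> X \<and>
    (\<forall>b\<in>block_vecs L. U b \<in> cspan (block_vecs L))"
    using assms
  proof (induction L rule: rev_induct)
    case Nil
    show ?case by (simp add: orthonormal_set_def)
  next
    case (snoc t L)
    obtain e f d r where t: "t = (e, f, d, r)" by (cases t)
    from snoc.prems have g: "good L" and n: "new_block L e f d r" by (auto simp: t good_snoc)
    let ?B = "block_vecs L"
    from snoc.IH[OF g] have IH: "finite ?B" "orthonormal_set ?B" "even (card (?B \<inter> null_space A))"
      "?B \<subseteq> null_space A \<union> X" "\<And>b. b \<in> ?B \<Longrightarrow> U b \<in> cspan ?B" by auto
    have ef: "norm e = 1" "norm f = 1" "cinner e f = 0" "\<And>b. b \<in> ?B \<Longrightarrow> cinner e b = 0" "\<And>b. b \<in> ?B \<Longrightarrow> cinner f b = 0"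
      and ty: "A e = 0 \<and> A f = 0 \<or> e \<in> X \<and> f = U e" using n by (auto simp: new_block_def)
    have vec: "block_vecs (L @ [t]) = insert e (insert f ?B)" by (auto simp: t)
    have f1: "orthonormal_set (insert f ?B)" "f \<notin> ?B"
      using orthonormal_insert[OF IH(2) ef(2,5)] by auto
    have e1: "orthonormal_set (insert e (insert f ?B))" "e \<notin> insert f ?B"
      using orthonormal_insert[OF f1(1) ef(1)] ef(3,4) by auto
    have "even (card (insert e (insert f ?B) \<inter> null_space A))"
    proof (cases "A e = 0 \<and> A f = 0")
      case True
      then have "insert e (insert f ?B) \<inter> null_space A = insert e (insert f (?B \<inter> null_space A))"
        by (auto simp: null_space_def)
      then show ?thesis using IH(1,3) e1(2) f1(2) by simp
    next
      case False
      with ty have "e \<in> X" "f \<in> X" using U_in_X by auto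
      then have "insert e (insert f ?B) \<inter> null_space A = ?B \<inter> null_space A"
        using not_kernel_X ef(1,2) by (auto simp: null_space_def)
      then show ?thesis using IH(3) by simp
    qed
    moreover have "U b \<in> cspan (insert e (insert f ?B))" if "b \<in> insert e (insert f ?B)" for b
    proof (cases "b \<in> ?B")
      case True
      then show ?thesis using IH(5) cspan_mono_in by blast
    next
      case False
      with that have b: "b = e \<or> b = f" by blast
      show ?thesis
      proof (cases "A e = 0 \<and> A f = 0")
        case True
        then have "U b = 0" using b U0 by auto
        then show ?thesis by (simp add: complex_vector.span_zero)
      next
        case False
        with ty have X: "e \<in> X" "f = U e" by auto
        have "f \<in> cspan (insert e (insert f ?B))" "- e \<in> cspan (insert e (insert f ?B))"
          by (auto intro: complex_vector.span_base complex_vector.span_neg)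
        moreover have "U b = f \<or> U b = - e" using b X UU_X by auto
        ultimately show ?thesis by auto
      qed
    qed
    moreover have "insert e (insert f ?B) \<subseteq> null_space A \<union> X"
      using IH(4) ty U_in_X by (auto simp: null_space_def)
    ultimately show ?case unfolding vec using IH(1) e1(1) by blast
  qed
  then show "finite (block_vecs L)" "orthonormal_set (block_vecs L)"
    "even (card (block_vecs L \<inter> null_space A))" "block_vecs L \<subseteq> null_space A \<union> X"
    "b \<in> block_vecs L \<Longrightarrow> U b \<in> cspan (block_vecs L)" by auto
qed

text \<open>A pair of kernel vectors is an exact block with \<open>d = 0\<close> and no error. After
  adding \<open>e\<close> the number of kernel vectors in use is odd, and \<open>odd_extend\<close>,
  the form the parity hypothesis takes here, supplies the partner \<open>f\<close>.\<close>

lemma kernel_step: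
  assumes L: "good L" and x: "A x = 0"
  obtains L' where "good (L @ L')" "x \<in> cspan (block_vecs (L @ L'))" "block_cost q L' = 0"
proof -
  note V = good_vecs[OF L]
  define B where "B = block_vecs L \<inter> null_space A"
  have B: "finite B" "orthonormal_set B" "B \<subseteq> null_space A" "even (card B)"
    using V by (auto simp: B_def orthonormal_set_def)
  have sub: "csubspace (null_space A)" by (rule csubspace_null_space[OF Aa(2)])
  have xN: "x \<in> null_space A" using x by (simp add: null_space_def)
  show thesis
  proof (rule orthonormal_extend[OF B(1,2) sub B(3) xN])
    assume "x \<in> cspan B"
    then show thesis using that[of "[]"] L cspan_mono_in[of x B "block_vecs L"] by (simp add: B_def)
  next
    fix e assume e: "e \<in> null_space A" "x \<in> cspan (insert e B)" "norm e = 1" "\<And>b. b \<in> B \<Longrightarrow> cinner e b = 0"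
    note ins = orthonormal_insert[OF B(2) e(3,4)]
    have "odd (card (insert e B))" using B(1,4) ins(2) by simp
    then obtain f where f: "f \<in> null_space A" "norm f = 1" "\<And>b. b \<in> insert e B \<Longrightarrow> cinner f b = 0"
      using odd_extend[of "insert e B"] B ins e(1) by auto
    have orth: "cinner y b = 0" if "y \<in> null_space A" "\<And>b. b \<in> B \<Longrightarrow> cinner y b = 0" "b \<in> block_vecs L" for y b
    proof (cases "b \<in> null_space A")
      case True
      with that show ?thesis by (simp add: B_def)
    next
      case False
      with V(4) that(3) have "b \<in> X" by auto
      then show ?thesis using X_cinner[of b y] that(1) cinner_eq_0_commute by (auto simp: null_space_def)
    qed
    have "new_block L e f 0 0" unfolding new_block_def
      using e f orth[OF e(1,4)] orth[OF f(1)] cinner_eq_0_commute[of e f] C complex_vector.span_zero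
      by (auto simp: null_space_def)
    then have "good (L @ [(e, f, 0, 0)])" using L by (simp add: good_snoc)
    moreover have "x \<in> cspan (block_vecs (L @ [(e, f, 0, 0)]))"
      by (rule cspan_mono_in[OF e(2)]) (auto simp: B_def)
    ultimately show thesis using that by fastforce
  qed
qed

text \<open>The compression T = R Q R to the complement of the old span commutes with
  \<open>P\<close>, \<open>U\<close> and \<i>, hence so do its spectral projections
  \<open>E k\<close>. So the components \<open>z k\<close> of \<open>R x\<close> stay orthogonal to
  the old blocks, \<open>U\<close> keeps each component inside its own spectral subspace, and
  different components are complex-orthogonal. Replacing \<open>Q\<close> by \<open>T\<close> only
  produces a term in the old span.\<close>

lemma range_step:
  assumes L: "good L" and x: "x \<in> X" and q: "1 < q" and \<eta>: "\<eta> > 0"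
  obtains L' where "good (L @ L')" "x \<in> cspan (block_vecs (L @ L'))" "block_cost q L' \<le> \<eta>"
proof -
  note V = good_vecs[OF L]
  define P where "P = fourier_sum (block_vecs L)"
  have P: "orth_proj P" unfolding P_def by (rule orth_proj_fourier_sum[OF V(1,2)])
  note Pd = selfadjD[OF orth_projD(1)[OF P]] and PP = orth_projD(2)[OF P]
  have Psp: "P y \<in> cspan (block_vecs L)" for y unfolding P_def by (rule fourier_sum_in_span[OF V(1,2)])
  have Pid: "P y = y" if "y \<in> cspan (block_vecs L)" for y
    unfolding P_def by (rule fourier_sum_id[OF V(1,2) that])
  have Pc: "P (c *\<^sub>C y) = c *\<^sub>C P y" for c y unfolding P_def by (rule fourier_sum_scaleC[OF V(1,2)])
  have Usp: "U y \<in> cspan (block_vecs L)" if "y \<in> cspan (block_vecs L)" for y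
    using that
    by (induction rule: complex_vector.span_induct_alt)
      (auto simp: Ul intro!: complex_vector.span_add complex_vector.span_scale complex_vector.span_zero V(5))
  have PU: "P (U y) = U (P y)" for y
    by (rule orth_proj_commute[OF P, of U "-1"]) (auto simp: Ua(5) Pid[OF Usp[OF Psp]])
  define R where "R y = y - P y" for y
  have R: "orth_proj R" unfolding R_def by (rule orth_proj_compl[OF P])
  note Rd = selfadjD[OF orth_projD(1)[OF R]]
  have PR: "P (R y) = 0" "R (P y) = 0" for y by (simp_all add: R_def Pd PP)
  have Ri: "R (\<i> *\<^sub>C y) = \<i> *\<^sub>C R y" for y by (simp add: R_def Pc scaleC_diff_right)
  have RU: "R (U y) = U (R y)" for y by (simp add: R_def PU Ul)
  define T where "T y = R (Q (R y))" for y
  have T: "selfadj T" unfolding selfadj_def T_def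
    by (auto simp: Rd(3) Qd(3) intro: bounded_linear_compose[OF Rd(1) bounded_linear_compose[OF Qd(1) Rd(1)]])
  have Tin: "inner (T y) y = inner (Q (R y)) (R y)" for y by (simp add: T_def Rd(3))
  have T0: "0 \<le> inner (T y) y" for y by (simp add: Tin pos_opD(2)[OF Q])
  have TC: "inner (T y) y \<le> C * (norm y)\<^sup>2" for y
  proof -
    have "inner (T y) y \<le> norm (Q (R y)) * norm (R y)" unfolding Tin by (rule norm_cauchy_schwarz)
    also have "\<dots> \<le> (C * norm y) * norm y"
      using orth_proj_norm_le[OF R, of y] QC[of "R y"] C
      by (intro mult_mono) (auto intro: order_trans[OF QC mult_left_mono])
    finally show ?thesis by (simp add: power2_eq_square)
  qed
  \<comment> \<open>The m + 1 slabs have width C / (m + 1) and cost (C / (m + 1))^q each, so the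
    total is C^q (m + 1)^(1 - q), which is small for large m because q > 1.\<close>
  have "(\<lambda>m. real (Suc m) powr (1 - q)) \<longlonglongrightarrow> 0"
    using q by (intro tendsto_neg_powr filterlim_compose[OF filterlim_real_sequentially filterlim_Suc]) auto
  then have "(\<lambda>m. C powr q * real (Suc m) powr (1 - q)) \<longlonglongrightarrow> C powr q * 0" by (intro tendsto_intros)
  then have "\<forall>\<^sub>F m in sequentially. C powr q * real (Suc m) powr (1 - q) < \<eta>"
    using \<eta> by (intro order_tendstoD(2)) auto
  then obtain m where m: "C powr q * real (Suc m) powr (1 - q) < \<eta>" by (auto simp: eventually_sequentially)
  define \<delta> where "\<delta> = C / real (Suc m)"
  have \<delta>: "0 < \<delta>" using C by (simp add: \<delta>_def)
  have m\<delta>: "real (Suc m) * \<delta> = C" by (simp add: \<delta>_def)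
  have cost: "real (Suc m) * \<delta> powr q \<le> \<eta>"
  proof -
    have "real (Suc m) * \<delta> powr q = C powr q * real (Suc m) powr (1 - q)"
      using C by (simp add: \<delta>_def powr_divide powr_diff)
    with m show ?thesis by simp
  qed
  have T\<delta>: "inner (T y) y \<le> real (Suc m) * \<delta> * (norm y)\<^sup>2" for y
    unfolding m\<delta> by (rule TC)
  obtain E where E: "\<And>k. k \<le> m \<Longrightarrow> spectral_proj T (E k)"
      "\<And>k x. k \<le> m \<Longrightarrow> norm (T (E k x) - (real k * \<delta>) *\<^sub>R E k x) \<le> \<delta> * norm (E k x)"
      "\<And>k l x. k \<le> m \<Longrightarrow> l \<le> m \<Longrightarrow> k \<noteq> l \<Longrightarrow> E k (E l x) = 0"
      "\<And>x. (\<Sum>k\<le>m. E k x) = x"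
    by (rule spectral_partition[OF T less_imp_le[OF \<delta>] T0 T\<delta>]) (rule that)
  have EP: "P (E k y) = E k (P y)" if "k \<le> m" for k y
    by (rule in_bicommutantD_selfadj[OF spectral_projD(2)[OF E(1)[OF that]] orth_projD(1)[OF P]])
      (simp add: T_def PR Qd Rd)
  have UT: "U (T y) = T (U y)" for y
  proof -
    have "U (T y) = R (A (R y))" by (simp add: T_def RU[symmetric] UQ)
    also have "\<dots> = T (U y)" by (simp add: T_def RU QU)
    finally show ?thesis .
  qed
  have EU: "U (E k y) = E k (U y)" if "k \<le> m" for k y
    by (rule in_bicommutantD[OF spectral_projD(2)[OF E(1)[OF that]], of U "-1"])
      (auto simp: Ua(3,5) UT)
  have Ei: "\<i> *\<^sub>C E k y = E k (\<i> *\<^sub>C y)" if "k \<le> m" for k y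
    by (rule in_bicommutantD[OF spectral_projD(2)[OF E(1)[OF that]], of "\<lambda>y. \<i> *\<^sub>C y" "-1"])
      (auto simp: bounded_linear_scaleC inner_i_left T_def Ri Qi)
  have Ei0: "inner (E k y) (E l z) = 0" if "k \<le> m" "l \<le> m" "k \<noteq> l" for k l y z
    using selfadjD(3)[OF spectral_projD(3)[OF E(1)[OF that(1)]]] E(3)[OF that] by simp
  have E0: "cinner (E k y) (E l z) = 0" if "k \<le> m" "l \<le> m" "k \<noteq> l" for k l y z
    using Ei0[OF that] Ei[OF that(2)] by (simp add: cinner_eq_0_iff_inner)
  have inX: "y \<in> X" if "U (U y) = - y" for y
    using U_in_X[of "U y"] complex_vector.subspace_neg[OF csubspace_X] that by fastforce
  define x' where "x' = R x"
  have x': "x' \<in> X" by (rule inX) (simp add: x'_def RU[symmetric] UU_X[OF x] Rd)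
  define z where "z k = E k x'" for k
  have zX: "z k \<in> X" if "k \<le> m" for k
    by (rule inX) (simp add: z_def EU[OF that] UU_X[OF x'] selfadjD(8)[OF spectral_projD(3)[OF E(1)[OF that]]])
  have zP: "P (z k) = 0" if "k \<le> m" for k
    by (simp add: z_def EP[OF that] x'_def PR selfadjD(7)[OF spectral_projD(3)[OF E(1)[OF that]]])
  \<comment> \<open>Recording that every new vector lies in the range of some \<open>E k\<close>
    with \<open>k < j\<close> is what makes the pair from component \<open>j\<close> orthogonal to
    the pairs added before it.\<close>
  have "\<exists>L'. good (L @ L') \<and> (\<forall>k<j. z k \<in> cspan (block_vecs (L @ L'))) \<and>
      (\<forall>b\<in>block_vecs L'. \<exists>k<j. \<exists>y. b = E k y) \<and> block_cost q L' \<le> real j * \<delta> powr q"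
    if "j \<le> Suc m" for j
    using that
  proof (induction j)
    case 0
    then show ?case using L by (intro exI[of _ "[]"]) auto
  next
    case (Suc j)
    then obtain L' where L': "good (L @ L')" "\<And>k. k < j \<Longrightarrow> z k \<in> cspan (block_vecs (L @ L'))"
      "\<And>b. b \<in> block_vecs L' \<Longrightarrow> \<exists>k<j. \<exists>y. b = E k y" "block_cost q L' \<le> real j * \<delta> powr q" by auto
    have jm: "j \<le> m" using Suc by simp
    show ?case
    proof (cases "z j = 0")
      case True
      have "block_cost q L' \<le> real (Suc j) * \<delta> powr q"
        using L'(4) powr_ge_zero[of \<delta> q] unfolding of_nat_Suc distrib_right by linarith
      moreover have "\<forall>k<Suc j. z k \<in> cspan (block_vecs (L @ L'))"
        using L'(2) True complex_vector.span_zero by (metis less_Suc_eq)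
      ultimately show ?thesis using L'(1,3) less_SucI by (intro exI[of _ L']) blast
    next
      case False
      define e where "e = (1 / norm (z j)) *\<^sub>R z j"
      define f where "f = U e"
      define d where "d = real j * \<delta>"
      note Ej = selfadjD[OF spectral_projD(3)[OF E(1)[OF jm]]]
      have ze: "z j = norm (z j) *\<^sub>R e" using False by (simp add: e_def)
      have eX: "e \<in> X" unfolding e_def scaleR_scaleC
        by (rule complex_vector.subspace_scale[OF csubspace_X zX[OF jm]])
      have e: "e \<in> X" "norm e = 1" using eX False by (auto simp: e_def)
      have f: "f \<in> X" "norm f = 1" using norm_U[OF e(1)] e(2) U_in_X by (auto simp: f_def)
      have eE: "e = E j ((1 / norm (z j)) *\<^sub>R x')" by (simp add: e_def z_def Ej)
      have fE: "f = E j (U ((1 / norm (z j)) *\<^sub>R x'))" by (simp add: f_def eE EU[OF jm])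
      have Pe: "P e = 0" "P f = 0" using zP[OF jm] by (simp_all add: f_def PU e_def Pd Ul)
      have P0: "cinner y b = 0" if "P y = 0" "b \<in> block_vecs L" for y b
        using cinner_fourier_sum[OF V(1,2) that(2), of y] that(1) by (simp add: P_def)
      have orth: "cinner e b = 0 \<and> cinner f b = 0" if b: "b \<in> block_vecs (L @ L')" for b
      proof (cases "b \<in> block_vecs L")
        case True
        then show ?thesis using P0 Pe by blast
      next
        case False
        then have "b \<in> block_vecs L'" using b by simp
        from L'(3)[OF this] obtain k y where k: "k < j" "b = E k y" by blast
        then show ?thesis using E0[OF jm, of k] jm by (simp add: eE fE)
      qed
      have Te: "norm (T e - d *\<^sub>R e) \<le> \<delta>"
        using E(2)[OF jm, of "(1 / norm (z j)) *\<^sub>R x'"] e(2) by (simp add: eE[symmetric] d_def)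
      have TeX: "T e \<in> X"
        by (rule inX) (simp add: UT UU_X[OF e(1)] selfadjD(8)[OF T])
      define v where "v = U (T e - d *\<^sub>R e)"
      have vX: "T e - d *\<^sub>R e \<in> X" unfolding scaleR_scaleC
        by (intro complex_vector.subspace_diff complex_vector.subspace_scale csubspace_X TeX e(1))
      have v: "norm v \<le> \<delta>" "norm (U v) \<le> \<delta>"
        using Te norm_U[OF vX] norm_U[of v] U_in_X by (auto simp: v_def)
      have Te_eq: "T e = Q e - P (Q e)" using Pe by (simp add: T_def R_def)
      \<comment> \<open>The left side is U (Q e - T e) = U (P (Q e)), and \<open>P\<close> commutes
        with \<open>U\<close>.\<close>
      have res: "A e - d *\<^sub>R f - v = P (A e)"
        by (simp add: v_def f_def Ul Te_eq UQ) (simp add: PU[symmetric] UQ)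
      \<comment> \<open>The second residual is \<open>U\<close> of the first because U e = f, U f =
        - e and \<open>A\<close> commutes with \<open>U\<close>; it stays in the
        \<open>U\<close>-invariant old span, and \<open>U v\<close> is as long as
        \<open>v\<close>.\<close>
      have "A f + d *\<^sub>R e - U v = U (A e - d *\<^sub>R f - v)"
        by (simp add: Ul f_def AU UU_X[OF e(1)])
      then have res': "A f + d *\<^sub>R e - U v \<in> cspan (block_vecs (L @ L'))"
        unfolding res using cspan_mono_in[OF Usp[OF Psp]] by simp
      have "d \<le> C" using m\<delta> jm \<delta> mult_right_mono[of "real j" "real (Suc m)" \<delta>] by (simp add: d_def)
      then have "\<bar>d\<bar> \<le> C" using \<delta> by (simp add: d_def)
      moreover have "A e - d *\<^sub>R f - v \<in> cspan (block_vecs (L @ L'))"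
        unfolding res using cspan_mono_in[OF Psp] by simp
      moreover have "cinner e f = 0" using cinner_U_self[of e] cinner_eq_0_commute[of e f] by (simp add: f_def)
      ultimately have "new_block (L @ L') e f d \<delta>"
        unfolding new_block_def using e f orth res' v by (auto simp: f_def[symmetric])
      then have g: "good (L @ L' @ [(e, f, d, \<delta>)])"
        using L'(1) good_snoc[of "L @ L'"] by simp
      have "z k \<in> cspan (block_vecs (L @ L' @ [(e, f, d, \<delta>)]))" if "k < Suc j" for k
      proof (cases "k = j")
        case True
        have "e \<in> block_vecs (L @ L' @ [(e, f, d, \<delta>)])" by simp
        then have "complex_of_real (norm (z j)) *\<^sub>C e \<in> cspan (block_vecs (L @ L' @ [(e, f, d, \<delta>)]))"
          by (intro complex_vector.span_scale complex_vector.span_base)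
        then show ?thesis unfolding True scaleR_scaleC[symmetric] ze[symmetric] .
      next
        case False
        with that have "k < j" by simp
        then show ?thesis by (intro cspan_mono_in[OF L'(2)]) auto
      qed
      moreover have "\<exists>k<Suc j. \<exists>y. b = E k y" if "b \<in> block_vecs (L' @ [(e, f, d, \<delta>)])" for b
      proof -
        from that consider "b \<in> block_vecs L'" | "b = e" | "b = f" by auto
        then show ?thesis
        proof cases
          case 1
          from L'(3)[OF this] show ?thesis using less_SucI by blast
        next
          case 2
          show ?thesis by (intro exI[of _ j] conjI lessI exI) (rule trans[OF 2 eE])
        next
          case 3
          show ?thesis by (intro exI[of _ j] conjI lessI exI) (rule trans[OF 3 fE])
        qed
      qed
      moreover have "block_cost q (L' @ [(e, f, d, \<delta>)]) \<le> real (Suc j) * \<delta> powr q"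
        using L'(4) by (simp add: algebra_simps)
      ultimately show ?thesis using g by (intro exI[of _ "L' @ [(e, f, d, \<delta>)]"]) blast
    qed
  qed
  from this[OF order_refl] obtain L' where L': "good (L @ L')"
    "\<And>k. k \<le> m \<Longrightarrow> z k \<in> cspan (block_vecs (L @ L'))" "block_cost q L' \<le> real (Suc m) * \<delta> powr q"
    using le_imp_less_Suc by metis
  have "x = P x + (\<Sum>k\<le>m. z k)" using E(4)[of x'] by (simp add: z_def) (simp add: x'_def R_def)
  moreover have "P x + (\<Sum>k\<le>m. z k) \<in> cspan (block_vecs (L @ L'))"
    using cspan_mono_in[OF Psp] L'(2) by (intro complex_vector.span_add complex_vector.span_sum) auto
  ultimately have "x \<in> cspan (block_vecs (L @ L'))" by simp
  then show thesis using that[OF L'(1)] L'(3) cost by simp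
qed

lemma step:
  assumes L: "good L" and q: "1 < q" and \<eta>: "\<eta> > 0"
  obtains L' where "good (L @ L')" "x \<in> cspan (block_vecs (L @ L'))" "block_cost q L' \<le> \<eta>"
proof -
  have "closed (null_space A)"
    using continuous_closed_preimage_constant[OF linear_continuous_on[OF Aa(3)], of UNIV 0]
    by (simp add: null_space_def)
  then obtain P where P: "\<And>x. P x \<in> null_space A" "\<And>x v. v \<in> null_space A \<Longrightarrow> inner (x - P x) v = 0"
    using ex_orth_proj[OF csubspace_real_subspace[OF csubspace_null_space[OF Aa(2)]]] by metis
  have N: "A (P x) = 0" using P(1) by (simp add: null_space_def)
  have X: "x - P x \<in> X" using P(2) by (simp add: X_def null_space_def)
  obtain L1 where L1: "good (L @ L1)" "P x \<in> cspan (block_vecs (L @ L1))" "block_cost q L1 = 0"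
    using kernel_step[OF L N] by metis
  obtain L2 where L2: "good ((L @ L1) @ L2)" "x - P x \<in> cspan (block_vecs ((L @ L1) @ L2))" "block_cost q L2 \<le> \<eta>"
    using range_step[OF L1(1) X q \<eta>] by metis
  have "P x + (x - P x) \<in> cspan (block_vecs (L @ L1 @ L2))"
    using L2(2) cspan_mono_in[OF L1(2)] by (intro complex_vector.span_add) auto
  with that[of "L1 @ L2"] L2 L1 show thesis by simp
qed

end

section \<open>Exhausting a dense sequence by blocks\<close>

context polar_decomposition
begin

text \<open>The n-th vector of a dense sequence is absorbed into the span at cost \<eta> / 2^(n+1),
  so the total after n steps stays below \<eta> (1 - 2^(-n)). The finite lists extend one another
  and define the infinite sequence of blocks.\<close>

lemma ex_block_sequence:
  assumes inf: "\<not> finite_cdim (UNIV :: 'a set)" and sep: "separable_space (euclidean :: 'a topology)"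
    and q: "1 < q" and \<eta>: "\<eta> > 0"
  obtains e f d r where
    "\<And>n. new_block (map (\<lambda>i. (e i, f i, d i, r i)) [0..<n]) (e n) (f n) (d n) (r n)"
    "closure (cspan (range e \<union> range f)) = UNIV" "\<And>n. (\<Sum>i<n. r i powr q) \<le> \<eta>"
proof -
  obtain D0 :: "'a set" where D0: "countable D0" "closure D0 = UNIV"
    using sep by (auto simp: separable_space_def)
  have "D0 \<noteq> {}" using D0(2) by auto
  define x where "x = from_nat_into D0"
  have x: "closure (range x) = UNIV" using range_from_nat_into[OF \<open>D0 \<noteq> {}\<close> D0(1)] D0(2) by (simp add: x_def)
  have "\<exists>F. \<forall>n. (good (F n) \<and> block_cost q (F n) \<le> \<eta> * (1 - (1/2)^n)) \<and>
      ((\<exists>M. F (Suc n) = F n @ M) \<and> x n \<in> cspan (block_vecs (F (Suc n))))"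
  proof (rule dependent_nat_choice[where P="\<lambda>n L. good L \<and> block_cost q L \<le> \<eta> * (1 - (1/2)^n)"
        and Q="\<lambda>n L L'. (\<exists>M. L' = L @ M) \<and> x n \<in> cspan (block_vecs L')"])
    show "\<exists>L. good L \<and> block_cost q L \<le> \<eta> * (1 - (1/2)^0)" by (rule exI[of _ "[]"]) (simp add: good_Nil)
    fix L n assume L: "good L \<and> block_cost q L \<le> \<eta> * (1 - (1/2)^n)"
    have "\<eta> * (1/2)^Suc n > 0" using \<eta> by simp
    then obtain M where M: "good (L @ M)" "x n \<in> cspan (block_vecs (L @ M))" "block_cost q M \<le> \<eta> * (1/2)^Suc n"
      using step[of L q _ "x n"] L q by metis
    have "block_cost q (L @ M) \<le> \<eta> * (1 - (1/2)^n) + \<eta> * (1/2)^Suc n"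
      using L M(3) by simp
    also have "\<dots> = \<eta> * (1 - (1/2)^Suc n)" by (simp add: algebra_simps)
    finally show "\<exists>L'. (good L' \<and> block_cost q L' \<le> \<eta> * (1 - (1/2)^Suc n)) \<and>
        ((\<exists>M. L' = L @ M) \<and> x n \<in> cspan (block_vecs L'))"
      using M by blast
  qed
  then obtain F where F: "\<And>n. good (F n)" "\<And>n. block_cost q (F n) \<le> \<eta> * (1 - (1/2)^n)"
    "\<And>n. \<exists>M. F (Suc n) = F n @ M" "\<And>n. x n \<in> cspan (block_vecs (F (Suc n)))" by blast
  have pre: "\<exists>M. F n = F m @ M" if "m \<le> n" for m n
    using that
  proof (induction rule: dec_induct)
    case (step n)
    with F(3)[of n] show ?case by auto
  qed simp
  \<comment> \<open>If the lists stopped growing, one finite-dimensional span, which is closed,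
    would contain a dense sequence and hence the whole space.\<close>
  have unb: "\<exists>n. k < length (F n)" for k
  proof (rule ccontr)
    assume "\<not> ?thesis"
    then have "\<forall>n. True \<longrightarrow> length (F n) < Suc k" by (simp add: not_less less_Suc_eq_le)
    from ex_has_greatest_nat[of "\<lambda>_. True" 0 "\<lambda>n. length (F n)", OF TrueI this]
    obtain n0 where n0: "\<And>n. length (F n) \<le> length (F n0)" by blast
    have const: "F n = F n0" if n: "n0 \<le> n" for n
    proof -
      obtain M where M: "F n = F n0 @ M" using pre[OF n] by blast
      with n0[of n] show ?thesis by simp
    qed
    note V = good_vecs[OF F(1)[of n0]]
    have "x i \<in> cspan (block_vecs (F n0))" for i
    proof -
      obtain M where "F (max (Suc i) n0) = F (Suc i) @ M" using pre[of "Suc i" "max (Suc i) n0"] by auto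
      then have "F n0 = F (Suc i) @ M" using const[of "max (Suc i) n0"] by simp
      with cspan_mono_in[OF F(4)[of i]] show ?thesis by simp
    qed
    then have "closure (range x) \<subseteq> cspan (block_vecs (F n0))"
      using closed_cspan_finite_orthonormal[OF V(1,2)] by (intro closure_minimal) auto
    with x V(1) have "finite_cdim (UNIV :: 'a set)" unfolding finite_cdim_def by auto
    with inf show False by simp
  qed
  then obtain N where N: "\<And>k. k < length (F (N k))" by metis
  \<comment> \<open>The choice of list is immaterial: the \<open>k\<close>-th block is the same in
    every list long enough to have one.\<close>
  define s where "s k = F (N k) ! k" for k
  have s: "F n ! k = s k" if k: "k < length (F n)" for n k
  proof (cases "n \<le> N k")
    case True
    then obtain M where "F (N k) = F n @ M" using pre by blast
    then show ?thesis using k by (simp add: s_def nth_append)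
  next
    case False
    then obtain M where "F n = F (N k) @ M" using pre[of "N k" n] by auto
    then show ?thesis using N[of k] by (simp add: s_def nth_append)
  qed
  define e where "e k = fst (s k)" for k
  define f where "f k = fst (snd (s k))" for k
  define d where "d k = fst (snd (snd (s k)))" for k
  define r where "r k = snd (snd (snd (s k)))" for k
  have sk: "s k = (e k, f k, d k, r k)" for k by (simp add: e_def f_def d_def r_def)
  have take: "take n (F m) = map (\<lambda>i. (e i, f i, d i, r i)) [0..<n]" if "n \<le> length (F m)" for n m
    by (rule nth_equalityI) (use that s sk in auto)
  show thesis
  proof (rule that)
    fix n
    have "case F (N n) ! n of (e, f, d, r) \<Rightarrow> new_block (take n (F (N n))) e f d r"
      by (rule F(1)[of "N n", unfolded good_def, rule_format, OF N])
    then show "new_block (map (\<lambda>i. (e i, f i, d i, r i)) [0..<n]) (e n) (f n) (d n) (r n)"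
      using take[of n "N n"] N[of n] s[OF N[of n]] sk[of n] by simp
    have "block_cost q (F (N n)) = block_cost q (take n (F (N n))) + block_cost q (drop n (F (N n)))"
      by (metis append_take_drop_id block_cost_simps(2))
    moreover have "0 \<le> block_cost q L" for L :: "('a \<times> 'a \<times> real \<times> real) list"
      unfolding block_cost_def by (rule sum_list_nonneg) auto
    moreover have "block_cost q (take n (F (N n))) = (\<Sum>i<n. r i powr q)"
      using take[of n "N n"] N[of n]
      by (simp add: block_cost_def sum_list_distinct_conv_sum_set atLeast0LessThan comp_def)
    moreover have "\<eta> * (1 - (1/2)^(N n)) \<le> \<eta>" using \<eta> by (simp add: mult_le_cancel_left1)
    ultimately show "(\<Sum>i<n. r i powr q) \<le> \<eta>" using F(2)[of "N n"] by (smt (verit))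
  next
    have "x i \<in> cspan (range e \<union> range f)" for i
    proof (rule cspan_mono_in[OF F(4)])
      obtain k where "F (Suc i) = map (\<lambda>i. (e i, f i, d i, r i)) [0..<k]"
        using take[of "length (F (Suc i))" "Suc i"] by auto
      then show "block_vecs (F (Suc i)) \<subseteq> range e \<union> range f" by (auto simp: block_vecs_def)
    qed
    then have "closure (range x) \<subseteq> closure (cspan (range e \<union> range f))" by (intro closure_mono) auto
    with x show "closure (cspan (range e \<union> range f)) = UNIV" by auto
  qed
qed

end

section \<open>A Schatten-type inequality for triangular matrices\<close>

text \<open>Jensen's inequality for t^q, with the missing mass placed at 0. Young's inequality
  z^(q-1) y \<le> (1 - 1/q) z^q + y^q / q is averaged over the weights, and the term in z^q is
  absorbed on the left.\<close>

lemma powr_sum_le_weighted: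
  fixes w y :: "'i \<Rightarrow> real"
  assumes w: "\<And>m. m \<in> M \<Longrightarrow> 0 \<le> w m" "(\<Sum>m\<in>M. w m) \<le> 1" and y: "\<And>m. m \<in> M \<Longrightarrow> 0 \<le> y m" and q: "1 < q"
  shows "(\<Sum>m\<in>M. w m * y m) powr q \<le> (\<Sum>m\<in>M. w m * y m powr q)"
proof -
  define z where "z = (\<Sum>m\<in>M. w m * y m)"
  have "z \<ge> 0" unfolding z_def using w y by (intro sum_nonneg) auto
  show ?thesis
  proof (cases "z = 0")
    case True
    then show ?thesis unfolding z_def[symmetric] using w by (auto intro!: sum_nonneg)
  next
    case False
    with \<open>z \<ge> 0\<close> have z: "z > 0" by simp
    have young: "z powr (q - 1) * t \<le> (1 - 1/q) * z powr q + t powr q / q" if "t \<ge> 0" for t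
    proof -
      have "1 < q / (q - 1)" "1 / (q / (q - 1)) + 1 / q = 1" using q by (auto simp: field_simps)
      from Youngs_inequality[OF this(1) q this(2), of "z powr (q - 1)" t] that z q
      have "z powr (q - 1) * t \<le> z powr q / (q / (q - 1)) + t powr q / q" by (simp add: powr_powr)
      also have "z powr q / (q / (q - 1)) = (1 - 1/q) * z powr q" using q by (simp add: field_simps)
      finally show ?thesis .
    qed
    have "z powr q = z powr (q - 1) * z" using z by (simp add: powr_diff)
    also have "\<dots> = (\<Sum>m\<in>M. w m * (z powr (q - 1) * y m))"
    proof -
      have "c * (\<Sum>m\<in>M. w m * y m) = (\<Sum>m\<in>M. w m * (c * y m))" for c
        by (simp add: sum_distrib_left mult_ac)
      then show ?thesis by (simp only: z_def)
    qed
    also have "\<dots> \<le> (\<Sum>m\<in>M. w m * ((1 - 1/q) * z powr q + y m powr q / q))"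
      using w y young by (intro sum_mono mult_left_mono) auto
    also have "\<dots> = (\<Sum>m\<in>M. w m) * ((1 - 1/q) * z powr q) + (\<Sum>m\<in>M. w m * y m powr q) / q"
      by (simp add: distrib_left sum.distrib sum_distrib_right sum_divide_distrib)
    also have "\<dots> \<le> 1 * ((1 - 1/q) * z powr q) + (\<Sum>m\<in>M. w m * y m powr q) / q"
      using w(2) q z by (intro add_right_mono mult_right_mono) auto
    finally have "z powr q / q \<le> (\<Sum>m\<in>M. w m * y m powr q) / q" by (simp add: algebra_simps)
    then show ?thesis using q by (simp add: z_def divide_le_cancel)
  qed
qed

text \<open>Jensen with weights a^2 and values c / a leaves a^(2-q) c^q = \<rho>^q (a^2)^(1-q/2)
  ((c/\<rho>)^2)^(q/2). Weighted AM-GM then yields only squares, the form in which Bessel's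
  inequality can be used.\<close>

lemma powr_sum_mult_le:
  fixes a c \<rho> :: "'i \<Rightarrow> real"
  assumes a: "\<And>m. m \<in> M \<Longrightarrow> 0 \<le> a m" "(\<Sum>m\<in>M. (a m)\<^sup>2) \<le> 1" and c: "\<And>m. m \<in> M \<Longrightarrow> 0 \<le> c m"
    and \<rho>: "\<And>m. m \<in> M \<Longrightarrow> 0 \<le> \<rho> m" "\<And>m. m \<in> M \<Longrightarrow> \<rho> m = 0 \<Longrightarrow> c m = 0"
    and q: "1 < q" "q \<le> 2"
  shows "(\<Sum>m\<in>M. a m * c m) powr q \<le> (\<Sum>m\<in>M. \<rho> m powr q * ((1 - q/2) * (a m)\<^sup>2 + (q/2) * (c m / \<rho> m)\<^sup>2))"
proof -
  \<comment> \<open>Where \<open>a m = 0\<close> the quotient has value 0, and both summands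
    vanish.\<close>
  have "(\<Sum>m\<in>M. a m * c m) = (\<Sum>m\<in>M. (a m)\<^sup>2 * (c m / a m))"
    by (intro sum.cong) (auto simp: power2_eq_square)
  then have "(\<Sum>m\<in>M. a m * c m) powr q \<le> (\<Sum>m\<in>M. (a m)\<^sup>2 * (c m / a m) powr q)"
    using powr_sum_le_weighted[of M "\<lambda>m. (a m)\<^sup>2" "\<lambda>m. c m / a m" q] a c q by simp
  also have "\<dots> \<le> (\<Sum>m\<in>M. \<rho> m powr q * ((1 - q/2) * (a m)\<^sup>2 + (q/2) * (c m / \<rho> m)\<^sup>2))"
  proof (rule sum_mono)
    fix m assume m: "m \<in> M"
    show "(a m)\<^sup>2 * (c m / a m) powr q \<le> \<rho> m powr q * ((1 - q/2) * (a m)\<^sup>2 + (q/2) * (c m / \<rho> m)\<^sup>2)"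
    proof (cases "a m = 0 \<or> c m = 0")
      case True
      then have "(a m)\<^sup>2 * (c m / a m) powr q = 0" by auto
      moreover have "0 \<le> \<rho> m powr q * ((1 - q/2) * (a m)\<^sup>2 + (q/2) * (c m / \<rho> m)\<^sup>2)"
        using q by (intro mult_nonneg_nonneg add_nonneg_nonneg) auto
      ultimately show ?thesis by linarith
    next
      case False
      then have pos: "a m > 0" "c m > 0" "\<rho> m > 0" using a(1)[OF m] c[OF m] \<rho>[OF m] by (auto simp: less_le)
      have "(a m)\<^sup>2 * (c m / a m) powr q = \<rho> m powr q * (((a m)\<^sup>2) powr (1 - q/2) * ((c m / \<rho> m)\<^sup>2) powr (q/2))"
        using pos by (simp add: powr_divide powr_powr powr_diff powr_numeral[symmetric] del: powr_numeral)
      also have "\<dots> \<le> \<rho> m powr q * ((1 - q/2) * (a m)\<^sup>2 + (q/2) * (c m / \<rho> m)\<^sup>2)"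
        using q pos by (intro mult_left_mono Youngs_inequality_0) auto
      finally show ?thesis .
    qed
  qed
  finally show ?thesis .
qed

lemma powr_add_le:
  fixes s t :: real
  assumes "0 \<le> s" "0 \<le> t" "1 < q"
  shows "(s + t) powr q \<le> 2 powr (q - 1) * (s powr q + t powr q)"
proof -
  have "(\<Sum>m\<in>{True,False}. (1/2) * (if m then s else t)) powr q \<le> (\<Sum>m\<in>{True,False}. (1/2) * (if m then s else t) powr q)"
    using assms by (intro powr_sum_le_weighted) auto
  then have "((s + t) / 2) powr q \<le> (s powr q + t powr q) / 2" by (simp add: add_divide_distrib)
  then show ?thesis using assms by (simp add: powr_divide powr_diff field_simps)
qed

section \<open>Orthonormal families and triangular forms\<close>

definition orthonormal_family :: "'i set \<Rightarrow> ('i \<Rightarrow> 'a::complex_inner) \<Rightarrow> bool" where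
  "orthonormal_family I u \<longleftrightarrow> (\<forall>i\<in>I. \<forall>j\<in>I. cinner (u i) (u j) = (if i = j then 1 else 0))"

lemma orthonormal_family_set:
  assumes "orthonormal_family I u"
  shows "inj_on u I" "orthonormal_set (u ` I)"
proof -
  show inj: "inj_on u I"
  proof (rule inj_onI)
    fix i j assume "i \<in> I" "j \<in> I" "u i = u j"
    then show "i = j" using assms unfolding orthonormal_family_def by (metis zero_neq_one)
  qed
  show "orthonormal_set (u ` I)"
    using assms inj unfolding orthonormal_family_def orthonormal_set_def by (auto simp: inj_on_eq_iff)
qed

lemma orthonormal_family_norm:
  assumes "orthonormal_family I u" "i \<in> I"
  shows "norm (u i) = 1"
proof -
  have "complex_of_real ((norm (u i))\<^sup>2) = complex_of_real 1"
    using assms cinner_self[of "u i"] by (simp add: orthonormal_family_def)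
  then have "(norm (u i))\<^sup>2 = 1" by (simp only: of_real_eq_iff)
  then show ?thesis using norm_ge_zero[of "u i"] by (auto simp: power2_eq_1_iff simp del: norm_ge_zero)
qed

lemma bessel_family:
  assumes "finite I" "orthonormal_family I u"
  shows "(\<Sum>i\<in>I. (cmod (cinner x (u i)))\<^sup>2) \<le> (norm x)\<^sup>2"
  using bessel_finite[of "u ` I" x] assms orthonormal_family_set[OF assms(2)]
  by (simp add: sum.reindex)

lemma bessel_family':
  assumes "finite I" "orthonormal_family I u"
  shows "(\<Sum>i\<in>I. (cmod (cinner (u i) x))\<^sup>2) \<le> (norm x)\<^sup>2"
  using bessel_family[OF assms, of x] by (metis (no_types, lifting) cnj_cinner complex_mod_cnj sum.cong)

definition partial_fourier :: "(nat \<Rightarrow> 'a::complex_inner) \<Rightarrow> nat \<Rightarrow> 'a \<Rightarrow> 'a" where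
  "partial_fourier b N x = (\<Sum>i<N. cinner x (b i) *\<^sub>C b i)"

text \<open>
  The weight \<open>a\<^sup>2\<^sup>-\<^sup>q c\<^sup>q\<close> is split by weighted AM-GM, after which Bessel's inequality applies in both
  families \<open>u\<close> and \<open>g\<close>; this is where \<open>q \<le> 2\<close> is needed.
\<close>

lemma sum_powr_bilinear_le:
  fixes b :: "nat \<Rightarrow> 'a::complex_inner"
  assumes b: "orthonormal_family UNIV b" and I: "finite I" "orthonormal_family I u" "orthonormal_family I g"
    and R: "\<And>m. norm (R m) \<le> \<rho> m" and q: "1 < q" "q \<le> 2"
  shows "(\<Sum>i\<in>I. (cmod (\<Sum>m<N. cnj (cinner (u i) (b m)) * cinner (R m) (g i))) powr q) \<le> (\<Sum>m<N. \<rho> m powr q)"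
proof -
  have \<rho>: "0 \<le> \<rho> m" for m using R[of m] norm_ge_zero order_trans by blast
  have bN: "orthonormal_family {..<N} b" using b by (simp add: orthonormal_family_def)
  let ?a = "\<lambda>i m. cmod (cinner (u i) (b m))" and ?c = "\<lambda>i m. cmod (cinner (R m) (g i))"
  have "(\<Sum>i\<in>I. (cmod (\<Sum>m<N. cnj (cinner (u i) (b m)) * cinner (R m) (g i))) powr q)
      \<le> (\<Sum>i\<in>I. (\<Sum>m<N. ?a i m * ?c i m) powr q)"
    using q by (intro sum_mono powr_mono2 norm_sum[THEN order_trans] sum_mono) (auto simp: norm_mult)
  also have "\<dots> \<le> (\<Sum>i\<in>I. \<Sum>m<N. \<rho> m powr q * ((1 - q/2) * (?a i m)\<^sup>2 + (q/2) * (?c i m / \<rho> m)\<^sup>2))"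
  proof (intro sum_mono powr_sum_mult_le)
    fix i assume i: "i \<in> I"
    show "(\<Sum>m<N. (?a i m)\<^sup>2) \<le> 1"
      using bessel_family[OF finite_lessThan bN, of "u i"] orthonormal_family_norm[OF I(2) i] by simp
    show "?c i m = 0" if "\<rho> m = 0" for m using R[of m] that by simp
  qed (use \<rho> q in auto)
  also have "\<dots> = (\<Sum>m<N. \<rho> m powr q * ((1 - q/2) * (\<Sum>i\<in>I. (?a i m)\<^sup>2) + (q/2) * (\<Sum>i\<in>I. (?c i m / \<rho> m)\<^sup>2)))"
    by (subst sum.swap) (simp add: sum_distrib_left sum.distrib distrib_left)
  also have "\<dots> \<le> (\<Sum>m<N. \<rho> m powr q * ((1 - q/2) * 1 + (q/2) * 1))"
  proof (intro sum_mono mult_left_mono add_mono)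
    fix m
    show "(\<Sum>i\<in>I. (?a i m)\<^sup>2) \<le> 1"
      using bessel_family'[OF I(1,2), of "b m"] orthonormal_family_norm[OF b] by simp
    show "(\<Sum>i\<in>I. (?c i m / \<rho> m)\<^sup>2) \<le> 1"
    proof (cases "\<rho> m = 0")
      case False
      have "(\<Sum>i\<in>I. (?c i m)\<^sup>2) \<le> (\<rho> m)\<^sup>2"
        using bessel_family[OF I(1,3), of "R m"] R[of m] power_mono[OF R[of m], of 2] by simp
      then show ?thesis using False by (simp add: power_divide sum_divide_distrib[symmetric])
    qed simp
  qed (use q in auto)
  finally show ?thesis by simp
qed

text \<open>\<Phi> is the strictly upper triangular part of the truncated form. The diagonal
  vanishes and the lower triangle is minus the transpose, so the truncated form is \<Phi>(x, y) -
  \<Phi>(y, x). The row vectors \<open>R m\<close> are projections of \<open>v m\<close>, hence no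
  longer than \<rho>, and \<open>sum_powr_bilinear_le\<close> bounds both terms.\<close>

lemma sum_powr_truncated_le:
  fixes b :: "nat \<Rightarrow> 'a::complex_inner"
  assumes b: "orthonormal_family UNIV b" and I: "finite I" "orthonormal_family I u" "orthonormal_family I g"
    and K: "antilinear K" "\<And>x y. cinner (K x) y = - cinner (K y) x"
    and v: "\<And>m l. m < l \<Longrightarrow> cinner (K (b m)) (b l) = cinner (v m) (b l)" "\<And>m. norm (v m) \<le> \<rho> m"
    and q: "1 < q" "q \<le> 2"
  shows "(\<Sum>i\<in>I. (cmod (cinner (K (partial_fourier b N (u i))) (partial_fourier b N (g i)))) powr q)
    \<le> 2 powr q * (\<Sum>m<N. \<rho> m powr q)"
proof -
  define R where "R m = (\<Sum>l\<in>{m<..<N}. cinner (v m) (b l) *\<^sub>C b l)" for m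
  have R: "norm (R m) \<le> \<rho> m" for m
  proof -
    have fam: "orthonormal_family {m<..<N} b" using b by (simp add: orthonormal_family_def)
    note os = orthonormal_family_set[OF fam]
    have "R m = fourier_sum (b ` {m<..<N}) (v m)" unfolding R_def fourier_sum_def by (simp add: sum.reindex[OF os(1)])
    then have "norm (R m) \<le> norm (v m)"
      using orth_proj_norm_le[OF orth_proj_fourier_sum[OF _ os(2)]] by simp
    with v(2)[of m] show ?thesis by simp
  qed
  define \<Phi> where "\<Phi> x y = (\<Sum>m<N. cnj (cinner x (b m)) * cinner (R m) y)" for x y
  have \<Phi>: "\<Phi> x y = (\<Sum>m<N. \<Sum>l\<in>{m<..<N}. cnj (cinner x (b m)) * cnj (cinner y (b l)) * cinner (K (b m)) (b l))" for x y
    unfolding \<Phi>_def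
  proof (rule sum.cong[OF refl])
    fix m
    have "cinner (R m) y = (\<Sum>l\<in>{m<..<N}. cinner (K (b m)) (b l) * cnj (cinner y (b l)))"
      unfolding R_def cinner_sum_left by (intro sum.cong) (auto simp: cinner_scaleC_left v(1) cnj_cinner)
    then show "cnj (cinner x (b m)) * cinner (R m) y =
        (\<Sum>l\<in>{m<..<N}. cnj (cinner x (b m)) * cnj (cinner y (b l)) * cinner (K (b m)) (b l))"
      by (simp add: sum_distrib_left algebra_simps)
  qed
  have diag: "cinner (K x) x = 0" for x using K(2)[of x x] by simp
  have main: "cinner (K (partial_fourier b N x)) (partial_fourier b N y) = \<Phi> x y - \<Phi> y x" for x y
  proof -
    define t where "t m l = cnj (cinner x (b m)) * cnj (cinner y (b l)) * cinner (K (b m)) (b l)" for m l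
    have "cinner (K (partial_fourier b N x)) (partial_fourier b N y) = (\<Sum>m<N. \<Sum>l<N. t m l)"
      unfolding partial_fourier_def antilinearD(7)[OF K(1)] cinner_sum_left cinner_sum_right t_def
      by (subst sum.swap, intro sum.cong refl)
        (simp add: antilinearD(2)[OF K(1)] cinner_scaleC_left cinner_scaleC_right)
    also have "\<dots> = (\<Sum>m<N. (\<Sum>l\<in>{m<..<N}. t m l) + (\<Sum>l<m. t m l))"
    proof (rule sum.cong[OF refl])
      fix m assume "m \<in> {..<N}"
      then have split: "{..<N} = {..<m} \<union> insert m {m<..<N}" by auto
      have "(\<Sum>l<N. t m l) = (\<Sum>l<m. t m l) + (t m m + (\<Sum>l\<in>{m<..<N}. t m l))"
        unfolding split by (subst sum.union_disjoint) auto
      then show "(\<Sum>l<N. t m l) = (\<Sum>l\<in>{m<..<N}. t m l) + (\<Sum>l<m. t m l)" by (simp add: t_def diag)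
    qed
    also have "\<dots> = \<Phi> x y + (\<Sum>m<N. \<Sum>l<m. t m l)" by (simp add: sum.distrib \<Phi> t_def)
    \<comment> \<open>Summing the lower triangle by columns makes it an upper triangle with the
      arguments exchanged; antisymmetry of \<open>K\<close> then supplies the sign.\<close>
    also have "(\<Sum>m<N. \<Sum>l<m. t m l) = (\<Sum>l<N. \<Sum>m\<in>{l<..<N}. t m l)"
    proof -
      have "(\<Sum>m<N. \<Sum>l<m. t m l) = (\<Sum>m<N. \<Sum>l<N. if l < m then t m l else 0)"
        by (intro sum.cong[OF refl] sum.mono_neutral_cong_left) auto
      also have "\<dots> = (\<Sum>l<N. \<Sum>m<N. if l < m then t m l else 0)" by (rule sum.swap)
      also have "\<dots> = (\<Sum>l<N. \<Sum>m\<in>{l<..<N}. t m l)"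
        by (intro sum.cong[OF refl] sum.mono_neutral_cong_right) auto
      finally show ?thesis .
    qed
    also have "\<dots> = - \<Phi> y x"
      unfolding \<Phi> sum_negf[symmetric] t_def
      by (intro sum.cong refl, subst K(2)) (simp add: mult_ac)
    finally show ?thesis by simp
  qed
  have "(\<Sum>i\<in>I. (cmod (cinner (K (partial_fourier b N (u i))) (partial_fourier b N (g i)))) powr q)
      \<le> (\<Sum>i\<in>I. 2 powr (q - 1) * ((cmod (\<Phi> (u i) (g i))) powr q + (cmod (\<Phi> (g i) (u i))) powr q))"
  proof (rule sum_mono)
    fix i
    have "(cmod (\<Phi> (u i) (g i) - \<Phi> (g i) (u i))) powr q \<le> (cmod (\<Phi> (u i) (g i)) + cmod (\<Phi> (g i) (u i))) powr q"
      using q by (intro powr_mono2 norm_triangle_ineq4) auto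
    also have "\<dots> \<le> 2 powr (q - 1) * ((cmod (\<Phi> (u i) (g i))) powr q + (cmod (\<Phi> (g i) (u i))) powr q)"
      using q by (intro powr_add_le) auto
    finally show "(cmod (cinner (K (partial_fourier b N (u i))) (partial_fourier b N (g i)))) powr q
      \<le> 2 powr (q - 1) * ((cmod (\<Phi> (u i) (g i))) powr q + (cmod (\<Phi> (g i) (u i))) powr q)"
      by (simp add: main)
  qed
  also have "\<dots> = 2 powr (q - 1) * ((\<Sum>i\<in>I. (cmod (\<Phi> (u i) (g i))) powr q) + (\<Sum>i\<in>I. (cmod (\<Phi> (g i) (u i))) powr q))"
    by (simp add: sum.distrib sum_distrib_left distrib_left)
  also have "\<dots> \<le> 2 powr (q - 1) * ((\<Sum>m<N. \<rho> m powr q) + (\<Sum>m<N. \<rho> m powr q))"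
    unfolding \<Phi>_def
    by (intro mult_left_mono add_mono sum_powr_bilinear_le[OF b I(1) _ _ R q] I) auto
  also have "\<dots> = 2 powr q * (\<Sum>m<N. \<rho> m powr q)" by (simp add: powr_diff)
  finally show ?thesis .
qed

section \<open>From truncations to the whole operator; compactness\<close>

lemma cspan_range_nat:
  fixes b :: "nat \<Rightarrow> 'a::complex_vector"
  assumes "x \<in> cspan (range b)"
  shows "\<exists>M. x \<in> cspan (b ` {..<M})"
  using assms
proof (induction rule: complex_vector.span_induct_alt)
  case base
  show ?case by (rule exI[of _ 0]) (simp add: complex_vector.span_zero)
next
  case (step c x y)
  then obtain k M where k: "x = b k" and M: "y \<in> cspan (b ` {..<M})" by blast
  have "b k \<in> cspan (b ` {..<max M (Suc k)})" by (auto intro: complex_vector.span_base)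
  moreover have "y \<in> cspan (b ` {..<max M (Suc k)})" by (rule cspan_mono_in[OF M]) auto
  ultimately show ?case unfolding k by (intro exI complex_vector.span_add complex_vector.span_scale)
qed

context
  fixes b :: "nat \<Rightarrow> 'a::complex_inner"
  assumes b: "orthonormal_family UNIV b"
begin

lemma partial_fourier_eq: "partial_fourier b N = fourier_sum (b ` {..<N})"
proof
  fix x
  have "inj_on b {..<N}" using orthonormal_family_set(1)[OF b] by (rule inj_on_subset) simp
  then show "partial_fourier b N x = fourier_sum (b ` {..<N}) x"
    by (simp add: partial_fourier_def fourier_sum_def sum.reindex)
qed

lemma orthonormal_initial: "finite (b ` {..<N})" "orthonormal_set (b ` {..<N})"
  using orthonormal_family_set(2)[of "{..<N}" b] b by (auto simp: orthonormal_family_def)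

lemma orth_proj_partial_fourier: "orth_proj (partial_fourier b N)"
  unfolding partial_fourier_eq by (rule orth_proj_fourier_sum[OF orthonormal_initial])

lemma partial_fourier_tendsto:
  assumes dense: "closure (cspan (range b)) = UNIV"
  shows "(\<lambda>N. partial_fourier b N x) \<longlonglongrightarrow> x"
proof (rule metric_LIMSEQ_I)
  fix \<epsilon> :: real assume "\<epsilon> > 0"
  then obtain y where y: "y \<in> cspan (range b)" "dist y x < \<epsilon>"
    using dense closure_approachable[of x "cspan (range b)"] by auto
  then obtain M where M: "y \<in> cspan (b ` {..<M})" using cspan_range_nat by blast
  have "dist (partial_fourier b N x) x < \<epsilon>" if "N \<ge> M" for N
  proof -
    let ?P = "partial_fourier b N"
    note P = selfadjD[OF orth_projD(1)[OF orth_proj_partial_fourier[of N]]]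
    have "y \<in> cspan (b ` {..<N})" using that by (intro cspan_mono_in[OF M]) auto
    then have "?P y = y" unfolding partial_fourier_eq by (rule fourier_sum_id[OF orthonormal_initial])
    then have eq: "x - ?P x = (x - y) - ?P (x - y)" by (simp add: P)
    have "norm (x - ?P x) \<le> norm (x - y)"
      unfolding eq by (rule orth_proj_norm_le[OF orth_proj_compl[OF orth_proj_partial_fourier[of N]]])
    then show ?thesis using y(2) by (simp add: dist_norm norm_minus_commute)
  qed
  then show "\<exists>no. \<forall>n\<ge>no. dist (partial_fourier b n x) x < \<epsilon>" by blast
qed

end

text \<open>Replaces compactness of balls in finite-dimensional subspaces: each further coefficient
  contributes a compact disc, and the combination depends on it continuously.\<close>

lemma compact_combination_superset:
  fixes v :: "nat \<Rightarrow> 'a::complex_inner"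
  shows "\<exists>S. compact S \<and> (\<forall>c. (\<forall>i<N. cmod (c i) \<le> C) \<longrightarrow> (\<Sum>i<N. c i *\<^sub>C v i) \<in> S)"
proof (induction N)
  case 0
  show ?case by (rule exI[of _ "{0}"]) auto
next
  case (Suc N)
  then obtain S where S: "compact S" "\<And>c. (\<forall>i<N. cmod (c i) \<le> C) \<Longrightarrow> (\<Sum>i<N. c i *\<^sub>C v i) \<in> S" by blast
  let ?g = "\<lambda>z::'a \<times> complex. fst z + snd z *\<^sub>C v N"
  have "bounded_linear (\<lambda>c. c *\<^sub>C v N)"
    by (rule bounded_linear_intro[where K="norm (v N)"])
      (auto simp: scaleC_add_left scaleR_scaleC scaleC_scaleC norm_scaleC scaleR_conv_of_real)
  then have "continuous_on (S \<times> cball 0 C) ?g"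
    by (intro continuous_on_add continuous_on_fst continuous_on_id bounded_linear.continuous_on[of "\<lambda>c. c *\<^sub>C v N"] continuous_on_snd)
  then have "compact (?g ` (S \<times> cball 0 C))" by (rule compact_continuous_image) (intro compact_Times S(1) compact_cball)
  moreover have "(\<Sum>i<Suc N. c i *\<^sub>C v i) \<in> ?g ` (S \<times> cball 0 C)" if "\<forall>i<Suc N. cmod (c i) \<le> C" for c
    using that by (intro image_eqI[of _ _ "(\<Sum>i<N. c i *\<^sub>C v i, c N)"]) (auto intro!: S(2))
  ultimately show ?case by blast
qed

text \<open>The condition on \<open>v\<close> says that \<open>K (b m)\<close> and
  \<open>v m\<close> agree along the later basis vectors. The data \<rho> and \<sigma> are
  parameters because the locale serves twice: for A - D, and with small \<sigma> for tails of
  \<open>K\<close> in the compactness proof.\<close>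

locale triangular_skew =
  fixes b :: "nat \<Rightarrow> 'a::chilbert_space" and K :: "'a \<Rightarrow> 'a" and v :: "nat \<Rightarrow> 'a" and \<rho> :: "nat \<Rightarrow> real" and q \<sigma> :: real
  assumes b: "orthonormal_family UNIV b" and dense: "closure (cspan (range b)) = UNIV"
    and K: "skew_antilinear K"
    and v: "m < l \<Longrightarrow> cinner (K (b m)) (b l) = cinner (v m) (b l)"
    and \<rho>: "norm (v m) \<le> \<rho> m" and q: "1 < q" "q \<le> 2" and \<sigma>: "(\<Sum>m<N. \<rho> m powr q) \<le> \<sigma>"
begin

lemmas Ka = skew_antilinearD[OF K] and Kl = antilinearD[OF skew_antilinearD(2)[OF K]]

text \<open>The bound for truncations does not depend on the truncation, and the projections
  converge strongly to the identity.\<close>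

lemma sum_powr_le:
  assumes I: "finite I" "orthonormal_family I u" "orthonormal_family I g"
  shows "(\<Sum>i\<in>I. (cmod (cinner (K (u i)) (g i))) powr q) \<le> 2 powr q * \<sigma>"
proof (rule LIMSEQ_le_const2)
  let ?P = "partial_fourier b"
  show "\<exists>N. \<forall>n\<ge>N. (\<Sum>i\<in>I. (cmod (cinner (K (?P n (u i))) (?P n (g i)))) powr q) \<le> 2 powr q * \<sigma>"
  proof (intro exI allI impI)
    fix n :: nat
    have "(\<Sum>i\<in>I. (cmod (cinner (K (?P n (u i))) (?P n (g i)))) powr q) \<le> 2 powr q * (\<Sum>m<n. \<rho> m powr q)"
      by (rule sum_powr_truncated_le[OF b I Ka(2,4) v \<rho> q])
    also have "\<dots> \<le> 2 powr q * \<sigma>" by (intro mult_left_mono \<sigma>) auto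
    finally show "(\<Sum>i\<in>I. (cmod (cinner (K (?P n (u i))) (?P n (g i)))) powr q) \<le> 2 powr q * \<sigma>" .
  qed
  have P: "(\<lambda>n. ?P n x) \<longlonglongrightarrow> x" for x by (rule partial_fourier_tendsto[OF b dense])
  have KP: "(\<lambda>n. K (?P n x)) \<longlonglongrightarrow> K x" for x by (rule bounded_linear.tendsto[OF Ka(3) P])
  have "(\<lambda>n. cinner (K (?P n x)) (?P n y)) \<longlonglongrightarrow> cinner (K x) y" for x y
  proof -
    have "(\<lambda>n. cinner (K (?P n x) - K x) (?P n y)) \<longlonglongrightarrow> 0"
    proof (rule Lim_null_comparison)
      show "\<forall>\<^sub>F n in sequentially. norm (cinner (K (?P n x) - K x) (?P n y)) \<le> norm (K (?P n x) - K x) * norm y"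
        by (intro always_eventually allI order_trans[OF cmod_cinner_le] mult_left_mono
            orth_proj_norm_le[OF orth_proj_partial_fourier[OF b]]) auto
      show "(\<lambda>n. norm (K (?P n x) - K x) * norm y) \<longlonglongrightarrow> 0"
        by (rule tendsto_mult_left_zero[OF tendsto_norm_zero[OF LIM_zero[OF KP]]])
    qed
    from tendsto_add[OF this bounded_linear.tendsto[OF bounded_linear_cinner_right P, of "K x" y]]
    show ?thesis by (simp add: cinner_diff_left)
  qed
  then show "(\<lambda>n. \<Sum>i\<in>I. (cmod (cinner (K (?P n (u i))) (?P n (g i)))) powr q)
      \<longlonglongrightarrow> (\<Sum>i\<in>I. (cmod (cinner (K (u i)) (g i))) powr q)"
    using q by (intro tendsto_sum tendsto_powr2 tendsto_norm tendsto_const) auto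
qed

text \<open>The previous estimate for one-element families, the normalised \<open>x\<close> and the
  normalised \<open>K x\<close>.\<close>

lemma norm_powr_le: "(norm (K x)) powr q \<le> 2 powr q * \<sigma> * (norm x) powr q"
proof (cases "x = 0 \<or> K x = 0")
  case True
  have "0 \<le> \<sigma>" using \<sigma>[of 0] by simp
  with True show ?thesis by (auto simp: Kl)
next
  case False
  then have x: "norm x > 0" and k: "norm (K x) > 0" by auto
  let ?u = "(1 / norm x) *\<^sub>R x" and ?g = "(1 / norm (K x)) *\<^sub>R K x"
  have "norm ?u = 1" "norm ?g = 1" using x k by auto
  then have "orthonormal_family {()} (\<lambda>_. ?u)" "orthonormal_family {()} (\<lambda>_. ?g)"
    by (auto simp: orthonormal_family_def cinner_self)
  from sum_powr_le[OF _ this] have "(cmod (cinner (K ?u) ?g)) powr q \<le> 2 powr q * \<sigma>" by simp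
  moreover have "cinner (K ?u) ?g = complex_of_real (norm (K x) / norm x)"
    using k by (simp add: Kl cinner_scaleR_left cinner_scaleR_right cinner_self power2_eq_square)
  ultimately have "(norm (K x) / norm x) powr q \<le> 2 powr q * \<sigma>" using x k by (simp add: norm_divide)
  then show ?thesis using x by (simp add: powr_divide divide_le_eq)
qed

text \<open>For R = 1 - P_N the tail R K R is again triangular, with errors \<rho> from index N on,
  so its norm tends to 0. The rest, K P_N + P_N K R, maps the unit ball into a compact set, whence
  the image of the ball is totally bounded.\<close>

lemma compact_operator: "compact_antilinear K"
proof -
  have \<rho>0: "0 \<le> \<rho> m" for m using \<rho>[of m] norm_ge_zero order_trans by blast
  have "summable (\<lambda>m. \<rho> m powr q)" by (rule summableI_nonneg_bounded[of _ \<sigma>]) (auto simp: \<sigma>)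
  obtain CK where CK: "CK > 0" "\<And>x. norm (K x) \<le> norm x * CK" using bounded_linear.pos_bounded[OF Ka(3)] by blast
  have tail: "\<exists>N. \<forall>x\<in>cball 0 1. norm ((K (x - partial_fourier b N x)) - partial_fourier b N (K (x - partial_fourier b N x))) \<le> e"
    if e: "e > 0" for e
  proof -
    \<comment> \<open>Chosen so that 2^q \<tau> = e^q, the value for which
      \<open>norm_powr_le\<close> bounds the tail by \<open>e\<close>.\<close>
    define \<tau> where "\<tau> = (e / 2) powr q"
    have "\<tau> > 0" using e by (simp add: \<tau>_def)
    with \<open>summable _\<close> obtain N where N: "\<And>M n. M \<ge> N \<Longrightarrow> norm (\<Sum>m\<in>{M..<n}. \<rho> m powr q) < \<tau>"
      unfolding summable_Cauchy by blast
    define R where "R x = x - partial_fourier b N x" for x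
    note Pd = selfadjD[OF orth_projD(1)[OF orth_proj_partial_fourier[OF b, of N]]]
    have R: "orth_proj R" unfolding R_def by (rule orth_proj_compl[OF orth_proj_partial_fourier[OF b]])
    note Rd = selfadjD[OF orth_projD(1)[OF R]]
    have Rc: "R (c *\<^sub>C x) = c *\<^sub>C R x" for c x
      unfolding R_def partial_fourier_eq[OF b] fourier_sum_scaleC[OF orthonormal_initial[OF b]] by (simp add: scaleC_diff_right)
    have Rb: "R (b m) = (if m < N then 0 else b m)" for m
    proof -
      have "partial_fourier b N (b m) = (\<Sum>i<N. if i = m then b m else 0)"
        unfolding partial_fourier_def using b by (intro sum.cong) (auto simp: orthonormal_family_def scaleC_one)
      then show ?thesis by (simp add: R_def)
    qed
    have Rcin: "cinner (R x) y = cinner x (R y)" for x y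
      using Rd(3)[of x y] Rd(3)[of x "\<i> *\<^sub>C y"] by (simp add: complex_eq_iff inner_Re_cinner[symmetric] Im_cinner Rc)
    define K' where "K' x = R (K (R x))" for x
    interpret K': triangular_skew b K' "\<lambda>m. if m < N then 0 else v m" "\<lambda>m. if m < N then 0 else \<rho> m" q \<tau>
    proof
      show "orthonormal_family UNIV b" "closure (cspan (range b)) = UNIV" "1 < q" "q \<le> 2" by (fact b dense q)+
      have "bounded_antilinear K'"
      proof (rule bounded_antilinearI)
        show "bounded_linear K'" unfolding K'_def
          by (intro bounded_linear_compose[OF Rd(1)] bounded_linear_compose[OF Ka(3)] Rd(1))
        show "K' (\<i> *\<^sub>C x) = - (\<i> *\<^sub>C K' x)" for x by (simp add: K'_def Rc Kl scaleC_minus_left Rd)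
      qed
      moreover have "cinner (K' x) y = - cinner (K' y) x" for x y
        using Ka(4)[of "R x" "R y"] by (simp add: K'_def Rcin)
      ultimately show "skew_antilinear K'" unfolding skew_antilinear_def by blast
      show "cinner (K' (b m)) (b l) = cinner (if m < N then 0 else v m) (b l)" if "m < l" for m l
        using that v[OF that] by (simp add: K'_def Rcin Rb Kl Rd(7))
      show "norm (if m < N then 0 else v m) \<le> (if m < N then 0 else \<rho> m)" for m by (simp add: \<rho>)
      show "(\<Sum>m<n. (if m < N then 0 else \<rho> m) powr q) \<le> \<tau>" for n
      proof -
        have "(\<Sum>m<n. (if m < N then 0 else \<rho> m) powr q) = (\<Sum>m\<in>{N..<n}. \<rho> m powr q)"
          by (intro sum.mono_neutral_cong_right) auto
        also have "\<dots> \<le> \<tau>" using N[OF order_refl, of n] by simp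
        finally show ?thesis .
      qed
    qed
    have "norm (K' x) \<le> e" if x: "x \<in> cball 0 1" for x
    proof (rule ccontr)
      assume "\<not> ?thesis"
      then have "e powr q < (norm (K' x)) powr q" using e q by (intro powr_less_mono2) auto
      also have "\<dots> \<le> 2 powr q * \<tau> * (norm x) powr q" by (rule K'.norm_powr_le)
      also have "\<dots> \<le> 2 powr q * \<tau> * 1"
        using x q \<open>\<tau> > 0\<close> by (intro mult_left_mono powr_le1) auto
      also have "\<dots> = e powr q" using e by (simp add: \<tau>_def powr_mult[symmetric])
      finally show False by simp
    qed
    then show ?thesis unfolding K'_def R_def by blast
  qed
  have "\<exists>k. finite k \<and> closure (K ` cball 0 1) \<subseteq> (\<Union>x\<in>k. ball x e)" if e: "e > 0" for e
  proof -
    \<comment> \<open>One third pays for the tail and one for the finite net. The resulting closed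
      balls of radius 2e/3 form a closed set, so they cover the closure as well, and they lie inside
      the open balls of radius \<open>e\<close>.\<close>
    have "e / 3 > 0" using e by simp
    from tail[OF this] obtain N where N: "\<And>x. x \<in> cball 0 1 \<Longrightarrow>
        norm ((K (x - partial_fourier b N x)) - partial_fourier b N (K (x - partial_fourier b N x))) \<le> e / 3"
      by blast
    let ?P = "partial_fourier b N"
    obtain S1 where S1: "compact S1" "\<And>c. (\<forall>i<N. cmod (c i) \<le> 1) \<Longrightarrow> (\<Sum>i<N. c i *\<^sub>C K (b i)) \<in> S1"
      using compact_combination_superset[of N 1 "\<lambda>i. K (b i)"] by blast
    obtain S2 where S2: "compact S2" "\<And>c. (\<forall>i<N. cmod (c i) \<le> CK) \<Longrightarrow> (\<Sum>i<N. c i *\<^sub>C b i) \<in> S2"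
      using compact_combination_superset[of N CK b] by blast
    have "compact {x + y |x y. x \<in> S1 \<and> y \<in> S2}" by (rule compact_sums[OF S1(1) S2(1)])
    then have "\<exists>k. finite k \<and> {x + y |x y. x \<in> S1 \<and> y \<in> S2} \<subseteq> (\<Union>x\<in>k. ball x (e/3))"
      unfolding compact_eq_totally_bounded using \<open>e / 3 > 0\<close> by (elim conjE allE[of _ "e/3"] mp)
    then obtain k where k: "finite k" "{x + y |x y. x \<in> S1 \<and> y \<in> S2} \<subseteq> (\<Union>x\<in>k. ball x (e/3))"
      by (elim exE conjE)
    have nb: "norm (b i) = 1" for i by (rule orthonormal_family_norm[OF b UNIV_I])
    have "K x \<in> (\<Union>x\<in>k. cball x (2*e/3))" if x: "x \<in> cball 0 1" for x
    proof -
      let ?R = "x - ?P x"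
      have xb: "cmod (cinner x (b i)) \<le> 1" for i
        using cmod_cinner_le[of x "b i"] x nb[of i] by simp
      have nR: "norm ?R \<le> 1" using orth_proj_norm_le[OF orth_proj_compl[OF orth_proj_partial_fourier[OF b]], of x N] x by simp
      have "K (?P x) = (\<Sum>i<N. cnj (cinner x (b i)) *\<^sub>C K (b i))" by (simp add: partial_fourier_def Kl)
      also have "\<dots> \<in> S1"
        using xb by (intro S1(2)) simp
      finally have s1: "K (?P x) \<in> S1" .
      have s2: "?P (K ?R) \<in> S2" unfolding partial_fourier_def[of b N "K ?R"]
      proof (intro S2(2) allI impI)
        fix i
        have "cmod (cinner (K ?R) (b i)) \<le> norm (K ?R)" using cmod_cinner_le[of "K ?R" "b i"] by (simp add: nb)
        also have "\<dots> \<le> norm ?R * CK" by (rule CK(2))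
        also have "\<dots> \<le> 1 * CK" using nR CK(1) by (intro mult_right_mono) auto
        finally show "cmod (cinner (K ?R) (b i)) \<le> CK" by simp
      qed
      obtain y where y: "y \<in> k" "dist y (K (?P x) + ?P (K ?R)) < e/3" using s1 s2 k(2) by fastforce
      have "K x - (K (?P x) + ?P (K ?R)) = K ?R - ?P (K ?R)" by (simp add: Kl)
      then have "dist (K (?P x) + ?P (K ?R)) (K x) \<le> e/3"
        unfolding dist_norm using N[OF x] by (subst norm_minus_commute) (simp only:)
      then have "dist y (K x) \<le> 2*e/3" using y(2) dist_triangle[of y "K x" "K (?P x) + ?P (K ?R)"] by linarith
      then show ?thesis using y(1) by auto
    qed
    then have "closure (K ` cball 0 1) \<subseteq> (\<Union>x\<in>k. cball x (2*e/3))"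
      using k(1) by (intro closure_minimal closed_UN) auto
    also have "\<dots> \<subseteq> (\<Union>x\<in>k. ball x e)" using e by (intro UN_mono) auto
    finally show ?thesis using k(1) by blast
  qed
  then have "compact (closure (K ` cball 0 1))"
    unfolding compact_eq_totally_bounded by (simp add: complete_eq_closed)
  with Ka(2) show ?thesis by (simp add: compact_antilinear_def)
qed

end

section \<open>Singular values\<close>

text \<open>Over the complex numbers a real quadratic form already forces self-adjointness: its
  vanishing imaginary part is polarised at x + y, and then y is replaced by - \<i> y.\<close>

lemma positive_operator_imp_pos_op:
  assumes T: "positive_operator T"
  shows "pos_op T" "T (c *\<^sub>C x) = c *\<^sub>C T x"
proof -
  have lin: "T (x + y) = T x + T y" "T (c *\<^sub>C x) = c *\<^sub>C T x" for x y c
    using T by (auto simp: positive_operator_def bounded_clinear_def Vector_Spaces.linear_iff)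
  have pos: "cinner (T x) x \<in> \<real>\<^sub>\<ge>\<^sub>0" for x using T by (simp add: positive_operator_def)
  have bd: "\<exists>C. \<forall>x. norm (T x) \<le> C * norm x"
    using T by (simp add: positive_operator_def bounded_clinear_def)
  show "T (c *\<^sub>C x) = c *\<^sub>C T x" by (rule lin)
  obtain C where C: "\<And>x. norm (T x) \<le> norm x * C" using bd by (metis mult.commute)
  have bl: "bounded_linear T"
    by (rule bounded_linear_intro[OF _ _ C]) (auto simp: lin scaleR_scaleC)
  have im: "inner (T x) (\<i> *\<^sub>C x) = 0" and re: "0 \<le> inner (T x) x" for x
    using pos[of x] by (auto simp: complex_nonneg_Reals_iff inner_Re_cinner[of "T x" x] Im_cinner)
  have anti: "inner (T x) (\<i> *\<^sub>C y) = - inner (T y) (\<i> *\<^sub>C x)" for x y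
    using im[of "x + y"] im[of x] im[of y]
    by (simp add: lin scaleC_add_right inner_add_left inner_add_right)
  have "inner (T x) y = inner x (T y)" for x y
  proof -
    have "inner (T x) y = inner (T x) (\<i> *\<^sub>C (- (\<i> *\<^sub>C y)))" by (simp add: scaleC_minus_right scaleC_i_i)
    also have "\<dots> = - inner (T (- (\<i> *\<^sub>C y))) (\<i> *\<^sub>C x)" by (rule anti)
    also have "T (- (\<i> *\<^sub>C y)) = - (\<i> *\<^sub>C T y)"
      using lin(2)[of "- \<i>" y] by (simp add: scaleC_minus_left)
    also have "- inner (- (\<i> *\<^sub>C T y)) (\<i> *\<^sub>C x) = inner (T y) x"
      by (simp add: inner_i_left scaleC_i_i)
    finally show ?thesis by (simp add: inner_commute)
  qed
  with bl re show "pos_op T" by (simp add: pos_op_def selfadj_def)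
qed

text \<open>To identify the definite description, any competing root T commutes with its own square
  - K K, hence with the root W, which commutes with everything that commutes with - K K; then
  \<open>pos_sqrt_unique\<close> applies.\<close>

lemma antilinear_abs_skew:
  fixes K :: "'a::chilbert_space \<Rightarrow> 'a"
  assumes K: "skew_antilinear K"
  shows "pos_op (antilinear_abs K)" "antilinear_abs K (antilinear_abs K x) = - K (K x)"
    "antilinear_abs K (c *\<^sub>C x) = c *\<^sub>C antilinear_abs K x"
    "cinner (antilinear_abs K x) y = cinner x (antilinear_abs K y)"
proof -
  obtain W where W: "pos_op W" "\<And>x. W (W x) = - K (K x)"
    "\<And>B x. bounded_linear B \<Longrightarrow> (\<And>x. B (- K (K x)) = - K (K (B x))) \<Longrightarrow> B (W x) = W (B x)"
  proof -
    note Ka = skew_antilinearD[OF K]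
    have "pos_op (\<lambda>x. - K (K x))" unfolding pos_op_def selfadj_def
    proof (intro conjI allI)
      show "bounded_linear (\<lambda>x. - K (K x))" by (intro bounded_linear_minus bounded_linear_compose[OF Ka(3) Ka(3)])
      show "inner (- K (K x)) y = inner x (- K (K y))" for x y by (simp add: Ka(5)[of "K x"] Ka(5)[of x])
      show "0 \<le> inner (- K (K x)) x" for x by (simp add: Ka(5)[of "K x"])
    qed
    from ex_pos_sqrt[OF this] that show thesis by metis
  qed
  note Wd = selfadjD[OF pos_opD(1)[OF W(1)]] and Kl = antilinearD[OF skew_antilinearD(2)[OF K]]
  have adj: "antilinear_adjoint K = (\<lambda>x. - K x)"
    using skew_antilinear_imp_skew_self_adjoint[OF K] by (simp add: skew_self_adjoint_def)
  have Wc: "W (c *\<^sub>C x) = c *\<^sub>C W x" for c x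
    by (rule W(3)[OF bounded_linear_scaleC, symmetric]) (simp add: Kl scaleC_minus_right)
  have Wcin: "cinner (W x) y = cinner x (W y)" for x y
    using Wd(3)[of x y] Wd(3)[of x "\<i> *\<^sub>C y"] by (simp add: complex_eq_iff inner_Re_cinner[symmetric] Im_cinner Wc)
  have eq: "antilinear_abs K = W" unfolding antilinear_abs_def
  proof (rule the_equality)
    have "cinner (W x) x \<in> \<real>\<^sub>\<ge>\<^sub>0" for x
    proof -
      have "Im (cinner (W x) x) = 0" using Wcin[of x x] cnj_cinner[of "W x" x]
        by (metis Reals_cnj_iff complex_is_Real_iff)
      then show ?thesis using pos_opD(2)[OF W(1), of x]
        by (simp add: complex_nonneg_Reals_iff inner_Re_cinner)
    qed
    moreover have "bounded_clinear W"
    proof -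
      obtain C where "\<And>x. norm (W x) \<le> C * norm x" using selfadj_pos_bound[OF pos_opD(1)[OF W(1)]] by metis
      moreover have "Vector_Spaces.linear scaleC scaleC W"
        unfolding Vector_Spaces.linear_iff using complex_vector.vector_space_axioms Wd(4) Wc by blast
      ultimately show ?thesis unfolding bounded_clinear_def by blast
    qed
    ultimately show "positive_operator W \<and> W \<circ> W = antilinear_adjoint K \<circ> K"
      by (auto simp: positive_operator_def adj W(2))
    fix T assume T: "positive_operator T \<and> T \<circ> T = antilinear_adjoint K \<circ> K"
    then have TT: "T (T x) = - K (K x)" for x by (metis adj comp_apply)
    have Tp: "pos_op T" using T positive_operator_imp_pos_op by blast
    have "T (W x) = W (T x)" for x
      by (rule W(3)[OF selfadjD(1)[OF pos_opD(1)[OF Tp]]]) (simp add: TT[symmetric])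
    with W(1,2) Tp TT show "T = W" by (intro pos_sqrt_unique[where S="\<lambda>x. - K (K x)"])
  qed
  show "pos_op (antilinear_abs K)" "antilinear_abs K (antilinear_abs K x) = - K (K x)"
    "antilinear_abs K (c *\<^sub>C x) = c *\<^sub>C antilinear_abs K x"
    "cinner (antilinear_abs K x) y = cinner x (antilinear_abs K y)"
    unfolding eq by (fact W(1) W(2) Wc Wcin)+
qed

context triangular_skew
begin

lemma singular_value_nonneg:
  assumes "s \<in> singular_values K"
  shows "0 \<le> s"
proof -
  obtain x where x: "x \<noteq> 0" "antilinear_abs K x = s *\<^sub>R x" using assms by (auto simp: singular_values_def)
  have "0 \<le> s * inner x x" using pos_opD(2)[OF antilinear_abs_skew(1)[OF K], of x] x(2) by simp
  moreover have "0 < inner x x" using x(1) by simp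
  ultimately show ?thesis by (auto simp: zero_le_mult_iff)
qed

text \<open>\<open>sum_powr_le\<close> is applied to orthonormal eigenvectors x of |K| and the
  vectors K x / s. The latter are orthonormal because <K x, K y> = t^2 <y, x> when |K| y = t y, and
  <K x, K x / s> = s.\<close>

lemma singular_value_sum_le:
  assumes F: "finite F" "F \<subseteq> singular_values K"
  shows "(\<Sum>s\<in>F. real (singular_value_mult K s) * s powr q) \<le> 2 powr q * \<sigma>"
proof -
  let ?W = "antilinear_abs K"
  note W = antilinear_abs_skew[OF K] and Wd = selfadjD[OF pos_opD(1)[OF antilinear_abs_skew(1)[OF K]]]
  define V where "V s = {x. ?W x = s *\<^sub>R x}" for s
  have V: "csubspace (V s)" for s
    unfolding complex_vector.subspace_def V_def
    by (auto simp: Wd W(3) scaleC_add_right scaleR_scaleC scaleC_scaleC mult.commute)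
  obtain B where B: "\<And>s. finite (B s)" "\<And>s. orthonormal_set (B s)" "\<And>s. B s \<subseteq> V s"
    "\<And>s. card (B s) = singular_value_mult K s"
  proof -
    have "\<forall>s. \<exists>B. finite B \<and> orthonormal_set B \<and> B \<subseteq> V s \<and> card B = singular_value_mult K s"
      using ex_orthonormal_dim[OF V] unfolding V_def singular_value_mult_def by metis
    then show thesis using that by metis
  qed
  \<comment> \<open>The value 0 contributes nothing to the sum and has to be removed before dividing
    by \<open>s\<close>.\<close>
  define F' where "F' = {s\<in>F. 0 < s}"
  have F': "finite F'" using F(1) by (simp add: F'_def)
  define I where "I = Sigma F' B"
  have I: "finite I" using F' B(1) by (simp add: I_def)
  have eig: "?W x = s *\<^sub>R x" "s > 0" if "(s, x) \<in> I" for s x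
    using that B(3) by (auto simp: I_def V_def F'_def)
  have orth: "cinner x y = (if (s, x) = (t, y) then 1 else 0)" if "(s, x) \<in> I" "(t, y) \<in> I" for s x t y
  proof (cases "s = t")
    case True
    then show ?thesis using that B(2)[of s] by (auto simp: I_def orthonormal_set_def)
  next
    case False
    have "s * cinner x y = t * cinner x y"
      using W(4)[of x y] eig(1)[OF that(1)] eig(1)[OF that(2)] by (simp add: cinner_scaleR_left cinner_scaleR_right)
    with False show ?thesis by simp
  qed
  define g where "g z = (1 / fst z) *\<^sub>R K (snd z)" for z :: "real \<times> 'a"
  have KK: "cinner (K x) (K y) = t\<^sup>2 * cinner y x" if "(t, y) \<in> I" for x t y
  proof -
    have "cinner (K x) (K y) = cinner (- K (K y)) x" using Ka(4)[of x "K y"] by (simp add: cinner_minus_left)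
    also have "- K (K y) = t\<^sup>2 *\<^sub>R y" using eig(1)[OF that] by (simp add: W(2)[symmetric] Wd power2_eq_square)
    finally show ?thesis by (simp add: cinner_scaleR_left)
  qed
  have u: "orthonormal_family I snd" unfolding orthonormal_family_def
  proof (intro ballI)
    fix z w assume "z \<in> I" "w \<in> I"
    then show "cinner (snd z) (snd w) = (if z = w then 1 else 0)"
      using orth[of "fst z" "snd z" "fst w" "snd w"] by simp
  qed
  have g: "orthonormal_family I g" unfolding orthonormal_family_def
  proof (intro ballI)
    fix z w assume zw: "z \<in> I" "w \<in> I"
    obtain s x t y where st: "z = (s, x)" "w = (t, y)" by (cases z, cases w)
    have "cinner (g z) (g w) = (1 / s) * (1 / t) * (t\<^sup>2 * cinner y x)"
      using KK[of t y x] zw st by (simp add: g_def cinner_scaleR_left cinner_scaleR_right)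
    also have "\<dots> = (if z = w then 1 else 0)"
      using orth[of t y s x] zw st eig(2)[of s x] by (auto simp: power2_eq_square)
    finally show "cinner (g z) (g w) = (if z = w then 1 else 0)" .
  qed
  have val: "cmod (cinner (K (snd z)) (g z)) = fst z" if z: "z \<in> I" for z
  proof -
    obtain s x where st: "z = (s, x)" by (cases z)
    have "cinner (K x) (g z) = (1 / s) * (s\<^sup>2 * 1)"
      using KK[of s x x] orth[of s x s x] z st by (simp add: g_def cinner_scaleR_right)
    then show ?thesis using eig(2)[of s x] z st by (simp add: power2_eq_square norm_mult norm_divide)
  qed
  have "(\<Sum>s\<in>F. real (singular_value_mult K s) * s powr q) = (\<Sum>s\<in>F'. real (singular_value_mult K s) * s powr q)"
    unfolding F'_def using F singular_value_nonneg
    by (intro sum.mono_neutral_right) (auto simp: not_less dest!: subsetD intro: antisym)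
  also have "\<dots> = (\<Sum>s\<in>F'. \<Sum>x\<in>B s. s powr q)" by (simp add: B(4))
  also have "\<dots> = (\<Sum>z\<in>I. fst z powr q)" unfolding I_def using F' B(1) by (subst sum.Sigma) (auto intro: sum.cong)
  also have "\<dots> = (\<Sum>z\<in>I. (cmod (cinner (K (snd z)) (g z))) powr q)" by (simp add: val)
  also have "\<dots> \<le> 2 powr q * \<sigma>" by (rule sum_powr_le[OF I u g])
  finally show ?thesis .
qed

text \<open>Every singular value of nonzero multiplicity satisfies s^q \<le> 2^q \<sigma> \<le> 1,
  so s \<le> 1 and s^p \<le> s^q. This carries the estimate from exponent q to every larger
  p.\<close>

lemma schatten_bound:
  assumes p: "q \<le> p" and le: "2 powr q * \<sigma> \<le> 1"
  shows "schatten_class p K" "(schatten_norm p K) powr p \<le> 2 powr q * \<sigma>"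
proof -
  let ?h = "\<lambda>s. real (singular_value_mult K s) * s powr p"
  have term_le: "?h s \<le> real (singular_value_mult K s) * s powr q" if s: "s \<in> singular_values K" for s
  proof (cases "singular_value_mult K s = 0 \<or> s = 0")
    case False
    then have s0: "s > 0" using singular_value_nonneg[OF s] by simp
    have "s powr q \<le> real (singular_value_mult K s) * s powr q" using False by (simp add: mult_le_cancel_right1)
    also have "\<dots> \<le> 1" using singular_value_sum_le[of "{s}"] s le by simp
    finally have "s powr q \<le> 1" .
    then have "s \<le> 1" using powr_less_mono2[of q 1 s] q by fastforce
    then show ?thesis using s0 p by (intro mult_left_mono powr_mono') auto
  qed auto
  have fin: "sum ?h F \<le> 2 powr q * \<sigma>" if F: "finite F" "F \<subseteq> singular_values K" for F
    using F singular_value_sum_le[OF F] by (intro order_trans[OF sum_mono[OF term_le]]) auto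
  have summ: "?h summable_on singular_values K"
    using fin by (intro nonneg_bdd_above_summable_on) (auto intro!: bdd_aboveI)
  then show "schatten_class p K" using compact_operator by (simp add: schatten_class_def)
  have "infsum ?h (singular_values K) \<le> 2 powr q * \<sigma>"
    by (rule infsum_le_finite_sums[OF summ fin])
  moreover have "0 \<le> infsum ?h (singular_values K)" by (intro infsum_nonneg) auto
  ultimately show "(schatten_norm p K) powr p \<le> 2 powr q * \<sigma>"
    using p q by (simp add: schatten_norm_def powr_powr)
qed

end

section \<open>The block skew-diagonal operator\<close>

lemma norm_sum_orthonormal_family:
  assumes "finite I" "orthonormal_family I u"
  shows "(norm (\<Sum>i\<in>I. c i *\<^sub>C u i))\<^sup>2 = (\<Sum>i\<in>I. (cmod (c i))\<^sup>2)"
proof -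
  have "complex_of_real ((norm (\<Sum>i\<in>I. c i *\<^sub>C u i))\<^sup>2) = (\<Sum>i\<in>I. \<Sum>j\<in>I. c i * cnj (c j) * cinner (u i) (u j))"
    unfolding cinner_self[symmetric] cinner_sum_left
    unfolding cinner_sum_right
    by (intro sum.cong refl) (simp add: cinner_scaleC_left cinner_scaleC_right)
  also have "\<dots> = (\<Sum>i\<in>I. \<Sum>j\<in>I. if i = j then c i * cnj (c i) else 0)"
    using assms(2) by (intro sum.cong refl) (auto simp: orthonormal_family_def)
  also have "\<dots> = complex_of_real (\<Sum>i\<in>I. (cmod (c i))\<^sup>2)"
    using assms(1) by (simp add: complex_norm_square del: of_real_power)
  finally show ?thesis by (simp only: of_real_eq_iff)
qed

lemma orthonormal_series_convergent:
  fixes b :: "nat \<Rightarrow> 'a::chilbert_space"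
  assumes b: "orthonormal_family UNIV b" and s: "summable (\<lambda>m. (cmod (c m))\<^sup>2)"
  shows "convergent (\<lambda>N. \<Sum>m<N. c m *\<^sub>C b m)"
proof -
  have "Cauchy (\<lambda>N. \<Sum>m<N. c m *\<^sub>C b m)"
  proof (rule CauchyI')
    fix e :: real assume e: "e > 0"
    then have "e\<^sup>2 > 0" by simp
    with s obtain N where N: "\<And>m n. m \<ge> N \<Longrightarrow> norm (\<Sum>k\<in>{m..<n}. (cmod (c k))\<^sup>2) < e\<^sup>2"
      unfolding summable_Cauchy by blast
    have "dist (\<Sum>k<m. c k *\<^sub>C b k) (\<Sum>k<n. c k *\<^sub>C b k) < e" if mn: "m \<ge> N" "n > m" for m n
    proof -
      have "orthonormal_family {m..<n} b" using b by (simp add: orthonormal_family_def)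
      then have "(norm (\<Sum>k\<in>{m..<n}. c k *\<^sub>C b k))\<^sup>2 < e\<^sup>2"
        using N[OF mn(1), of n] by (simp add: norm_sum_orthonormal_family sum_nonneg)
      then have "norm (\<Sum>k\<in>{m..<n}. c k *\<^sub>C b k) < e" using e by (simp add: power2_less_imp_less)
      moreover have "(\<Sum>k<n. c k *\<^sub>C b k) - (\<Sum>k<m. c k *\<^sub>C b k) = (\<Sum>k\<in>{m..<n}. c k *\<^sub>C b k)"
        using mn(2) by (simp add: sum_diff_nat_ivl[of 0 m n] lessThan_atLeast0)
      ultimately show ?thesis unfolding dist_norm by (subst norm_minus_commute) simp
    qed
    then show "\<exists>M. \<forall>m\<ge>M. \<forall>n>m. dist (\<Sum>k<m. c k *\<^sub>C b k) (\<Sum>k<n. c k *\<^sub>C b k) < e" by blast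
  qed
  then show ?thesis by (rule Cauchy_convergent)
qed

text \<open>In the flattened basis the indices 2n and 2n+1 carry e_n and f_n.\<close>

definition block_partner :: "nat \<Rightarrow> nat" where
  "block_partner m = (if even m then Suc m else m - 1)"

lemma block_partner_involution [simp]: "block_partner (block_partner m) = m"
  by (auto simp: block_partner_def)

text \<open>Truncation at an even index separates no pair, so antisymmetry can be checked on even
  partial sums.\<close>

lemma block_partner_less: "block_partner m < 2 * k \<longleftrightarrow> m < 2 * k"
  unfolding block_partner_def by (auto, presburger+)

text \<open>\<open>D\<close> is given by its Fourier series, which converges by Bessel's inequality
  and the bound on \<gamma>. Exchanging partners in the sum swaps the two arguments of the form, and
  the sign rule for \<gamma> turns this into antisymmetry.\<close>

lemma ex_block_operator:
  fixes b :: "nat \<Rightarrow> 'a::chilbert_space" and \<gamma> :: "nat \<Rightarrow> real"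
  assumes b: "orthonormal_family UNIV b" and \<gamma>: "\<And>m. \<gamma> (block_partner m) = - \<gamma> m" "\<And>m. \<bar>\<gamma> m\<bar> \<le> C"
  obtains D where "skew_antilinear D" "\<And>k. D (b k) = \<gamma> (block_partner k) *\<^sub>R b (block_partner k)"
proof -
  let ?\<pi> = block_partner
  have C: "0 \<le> C" using \<gamma>(2)[of 0] by simp
  have b\<pi>: "orthonormal_family I (\<lambda>m. b (?\<pi> m))" for I
    using b unfolding orthonormal_family_def by (metis UNIV_I block_partner_involution)
  have bI: "orthonormal_family I b" for I using b by (simp add: orthonormal_family_def)
  define c where "c x m = \<gamma> m * cnj (cinner x (b (?\<pi> m)))" for x m
  define S where "S N x = (\<Sum>m<N. c x m *\<^sub>C b m)" for N x
  have c2: "(\<Sum>m<N. (cmod (c x m))\<^sup>2) \<le> (C * norm x)\<^sup>2" for x N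
  proof -
    have "(\<Sum>m<N. (cmod (c x m))\<^sup>2) \<le> (\<Sum>m<N. C\<^sup>2 * (cmod (cinner x (b (?\<pi> m))))\<^sup>2)"
    proof (intro sum_mono)
      fix m
      have "\<bar>\<gamma> m\<bar>\<^sup>2 \<le> C\<^sup>2" using \<gamma>(2) by (intro power_mono) auto
      then show "(cmod (c x m))\<^sup>2 \<le> C\<^sup>2 * (cmod (cinner x (b (?\<pi> m))))\<^sup>2"
        by (simp add: c_def norm_mult power_mult_distrib mult_right_mono)
    qed
    also have "\<dots> \<le> C\<^sup>2 * (norm x)\<^sup>2"
      unfolding sum_distrib_left[symmetric] by (intro mult_left_mono bessel_family b\<pi>) auto
    finally show ?thesis by (simp add: power_mult_distrib)
  qed
  have conv: "convergent (\<lambda>N. S N x)" for x unfolding S_def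
    by (intro orthonormal_series_convergent[OF b] summableI_nonneg_bounded[of _ "(C * norm x)\<^sup>2"] c2) auto
  define D where "D x = lim (\<lambda>N. S N x)" for x
  have D: "(\<lambda>N. S N x) \<longlonglongrightarrow> D x" for x using conv[of x] unfolding D_def convergent_LIMSEQ_iff .
  have nS: "norm (S N x) \<le> norm x * C" for N x
  proof (rule power2_le_imp_le)
    show "(norm (S N x))\<^sup>2 \<le> (norm x * C)\<^sup>2"
      using c2[where N=N] unfolding S_def by (simp add: norm_sum_orthonormal_family[OF _ bI] mult.commute)
  qed (use C in simp)
  have add: "D (x + y) = D x + D y" for x y
  proof (rule LIMSEQ_unique[OF D])
    show "(\<lambda>N. S N (x + y)) \<longlonglongrightarrow> D x + D y"
      using tendsto_add[OF D[of x] D[of y]]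
      by (simp add: S_def c_def cinner_add_left distrib_left scaleC_add_left sum.distrib)
  qed
  have sc: "D (a *\<^sub>C x) = cnj a *\<^sub>C D x" for a x
  proof (rule LIMSEQ_unique[OF D])
    have "S N (a *\<^sub>C x) = cnj a *\<^sub>C S N x" for N
      by (simp add: S_def c_def cinner_scaleC_left scaleC_sum_right scaleC_scaleC mult_ac)
    then show "(\<lambda>N. S N (a *\<^sub>C x)) \<longlonglongrightarrow> cnj a *\<^sub>C D x"
      using bounded_linear.tendsto[OF bounded_linear_scaleC D] by simp
  qed
  have nD: "norm (D x) \<le> C * norm x" for x
    by (rule LIMSEQ_le_const2[OF tendsto_norm[OF D]]) (use nS in \<open>auto simp: mult.commute\<close>)
  have ba: "bounded_antilinear D"
    unfolding bounded_antilinear_def antilinear_def using add sc nD by blast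
  have skS: "cinner (S (2 * k) x) y = - cinner (S (2 * k) y) x" for k x y
  proof -
    have S_eq: "cinner (S (2 * k) x) y = (\<Sum>m<2*k. \<gamma> m * cnj (cinner x (b (?\<pi> m))) * cnj (cinner y (b m)))" for x y
      unfolding S_def cinner_sum_left by (intro sum.cong refl) (simp add: c_def cinner_scaleC_left cnj_cinner)
    have "cinner (S (2 * k) x) y
        = (\<Sum>m<2*k. \<gamma> (?\<pi> m) * cnj (cinner x (b m)) * cnj (cinner y (b (?\<pi> m))))"
      unfolding S_eq
      by (rule sum.reindex_bij_witness[of _ ?\<pi> ?\<pi>]) (auto simp: block_partner_less)
    also have "\<dots> = - cinner (S (2 * k) y) x"
      unfolding S_eq sum_negf[symmetric] by (intro sum.cong refl) (simp add: \<gamma>(1) mult_ac)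
    finally show ?thesis .
  qed
  have "cinner (D x) y = - cinner (D y) x" for x y
  proof (rule LIMSEQ_unique)
    have lim: "(\<lambda>k. cinner (S (2 * k) x) y) \<longlonglongrightarrow> cinner (D x) y" for x y
      by (rule bounded_linear.tendsto[OF bounded_linear_cinner_left])
        (use LIMSEQ_subseq_LIMSEQ[OF D, of "\<lambda>k. 2 * k"] in \<open>auto simp: strict_mono_def comp_def\<close>)
    show "(\<lambda>k. cinner (S (2 * k) x) y) \<longlonglongrightarrow> cinner (D x) y" by (rule lim)
    show "(\<lambda>k. cinner (S (2 * k) x) y) \<longlonglongrightarrow> - cinner (D y) x"
      using tendsto_minus[OF lim[of y x]] skS[of _ x y] by simp
  qed
  with ba have sk: "skew_antilinear D" unfolding skew_antilinear_def by blast
  have "D (b k) = \<gamma> (?\<pi> k) *\<^sub>R b (?\<pi> k)" for k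
  proof (rule LIMSEQ_unique[OF D])
    have "S N (b k) = \<gamma> (?\<pi> k) *\<^sub>R b (?\<pi> k)" if N: "N > ?\<pi> k" for N
    proof -
      have "S N (b k) = (\<Sum>m<N. if m = ?\<pi> k then \<gamma> (?\<pi> k) *\<^sub>R b (?\<pi> k) else 0)"
        unfolding S_def
      proof (intro sum.cong refl)
        fix m
        have "cinner (b k) (b (?\<pi> m)) = (if m = ?\<pi> k then 1 else 0)"
          using b unfolding orthonormal_family_def by (metis UNIV_I block_partner_involution)
        then show "c (b k) m *\<^sub>C b m = (if m = ?\<pi> k then \<gamma> (?\<pi> k) *\<^sub>R b (?\<pi> k) else 0)"
          by (simp add: c_def scaleR_scaleC)
      qed
      then show ?thesis using N by simp
    qed
    then show "(\<lambda>N. S N (b k)) \<longlonglongrightarrow> \<gamma> (?\<pi> k) *\<^sub>R b (?\<pi> k)"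
      by (intro tendsto_eventually) (auto simp: eventually_sequentially intro!: exI[of _ "Suc (?\<pi> k)"])
  qed
  with sk show thesis by (rule that)
qed

text \<open>An odd orthonormal set spanning \<open>N\<close> would be a basis and give
  \<open>N\<close> odd finite dimension.\<close>

lemma odd_orthonormal_extend:
  fixes A :: "'a::complex_inner \<Rightarrow> 'a"
  assumes N: "csubspace N"
    and dim: "\<not> finite_cdim N \<or> (finite_cdim N \<and> even (complex_vector.dim N))"
    and B: "finite B" "orthonormal_set B" "B \<subseteq> N" "odd (card B)"
  shows "\<exists>y\<in>N. norm y = 1 \<and> (\<forall>b\<in>B. cinner y b = 0)"
proof (cases "N \<subseteq> cspan B")
  case True
  then have "finite_cdim N" "complex_vector.dim N = card B"
    using B(1,3) complex_vector.dim_unique[OF B(3) True orthonormal_set_independent[OF B(1,2)] refl]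
    by (auto simp: finite_cdim_def)
  with dim B(4) show ?thesis by simp
next
  case False
  then obtain x where "x \<in> N" "x \<notin> cspan B" by blast
  then show ?thesis using orthonormal_extend[OF B(1,2) N B(3)] by metis
qed

section \<open>Assembling the decomposition\<close>

lemma sum_div2: "(\<Sum>m<2 * N. h (m div 2)) = 2 * (\<Sum>i<N. h i :: real)" for N :: nat
  by (induction N) (auto simp: lessThan_Suc)

text \<open>Interleaving the pairs into one basis makes K = A - D an instance of
  \<open>triangular_skew\<close>. Both vectors of a pair carry the error \<open>r\<close> of that
  pair, hence the total 2 \<eta>.\<close>

lemma schatten_perturbation_from_blocks:
  fixes A :: "'a::chilbert_space \<Rightarrow> 'a" and e f :: "nat \<Rightarrow> 'a" and d r :: "nat \<Rightarrow> real"
  assumes A: "skew_antilinear A"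
    and unit: "\<And>n. norm (e n) = 1" "\<And>n. norm (f n) = 1" "\<And>n. cinner (e n) (f n) = 0"
    and orth: "\<And>n x. x \<in> e ` {..<n} \<union> f ` {..<n} \<Longrightarrow> cinner (e n) x = 0"
      "\<And>n x. x \<in> e ` {..<n} \<union> f ` {..<n} \<Longrightarrow> cinner (f n) x = 0"
    and dense: "closure (cspan (range e \<union> range f)) = UNIV"
    and d: "\<And>n. \<bar>d n\<bar> \<le> C"
    and res: "\<And>n. \<exists>v w. norm v \<le> r n \<and> norm w \<le> r n \<and>
        A (e n) - d n *\<^sub>R f n - v \<in> cspan (e ` {..<n} \<union> f ` {..<n}) \<and>
        A (f n) + d n *\<^sub>R e n - w \<in> cspan (e ` {..<n} \<union> f ` {..<n})"
    and q: "1 < q" "q \<le> 2" and qp: "q \<le> p" and \<eta>: "\<And>N. (\<Sum>i<N. r i powr q) \<le> \<eta>" "2 powr q * (2 * \<eta>) \<le> 1"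
  obtains D where "block_skew_diagonal D" "skew_antilinear (\<lambda>x. A x - D x)" "schatten_class p (\<lambda>x. A x - D x)"
    "(schatten_norm p (\<lambda>x. A x - D x)) powr p \<le> 2 powr q * (2 * \<eta>)"
proof -
  define b where "b m = (if even m then e (m div 2) else f (m div 2))" for m
  have b2: "b (2 * i) = e i" "b (Suc (2 * i)) = f i" for i by (auto simp: b_def)
  have b_in: "b l \<in> e ` {..<n} \<union> f ` {..<n}" if "l < 2 * n" for l n using that by (auto simp: b_def)
  have b_sub: "e ` {..<n} \<union> f ` {..<n} \<subseteq> b ` {..<2 * n}" for n
  proof -
    have "e i \<in> b ` {..<2 * n}" "f i \<in> b ` {..<2 * n}" if "i < n" for i
      using that imageI[of "2 * i" "{..<2 * n}" b] imageI[of "Suc (2 * i)" "{..<2 * n}" b] by (auto simp: b2)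
    then show ?thesis by auto
  qed
  have lt: "cinner (b m) (b l) = 0" if "l < m" for l m
  proof (cases "l < 2 * (m div 2)")
    case True
    from b_in[OF this] show ?thesis using orth by (simp add: b_def[of m])
  next
    case False
    with that have "l = 2 * (m div 2)" "m = Suc (2 * (m div 2))" by presburger+
    then have "b l = e (m div 2)" "b m = f (m div 2)" using b2[of "m div 2"] by metis+
    then show ?thesis using unit(3) cinner_eq_0_commute by metis
  qed
  have nb: "norm (b m) = 1" for m by (simp add: b_def unit)
  have b: "orthonormal_family UNIV b" unfolding orthonormal_family_def
  proof (intro ballI)
    fix m l :: nat
    show "cinner (b m) (b l) = (if m = l then 1 else 0)"
      using lt[of m l] lt[of l m] cinner_eq_0_commute[of "b m" "b l"] nb[of m]
      by (cases m l rule: linorder_cases) (auto simp: cinner_self)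
  qed
  have "range b = range e \<union> range f"
  proof
    show "range b \<subseteq> range e \<union> range f" by (auto simp: b_def)
    show "range e \<union> range f \<subseteq> range b" using b2 by (metis Un_subset_iff image_subsetI rangeI)
  qed
  with dense have bdense: "closure (cspan (range b)) = UNIV" by simp
  \<comment> \<open>\<open>ex_block_operator\<close> reads \<gamma> at the partner index, so D e_n =
    d_n f_n requires +d at the odd index.\<close>
  define \<gamma> where "\<gamma> m = (if even m then - d (m div 2) else d (m div 2))" for m
  have "\<gamma> (block_partner m) = - \<gamma> m" "\<bar>\<gamma> m\<bar> \<le> C" for m
    using d by (auto simp: \<gamma>_def block_partner_def elim!: oddE)
  then obtain D where D: "skew_antilinear D" "\<And>k. D (b k) = \<gamma> (block_partner k) *\<^sub>R b (block_partner k)"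
    using ex_block_operator[OF b] by metis
  have De: "D (e n) = d n *\<^sub>R f n" for n
    using D(2)[of "2 * n"] by (simp add: b2 block_partner_def \<gamma>_def)
  have Df: "D (f n) = - (d n *\<^sub>R e n)" for n
    using D(2)[of "Suc (2 * n)"] by (simp add: b2 block_partner_def \<gamma>_def)
  have onb: "orthonormal_basis (case_sum e f)" unfolding orthonormal_basis_def
  proof (intro conjI allI)
    define \<iota> :: "nat + nat \<Rightarrow> nat" where "\<iota> = case_sum (\<lambda>i. 2 * i) (\<lambda>i. Suc (2 * i))"
    have c: "case_sum e f z = b (\<iota> z)" for z by (cases z) (auto simp: \<iota>_def b2)
    have inj: "\<iota> z = \<iota> w \<longleftrightarrow> z = w" for z w by (cases z; cases w) (simp_all add: \<iota>_def, presburger+)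
    show "cinner (case_sum e f i) (case_sum e f j) = (if i = j then 1 else 0)" for i j
      using b by (simp add: c orthonormal_family_def inj)
    have "range (case_sum e f) = range e \<union> range f"
    proof
      show "range (case_sum e f) \<subseteq> range e \<union> range f" by (auto split: sum.splits)
      show "range e \<union> range f \<subseteq> range (case_sum e f)"
        by (auto intro: range_eqI[of _ _ "Inl _"] range_eqI[of _ _ "Inr _"])
    qed
    then show "closure (cspan (range (case_sum e f))) = UNIV" using dense by simp
  qed
  have bsd: "block_skew_diagonal D" unfolding block_skew_diagonal_def
  proof (intro conjI)
    show "bounded_antilinear D" by (rule skew_antilinearD(1)[OF D(1)])
    show "\<exists>(d :: nat \<Rightarrow> complex) (e :: nat \<Rightarrow> 'a) (f :: nat \<Rightarrow> 'a). orthonormal_basis (case_sum e f) \<and> (\<forall>n. D (e n) = d n *\<^sub>C f n \<and> D (f n) = - (d n *\<^sub>C e n))"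
      by (rule exI[of _ "\<lambda>n. complex_of_real (d n)"], rule exI[of _ e], rule exI[of _ f])
        (use onb in \<open>simp add: De Df scaleR_scaleC\<close>)
  qed
  define K where "K x = A x - D x" for x
  have K: "skew_antilinear K"
  proof -
    note Aa = skew_antilinearD[OF A] and Da = skew_antilinearD[OF D(1)]
    have "bounded_antilinear K"
    proof (rule bounded_antilinearI)
      show "bounded_linear K" unfolding K_def by (rule bounded_linear_sub[OF Aa(3) Da(3)])
      show "K (\<i> *\<^sub>C x) = - (\<i> *\<^sub>C K x)" for x
        by (simp add: K_def antilinearD[OF Aa(2)] antilinearD[OF Da(2)] scaleC_minus_left scaleC_diff_right)
    qed
    moreover have "cinner (K x) y = - cinner (K y) x" for x y
      using Aa(4)[of x y] Da(4)[of x y] by (simp add: K_def cinner_diff_left)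
    ultimately show ?thesis unfolding skew_antilinear_def by blast
  qed
  obtain V W where VW: "\<And>n. norm (V n) \<le> r n" "\<And>n. norm (W n) \<le> r n"
    "\<And>n. K (e n) - V n \<in> cspan (e ` {..<n} \<union> f ` {..<n})"
    "\<And>n. K (f n) - W n \<in> cspan (e ` {..<n} \<union> f ` {..<n})"
  proof -
    have "\<forall>n. \<exists>v w. norm v \<le> r n \<and> norm w \<le> r n \<and> K (e n) - v \<in> cspan (e ` {..<n} \<union> f ` {..<n}) \<and>
        K (f n) - w \<in> cspan (e ` {..<n} \<union> f ` {..<n})"
      using res by (simp add: K_def De Df)
    then show thesis using that by metis
  qed
  define v where "v m = (if even m then V (m div 2) else W (m div 2))" for m
  interpret triangular_skew b K v "\<lambda>m. r (m div 2)" q "2 * \<eta>"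
  proof
    show "cinner (K (b m)) (b l) = cinner (v m) (b l)" if ml: "m < l" for m l
    proof -
      \<comment> \<open>The span stops before the pair containing \<open>m\<close>, not merely
        before \<open>m\<close>. Hence all of its basis vectors are orthogonal to
        \<open>b l\<close>, including the case where \<open>l\<close> is the partner of
        \<open>m\<close>.\<close>
      have span: "K (b m) - v m \<in> cspan (b ` {..<2 * (m div 2)})"
        by (rule cspan_mono_in[OF _ b_sub]) (use VW in \<open>simp add: b_def v_def\<close>)
      have "cinner (b l) (K (b m) - v m) = 0"
      proof (rule cinner_span_eq_0[OF _ span])
        fix x assume "x \<in> b ` {..<2 * (m div 2)}"
        then obtain i where i: "x = b i" "i < 2 * (m div 2)" by blast
        have "2 * (m div 2) \<le> m" by simp
        with i(2) ml have "i < l" by linarith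
        then show "cinner (b l) x = 0" unfolding i(1) by (rule lt)
      qed
      then have "cinner (K (b m) - v m) (b l) = 0" using cinner_eq_0_commute by blast
      then show ?thesis by (simp add: cinner_diff_left)
    qed
    show "norm (v m) \<le> r (m div 2)" for m by (simp add: v_def VW)
    show "(\<Sum>m<N. r (m div 2) powr q) \<le> 2 * \<eta>" for N
    proof -
      have "(\<Sum>m<N. r (m div 2) powr q) \<le> (\<Sum>m<2 * N. r (m div 2) powr q)"
        by (intro sum_mono2) auto
      also have "\<dots> = 2 * (\<Sum>i<N. r i powr q)" by (rule sum_div2)
      finally show ?thesis using \<eta>(1)[of N] by simp
    qed
  qed (fact b bdense K q)+
  have "(\<lambda>x. A x - D x) = K" by (rule ext) (simp add: K_def)
  then show thesis using that[of D] bsd K schatten_bound[OF qp \<eta>(2)] by simp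
qed

theorem theorem1p1:
  fixes A :: "'a::chilbert_space \<Rightarrow> 'a" and p \<epsilon> :: real
  assumes "\<not> finite_cdim (UNIV :: 'a set)"
    and "separable_space (euclidean :: 'a topology)"
    and "skew_self_adjoint A"
    and "\<not> finite_cdim (null_space A) \<or>
         (finite_cdim (null_space A) \<and> even (complex_vector.dim (null_space A)))"
    and "1 < p"
    and "\<epsilon> > 0"
  shows "\<exists>D K :: 'a \<Rightarrow> 'a. block_skew_diagonal D \<and> skew_self_adjoint K \<and> schatten_class p K \<and>
           A = (\<lambda>x. K x + D x) \<and> schatten_norm p K < \<epsilon>"
proof -
  have A: "skew_antilinear A" by (rule skew_self_adjoint_imp_skew_antilinear[OF assms(3)])
  obtain Q U where QU: "pos_op Q" "\<And>x. Q (\<i> *\<^sub>C x) = \<i> *\<^sub>C Q x" "skew_antilinear U"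
    "\<And>x. U (Q x) = A x" "\<And>x. Q (U x) = A x" "\<And>x. A (U x) = U (A x)" "\<And>x. A x = 0 \<Longrightarrow> U x = 0"
    "\<And>x. \<forall>n. A n = 0 \<longrightarrow> inner x n = 0 \<Longrightarrow> U (U x) = - x"
    by (rule skew_antilinear_polar[OF A]) (rule that)
  obtain C where C: "C > 0" "\<And>x. norm (Q x) \<le> C * norm x"
    using selfadj_pos_bound[OF pos_opD(1)[OF QU(1)]] by metis
  interpret polar_decomposition A Q U C
    using A QU C odd_orthonormal_extend[OF csubspace_null_space[OF skew_antilinearD(2)[OF A]] assms(4)]
    by unfold_locales auto
  define q where "q = min p 2"
  have q: "1 < q" "q \<le> 2" and qp: "q \<le> p" using assms(5) by (auto simp: q_def)
  \<comment> \<open>The denominator cancels the factor 2^q (2 \<eta>) of the final estimate. The 1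
    in the minimum meets the hypothesis of \<open>schatten_bound\<close>, and halving \<epsilon>^p
    makes the final inequality strict.\<close>
  define \<eta> where "\<eta> = min 1 (\<epsilon> powr p / 2) / (2 * 2 powr q)"
  have \<eta>: "\<eta> > 0" using assms(6) by (simp add: \<eta>_def)
  have \<eta>2: "2 powr q * (2 * \<eta>) = min 1 (\<epsilon> powr p / 2)" by (simp add: \<eta>_def)
  obtain e f d r where seq: "\<And>n. new_block (map (\<lambda>i. (e i, f i, d i, r i)) [0..<n]) (e n) (f n) (d n) (r n)"
    "closure (cspan (range e \<union> range f)) = UNIV" "\<And>n. (\<Sum>i<n. r i powr q) \<le> \<eta>"
    by (rule ex_block_sequence[OF assms(1,2) q(1) \<eta>]) (rule that)
  have vecs: "block_vecs (map (\<lambda>i. (e i, f i, d i, r i)) [0..<n]) = e ` {..<n} \<union> f ` {..<n}" for n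
    by (auto simp: block_vecs_def)
  note blk = seq(1)[unfolded new_block_def vecs]
  have unit: "norm (e n) = 1" "norm (f n) = 1" "cinner (e n) (f n) = 0" and d: "\<bar>d n\<bar> \<le> C" for n
    using blk[of n] by blast+
  have orth: "cinner (e n) x = 0" "cinner (f n) x = 0" if "x \<in> e ` {..<n} \<union> f ` {..<n}" for n x
    using blk[of n] that by blast+
  have res: "\<exists>v w. norm v \<le> r n \<and> norm w \<le> r n \<and>
        A (e n) - d n *\<^sub>R f n - v \<in> cspan (e ` {..<n} \<union> f ` {..<n}) \<and>
        A (f n) + d n *\<^sub>R e n - w \<in> cspan (e ` {..<n} \<union> f ` {..<n})" for n
    using blk[of n] by (elim conjE)
  have \<eta>1: "2 powr q * (2 * \<eta>) \<le> 1" by (simp add: \<eta>2)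
  obtain D where D: "block_skew_diagonal D" "skew_antilinear (\<lambda>x. A x - D x)" "schatten_class p (\<lambda>x. A x - D x)"
    "(schatten_norm p (\<lambda>x. A x - D x)) powr p \<le> 2 powr q * (2 * \<eta>)"
    by (rule schatten_perturbation_from_blocks[OF A unit orth seq(2) d res q qp seq(3) \<eta>1]) (assumption | rule that)+
  have "(schatten_norm p (\<lambda>x. A x - D x)) powr p < \<epsilon> powr p"
  proof -
    have "min 1 (\<epsilon> powr p / 2) \<le> \<epsilon> powr p / 2" "0 < \<epsilon> powr p" using assms(6) by auto
    then show ?thesis using D(4) unfolding \<eta>2 by linarith
  qed
  then have "schatten_norm p (\<lambda>x. A x - D x) < \<epsilon>"
    using powr_mono2[of p \<epsilon> "schatten_norm p (\<lambda>x. A x - D x)"] assms(5,6) by linarith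
  with D show ?thesis
    by (intro exI[of _ D] exI[of _ "\<lambda>x. A x - D x"]) (auto intro: skew_antilinear_imp_skew_self_adjoint)
qed

end
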